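(* Let $P$ be a (constant) LTI system and $K(\mu)$, $\mu\in\mathcal{D}\subseteq\mathbb{R}^{n_\mu}$, a parameter-dependent LTI system, and let $G(\mu):(u_1,u_2)\mapsto(y_1,y_2)$ be their feedback interconnection defined by $y_1=u_1+P\,y_2$, $y_2=u_2+K(\mu)\,y_1$. Let $c(\mu)=\tfrac12\|G(\mu)\|_{\mathcal{H}_2}^2$ (with $c(\mu)=\infty$ if $G(\mu)$ is not asymptotically stable). Then $c$ is continuous (as an extended-real-valued function) at every $\mu\in\mathcal{D}$ if the following conditions hold: (i) the McMillan degree of $K(\mu)$ does not depend on $\mu$; (ii) $P(s)$ is a rational transfer function; (iii) each entry of the transfer matrix $K(\mu;s)$ is a rational transfer function whose numerator and denominator coefficients are continuous functions of $\mu$; (iv) $G(\mu)$ is strictly proper.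
   Context: The $\mathcal{H}_2$ inner product of asymptotically stable proper LTI systems $A,B$ is $\langle A,B\rangle_{\mathcal{H}_2}=\frac1{2\pi}\int_{-\infty}^\infty\mathrm{tr}(A(i\omega)B(-i\omega)^{\mathrm T})\,d\omega$, and is set to $\infty$ if either system is unstable; $\|G\|_{\mathcal{H}_2}^2=\langle G,G\rangle_{\mathcal{H}_2}$. *)

theory Defs
  imports "HOL-Analysis.Analysis"
          "HOL-Computational_Algebra.Polynomial_Factorial"
          "HOL-Computational_Algebra.Field_as_Ring"
          "HOL-Computational_Algebra.Normalized_Fraction"
          "Jordan_Normal_Form.Determinant"
          "Jordan_Normal_Form.DL_Submatrix"
begin

text \<open>
  A (rational) LTI system is represented by its transfer matrix, a matrix whose entries
  are real rational functions in the Laplace variable s, i.e. elements of the fraction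
  field of real polynomials.  Dimensions are carried by the Jordan_Normal_Form matrix.
\<close>

type_synonym tf = "real poly fract"

text \<open>Numerator / denominator in lowest terms (normalized, monic denominator).\<close>
definition tf_num :: "tf \<Rightarrow> real poly" where "tf_num f = fst (quot_of_fract f)"
definition tf_den :: "tf \<Rightarrow> real poly" where "tf_den f = snd (quot_of_fract f)"

definition tf_eval :: "tf \<Rightarrow> complex \<Rightarrow> complex" where
  "tf_eval f s = poly (map_poly complex_of_real (tf_num f)) s
                 / poly (map_poly complex_of_real (tf_den f)) s"

definition tfm_eval :: "tf mat \<Rightarrow> complex \<Rightarrow> complex mat" where
  "tfm_eval G s = mat (dim_row G) (dim_col G) (\<lambda>(i,j). tf_eval (G $$ (i,j)) s)"

definition mat_trace :: "'a::comm_monoid_add mat \<Rightarrow> 'a" where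
  "mat_trace A = (\<Sum>i<dim_row A. A $$ (i,i))"

definition tf_proper :: "tf \<Rightarrow> bool" where
  "tf_proper f \<longleftrightarrow> degree (tf_num f) \<le> degree (tf_den f)"

definition tf_strictly_proper :: "tf \<Rightarrow> bool" where
  "tf_strictly_proper f \<longleftrightarrow> tf_num f = 0 \<or> degree (tf_num f) < degree (tf_den f)"

definition tfm_strictly_proper :: "tf mat \<Rightarrow> bool" where
  "tfm_strictly_proper G \<longleftrightarrow>
     (\<forall>i<dim_row G. \<forall>j<dim_col G. tf_strictly_proper (G $$ (i,j)))"

definition tf_poles :: "tf \<Rightarrow> complex set" where
  "tf_poles f = {s. poly (map_poly complex_of_real (tf_den f)) s = 0}"

definition tfm_stable :: "tf mat \<Rightarrow> bool" where
  "tfm_stable G \<longleftrightarrow> (\<forall>i<dim_row G. \<forall>j<dim_col G.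
      tf_proper (G $$ (i,j)) \<and> (\<forall>s\<in>tf_poles (G $$ (i,j)). Re s < 0))"

text \<open>Squared H2 norm <G,G>_H2, as an extended real; \<infinity> if G is not asymptotically stable
  (and \<infinity> if the integral diverges).  The integrand tr(G(i w) G(-i w)^T) is real and
  nonnegative for real-rational G.\<close>
definition H2_norm_sq :: "tf mat \<Rightarrow> ereal" where
  "H2_norm_sq G = (if tfm_stable G then
      enn2ereal (ennreal (1 / (2 * pi)) *
        (\<integral>\<^sup>+ \<omega>. ennreal (Re (mat_trace (tfm_eval G (\<i> * complex_of_real \<omega>)
              * transpose_mat (tfm_eval G (- (\<i> * complex_of_real \<omega>)))))) \<partial>lborel))
    else \<infinity>)"

text \<open>McMillan degree (Kailath): total number of poles including those at infinity,
  i.e. degree of the pole polynomial (least common denominator of all minors of all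
  orders) plus the pole degree at infinity (that of G(1/s) at s = 0).\<close>
definition pole_poly :: "tf mat \<Rightarrow> real poly" where
  "pole_poly G = Lcm {tf_den (det (submatrix G I J)) | I J.
      I \<subseteq> {..<dim_row G} \<and> J \<subseteq> {..<dim_col G} \<and> card I = card J \<and> I \<noteq> {}}"

definition tf_const :: "real \<Rightarrow> tf" where "tf_const c = to_fract [:c:]"
definition tf_s :: tf where "tf_s = to_fract [:0, 1:]"

definition tf_subst_inv :: "tf \<Rightarrow> tf" where
  "tf_subst_inv f = poly (map_poly tf_const (tf_num f)) (inverse tf_s)
                    / poly (map_poly tf_const (tf_den f)) (inverse tf_s)"

definition mcmillan_degree :: "tf mat \<Rightarrow> nat" where
  "mcmillan_degree G = degree (pole_poly G)
      + order 0 (pole_poly (map_mat tf_subst_inv G))"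

text \<open>G is the feedback interconnection of P (n1 x n2) and K (n2 x n1):
  y1 = u1 + P y2, y2 = u2 + K y1, i.e. y = u + [[0,P],[K,0]] y, with y = G u.\<close>
definition feedback_interconnection :: "nat \<Rightarrow> nat \<Rightarrow> tf mat \<Rightarrow> tf mat \<Rightarrow> tf mat \<Rightarrow> bool" where
  "feedback_interconnection n1 n2 P K G \<longleftrightarrow>
     G \<in> carrier_mat (n1 + n2) (n1 + n2) \<and>
     G = 1\<^sub>m (n1 + n2) + four_block_mat (0\<^sub>m n1 n1) P K (0\<^sub>m n2 n2) * G"

end

theory Submission
  imports Defs
    "HOL-Computational_Algebra.Fundamental_Theorem_Algebra"
    "HOL-Probability.Sinc_Integral"
begin

text \<open>
  Put \<open>M = ((0, P), (K, 0))\<close>, so that \<open>G = (1 - M)\<^sup>-\<^sup>1\<close>. The minors of \<open>K\<close> are the maximal minors of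
  its graph, hence, cleared of denominators by the pole polynomial, homogeneous coordinates of
  degree exactly the McMillan degree without common zero, infinity included. If that degree is
  constant, a limit of normalised coordinates has no room for a common factor, so along a
  subsequence the coordinates converge coefficientwise to those of the limit system. By
  multilinearity, the closed-loop polynomial \<open>\<kappa> = q det (1 - M)\<close> (\<open>q\<close> the product of the pole
  polynomials of \<open>P\<close> and \<open>K\<close>) and the numerators \<open>\<kappa> G\<close> are combinations of products of these
  coordinates and converge as well.

  A minor of \<open>M\<close> times \<open>det G\<close> is a polynomial in the entries of \<open>G\<close>. Hence \<open>\<kappa>\<close> has no zero at a
  point where \<open>G\<close> is analytic, and has full degree if \<open>G\<close> is proper: stability of \<open>G\<close> means that \<open>\<kappa>\<close>
  is Hurwitz. If the limit \<open>\<kappa>\<close> is Hurwitz, then \<open>\<bar>\<kappa>(s)\<bar>\<close> is bounded below by a multiple of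
  \<open>(1 + \<bar>s\<bar>)\<close> to its degree, uniformly along the sequence and the closed right half plane, and
  dominated convergence applies. A limit root in the open right half
  plane makes the nearby systems unstable, and a pole of the limit on the imaginary axis makes
  the integrals diverge by Fatou's lemma.
\<close>

section \<open>Rational functions\<close>

text \<open>The obstacle is hidden cancellation. Convergent numerators and denominators may acquire
  a common root in the limit, or lose degree together; a pole of \<open>K\<close> then disappears
  from the limit although nearby systems still have it. The graph minors are Pluecker coordinates of
  the curve that sends \<open>s\<close> to the graph of \<open>K(s)\<close> in a Grassmannian. The
  McMillan degree is the degree of this curve, and splitting off a common factor in a limit would
  lower it. In the loop the coordinates of \<open>P\<close> and \<open>K\<close> multiply, so the
  total degree \<open>d + dP\<close> is again independent of the parameter. Properness of
  \<open>G\<close> at every parameter gives \<open>\<kappa>\<close> exactly this degree, so no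
  closed-loop root escapes to infinity. Coordinates are determined only up to a nonzero scalar,
  which cancels in the quotient of a numerator and \<open>\<kappa>\<close>. Compactness therefore
  yields the same limit whatever subsequence it selects, and this is enough for convergence of the
  whole sequence.\<close>

abbreviation cpoly :: "real poly \<Rightarrow> complex \<Rightarrow> complex" where
  "cpoly p s \<equiv> poly (map_poly complex_of_real p) s"

lemma cpoly_add [simp]: "cpoly (p + q) s = cpoly p s + cpoly q s"
proof -
  have "map_poly complex_of_real (p + q) = map_poly of_real p + map_poly of_real q"
    by (simp add: poly_eq_iff coeff_map_poly)
  then show ?thesis by simp
qed

lemma cpoly_mult [simp]: "cpoly (p * q) s = cpoly p s * cpoly q s"
proof -
  have "map_poly complex_of_real (p * q) = map_poly of_real p * map_poly of_real q"
    by (simp add: poly_eq_iff coeff_map_poly coeff_mult)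
  then show ?thesis by simp
qed

text \<open>The range of summation depends only on the bound \<open>d\<close>, so one formula serves
  all members of a sequence of varying degrees.\<close>

lemma cpoly_sum:
  assumes "degree p \<le> d"
  shows "cpoly p s = (\<Sum>k\<le>d. of_real (coeff p k) * s ^ k)"
proof -
  have "cpoly p s = (\<Sum>k\<le>degree p. of_real (coeff p k) * s ^ k)"
    by (simp add: poly_altdef degree_map_poly coeff_map_poly)
  also have "\<dots> = (\<Sum>k\<le>d. of_real (coeff p k) * s ^ k)"
    using assms by (intro sum.mono_neutral_left) (auto simp: coeff_eq_0)
  finally show ?thesis .
qed

lemma tf_den_nonzero [simp]: "tf_den f \<noteq> 0"
  by (simp add: tf_den_def)

lemma Fract_num_den: "Fract (tf_num f) (tf_den f) = f"
  by (simp add: tf_num_def tf_den_def)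

lemma coprime_num_den: "coprime (tf_num f) (tf_den f)"
  by (simp add: tf_num_def tf_den_def coprime_quot_of_fract)

lemma tf_eq_iff: "b \<noteq> 0 \<Longrightarrow> f = Fract a b \<longleftrightarrow> tf_num f * b = a * tf_den f"
  by (subst Fract_num_den [of f, symmetric]) (simp add: eq_fract)

lemma to_fract_mult_eq_iff:
  "to_fract p * f = to_fract q \<longleftrightarrow> p * tf_num f = q * tf_den f"
  by (subst Fract_num_den [of f, symmetric]) (simp add: to_fract_def eq_fract)

text \<open>Coprimality of \<open>tf_num f\<close> and \<open>tf_den f\<close> forces the
  divisibility. From here on rational functions are mostly handled through clearing equations
  \<open>to_fract b * f = to_fract a\<close>, in which \<open>a\<close> and \<open>b\<close> may
  share factors.\<close>

lemma den_dvd_iff: "tf_den f dvd p \<longleftrightarrow> (\<exists>q. to_fract p * f = to_fract q)"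
proof
  assume "tf_den f dvd p"
  then show "\<exists>q. to_fract p * f = to_fract q"
    unfolding to_fract_mult_eq_iff by (metis dvdE mult.assoc mult.commute)
next
  assume "\<exists>q. to_fract p * f = to_fract q"
  then have "tf_den f dvd p * tf_num f"
    by (auto simp: to_fract_mult_eq_iff)
  then show "tf_den f dvd p"
    using coprime_num_den [of f] coprime_commute coprime_dvd_mult_left_iff by blast
qed

lemma tf_num_0 [simp]: "tf_num 0 = 0" and tf_den_0 [simp]: "tf_den 0 = 1"
  and tf_num_1 [simp]: "tf_num 1 = 1" and tf_den_1 [simp]: "tf_den 1 = 1"
  by (simp_all add: tf_num_def tf_den_def)

lemma tf_num_eq_0_iff [simp]: "tf_num f = 0 \<longleftrightarrow> f = 0"
  by (simp add: tf_num_def)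

lemma tf_num_uminus [simp]: "tf_num (- f) = - tf_num f"
  and tf_den_uminus [simp]: "tf_den (- f) = tf_den f"
  by (simp_all add: tf_num_def tf_den_def quot_of_fract_uminus case_prod_beta Let_def)

text \<open>The index allows sequences of rational functions to be treated like single ones.\<close>
definition ring_closed :: "(('i \<Rightarrow> 'a::comm_ring_1) \<Rightarrow> bool) \<Rightarrow> bool" where
  "ring_closed Q \<longleftrightarrow> Q (\<lambda>_. 0) \<and> Q (\<lambda>_. 1) \<and> (\<forall>f. Q f \<longrightarrow> Q (\<lambda>x. - f x)) \<and>
     (\<forall>f g. Q f \<longrightarrow> Q g \<longrightarrow> Q (\<lambda>x. f x + g x)) \<and>
     (\<forall>f g. Q f \<longrightarrow> Q g \<longrightarrow> Q (\<lambda>x. f x * g x))"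

lemma ring_closedD:
  assumes "ring_closed Q"
  shows "Q (\<lambda>_. 0)" "Q (\<lambda>_. 1)" "Q f \<Longrightarrow> Q (\<lambda>x. - f x)"
    "Q f \<Longrightarrow> Q g \<Longrightarrow> Q (\<lambda>x. f x + g x)" "Q f \<Longrightarrow> Q g \<Longrightarrow> Q (\<lambda>x. f x * g x)"
  using assms by (auto simp: ring_closed_def)

lemma ring_closed_sum:
  assumes "ring_closed Q" and "finite S" and "\<And>s. s \<in> S \<Longrightarrow> Q (f s)"
  shows "Q (\<lambda>x. \<Sum>s\<in>S. f s x)"
  using assms(2,3) by (induction S rule: finite_induct) (auto intro!: ring_closedD[OF assms(1)])

lemma ring_closed_prod:
  assumes "ring_closed Q" and "finite S" and "\<And>s. s \<in> S \<Longrightarrow> Q (f s)"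
  shows "Q (\<lambda>x. \<Prod>s\<in>S. f s x)"
  using assms(2,3) by (induction S rule: finite_induct) (auto intro!: ring_closedD[OF assms(1)])

text \<open>The Leibniz formula uses ring operations only. Applied below to properness, to
  analyticity at a point and to convergence of fractions.\<close>

lemma ring_closed_det:
  assumes Q: "ring_closed Q" and A: "\<And>x. A x \<in> carrier_mat n n"
    and ent: "\<And>i j. i < n \<Longrightarrow> j < n \<Longrightarrow> Q (\<lambda>x. A x $$ (i,j))"
  shows "Q (\<lambda>x. det (A x))"
proof -
  have "Q (\<lambda>x. \<Sum>p\<in>{p. p permutes {0..<n}}. signof p * (\<Prod>i = 0..<n. A x $$ (i, p i)))"
  proof (rule ring_closed_sum[OF Q])
    show "finite {p. p permutes {0..<n}}" by (simp add: finite_permutations)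
    fix p assume "p \<in> {p. p permutes {0..<n}}"
    then have p: "p permutes {0..<n}" by simp
    have s: "Q (\<lambda>x. signof p)"
      by (cases p rule: sign_cases) (auto intro!: ring_closedD[OF Q])
    have "Q (\<lambda>x. \<Prod>i = 0..<n. A x $$ (i, p i))"
    proof (rule ring_closed_prod[OF Q])
      fix i assume i: "i \<in> {0..<n}"
      then have "p i < n" using permutes_in_image[OF p, of i] by auto
      then show "Q (\<lambda>x. A x $$ (i, p i))" using ent i by auto
    qed simp
    then show "Q (\<lambda>x. signof p * (\<Prod>i = 0..<n. A x $$ (i, p i)))"
      using ring_closedD(5)[OF Q, where f = "\<lambda>x. signof p"] s by blast
  qed
  then show ?thesis using det_def'[OF A] by simp
qed

definition analytic_at_point :: "complex \<Rightarrow> tf \<Rightarrow> bool" where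
  "analytic_at_point s f \<longleftrightarrow> cpoly (tf_den f) s \<noteq> 0"

lemma analytic_at_pointI:
  assumes "to_fract b * f = to_fract a" "cpoly b s \<noteq> 0"
  shows "analytic_at_point s f"
proof -
  have "tf_den f dvd b" using den_dvd_iff assms(1) by blast
  then show ?thesis using assms(2) by (auto simp: analytic_at_point_def elim!: dvdE)
qed

lemma to_fract_den_mult: "to_fract (tf_den f) * f = to_fract (tf_num f)"
  by (simp add: to_fract_mult_eq_iff)

lemma fract_op_eqs:
  assumes "to_fract b * f = to_fract a" "to_fract d * g = to_fract c"
  shows "to_fract b * (- f) = to_fract (- a)"
    "to_fract (b * d) * (f + g) = to_fract (a * d + c * b)"
    "to_fract (b * d) * (f * g) = to_fract (a * c)"
  using assms by (auto simp: algebra_simps simp flip: assms)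

text \<open>The rational functions without a pole at \<open>s\<close> form a local ring. A single
  function is encoded as a family over \<open>unit\<close>.\<close>

lemma analytic_at_point_ring: "ring_closed (\<lambda>f::unit \<Rightarrow> tf. analytic_at_point s (f ()))"
  unfolding ring_closed_def
proof (intro conjI allI impI)
  fix f g :: "unit \<Rightarrow> tf"
  note e = fract_op_eqs[OF to_fract_den_mult[of "f ()"] to_fract_den_mult[of "g ()"]]
  assume f: "analytic_at_point s (f ())"
  then show "analytic_at_point s (- f ())"
    by (simp add: analytic_at_point_def)
  assume g: "analytic_at_point s (g ())"
  have "cpoly (tf_den (f ()) * tf_den (g ())) s \<noteq> 0"
    using f g by (simp add: analytic_at_point_def)
  then show "analytic_at_point s (f () + g ())" "analytic_at_point s (f () * g ())"
    by (rule analytic_at_pointI[OF e(2)], rule analytic_at_pointI[OF e(3)])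
qed (simp_all add: analytic_at_point_def)

text \<open>Cancelling a common factor lowers both degrees by the same amount, so the comparison may
  be made on any representation.\<close>

lemma tf_properI:
  assumes "to_fract b * f = to_fract a" "b \<noteq> 0" "degree a \<le> degree b"
  shows "tf_proper f"
proof (cases "f = 0")
  case False
  have eq: "b * tf_num f = a * tf_den f" using assms(1) by (simp add: to_fract_mult_eq_iff)
  with False assms(2) have "a \<noteq> 0" by auto
  then show ?thesis using arg_cong[OF eq, of degree] False assms(2,3)
    by (simp add: degree_mult_eq tf_proper_def)
qed (simp add: tf_proper_def)

lemma tf_proper_ring: "ring_closed (\<lambda>f::unit \<Rightarrow> tf. tf_proper (f ()))"
  unfolding ring_closed_def
proof (intro conjI allI impI)
  fix f g :: "unit \<Rightarrow> tf"
  note e = fract_op_eqs[OF to_fract_den_mult[of "f ()"] to_fract_den_mult[of "g ()"]]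
  assume f: "tf_proper (f ())"
  then show "tf_proper (- f ())"
    by (simp add: tf_proper_def)
  assume g: "tf_proper (g ())"
  show "tf_proper (f () + g ())" 
    by (rule tf_properI[OF e(2)])
      (use f g in \<open>auto simp: tf_proper_def degree_mult_eq intro!: degree_add_le order_trans[OF degree_mult_le]\<close>)
  show "tf_proper (f () * g ())"
    by (rule tf_properI[OF e(3)])
      (use f g in \<open>auto simp: tf_proper_def degree_mult_eq intro!: order_trans[OF degree_mult_le]\<close>)
qed (simp_all add: tf_proper_def)

lemma tf_eval_eq:
  assumes "to_fract b * f = to_fract a" "cpoly b s \<noteq> 0"
  shows "tf_eval f s = cpoly a s / cpoly b s"
proof -
  have "cpoly (b * tf_num f) s = cpoly (a * tf_den f) s" 
    using assms(1) by (simp add: to_fract_mult_eq_iff)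
  moreover have "cpoly (tf_den f) s \<noteq> 0"
    using analytic_at_pointI[OF assms] by (simp add: analytic_at_point_def)
  ultimately show ?thesis using assms(2) by (simp add: tf_eval_def field_simps)
qed

section \<open>Minors of the graph of a matrix\<close>

text \<open>Rows are selected from the identity stacked on top of \<open>K\<close>; up to sign, the resulting
  determinants are the minors of \<open>K\<close> of all orders.\<close>
definition graph_mat :: "'a::comm_ring_1 mat \<Rightarrow> (nat \<Rightarrow> nat) \<Rightarrow> 'a mat" where
  "graph_mat K \<sigma> = mat (dim_col K) (dim_col K) (\<lambda>(i,j).
     if \<sigma> i < dim_col K then (if \<sigma> i = j then 1 else 0) else K $$ (\<sigma> i - dim_col K, j))"

definition graph_minor :: "'a::comm_ring_1 mat \<Rightarrow> (nat \<Rightarrow> nat) \<Rightarrow> 'a" where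
  "graph_minor K \<sigma> = det (graph_mat K \<sigma>)"

definition row_choices :: "'a mat \<Rightarrow> (nat \<Rightarrow> nat) set" where
  "row_choices K = {..<dim_col K} \<rightarrow>\<^sub>E {..<dim_col K + dim_row K}"

lemma graph_mat_carrier: "K \<in> carrier_mat r c \<Longrightarrow> graph_mat K \<sigma> \<in> carrier_mat c c"
  by (auto simp: graph_mat_def)

lemma finite_row_choices [simp]: "finite (row_choices K)"
  by (auto simp: row_choices_def intro: finite_PiE)

lemma graph_minor_restrict: "graph_minor K (restrict \<sigma> {..<dim_col K}) = graph_minor K \<sigma>"
  unfolding graph_minor_def by (rule arg_cong[where f = det]) (auto simp: graph_mat_def)

lemma restrict_row_choices:
  "(\<And>i. i < dim_col K \<Longrightarrow> \<sigma> i < dim_col K + dim_row K) \<Longrightarrow> restrict \<sigma> {..<dim_col K} \<in> row_choices K"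
  by (auto simp: row_choices_def)

text \<open>This selector gives the affine coordinate \<open>1\<close>; its homogeneous coordinate
  is the clearing polynomial itself.\<close>

lemma graph_minor_id: "graph_minor K (\<lambda>i. i) = 1"
proof -
  have "graph_mat K (\<lambda>i. i) = 1\<^sub>m (dim_col K)" by (auto simp: graph_mat_def)
  then show ?thesis by (simp add: graph_minor_def)
qed

section \<open>Determinants with unit rows, evaluated up to sign\<close>

lemma ex_permutes_extending:
  assumes f: "inj_on f {..<m}" "f ` {..<m} \<subseteq> {..<c::nat}"
  obtains \<alpha> where "\<alpha> permutes {..<c}" "\<And>i. i < m \<Longrightarrow> \<alpha> i = f i"
proof -
  have m: "m \<le> c" using card_inj_on_le[OF f] by simp
  have "card ({..<c} - f ` {..<m}) = card {m..<c}"
    using f by (simp add: card_Diff_subset card_image)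
  then obtain g where g: "bij_betw g {m..<c} ({..<c} - f ` {..<m})"
    by (metis finite_same_card_bij finite_Diff finite_atLeastLessThan finite_lessThan)
  define \<alpha> where "\<alpha> i = (if i < m then f i else if i < c then g i else i)" for i
  have "bij_betw \<alpha> {..<m} (f ` {..<m})"
    using f(1) by (auto simp: bij_betw_def \<alpha>_def inj_on_def)
  moreover have "bij_betw \<alpha> {m..<c} ({..<c} - f ` {..<m})"
    using g by (rule bij_betw_cong[THEN iffD1, rotated]) (auto simp: \<alpha>_def)
  ultimately have "bij_betw \<alpha> ({..<m} \<union> {m..<c}) (f ` {..<m} \<union> ({..<c} - f ` {..<m}))"
    by (rule bij_betw_combine) auto
  moreover have "{..<m} \<union> {m..<c} = {..<c}" "f ` {..<m} \<union> ({..<c} - f ` {..<m}) = {..<c}"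
    using m f(2) by auto
  ultimately have "\<alpha> permutes {..<c}"
    using m by (intro bij_imp_permutes) (auto simp: \<alpha>_def)
  then show ?thesis by (rule that) (simp add: \<alpha>_def)
qed

lemma signof_cases: "(signof p :: 'a::comm_ring_1) = 1 \<or> (signof p :: 'a) = -1"
  by (cases p rule: sign_cases) auto

lemma det_permute_rows_cols:
  fixes B :: "'a::comm_ring_1 mat"
  assumes B: "B \<in> carrier_mat c c" and \<alpha>: "\<alpha> permutes {..<c}" and \<beta>: "\<beta> permutes {..<c}"
  defines "B' \<equiv> mat c c (\<lambda>(i,j). B $$ (\<alpha> i, \<beta> j))"
  shows "det B = det B' \<or> det B = - det B'"
proof -
  define C where "C = mat c c (\<lambda>(i,j). B $$ (\<alpha> i, j))"
  have lt: "\<alpha> i < c" "\<beta> i < c" if "i < c" for i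
    using that permutes_in_image[OF \<alpha>] permutes_in_image[OF \<beta>] by auto
  have 1: "det C = signof \<alpha> * det B"
    unfolding C_def using det_permute_rows[OF B] \<alpha> by (simp add: atLeast0LessThan)
  have "transpose_mat B' = mat c c (\<lambda>(i,j). transpose_mat C $$ (\<beta> i, j))"
    using lt by (auto simp: B'_def C_def)
  then have "det (transpose_mat B') = signof \<beta> * det (transpose_mat C)"
    using det_permute_rows[of "transpose_mat C" c \<beta>] \<beta> by (simp add: atLeast0LessThan C_def)
  then have 2: "det B' = signof \<beta> * det C"
    using det_transpose[of B' c] det_transpose[of C c] by (simp add: B'_def C_def)
  show ?thesis
    using 1 2 signof_cases[of \<alpha>, where 'a = 'a] signof_cases[of \<beta>, where 'a = 'a] by auto
qed

text \<open>After the permutations the rows from \<open>m\<close> on are unit rows with their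
  \<open>1\<close> on the diagonal, so the matrix is block upper triangular with an identity block.
  The sign is left open because denominators, degrees and zeros ignore it.\<close>

lemma det_permuted_block:
  fixes B :: "'a::idom mat"
  assumes B: "B \<in> carrier_mat c c" and \<alpha>: "\<alpha> permutes {..<c}" and \<beta>: "\<beta> permutes {..<c}"
    and m: "m \<le> c"
    and unit: "\<And>i j. m \<le> i \<Longrightarrow> i < c \<Longrightarrow> j < c \<Longrightarrow> B $$ (\<alpha> i, \<beta> j) = (if i = j then 1 else 0)"
  defines "D \<equiv> mat m m (\<lambda>(i,j). B $$ (\<alpha> i, \<beta> j))"
  shows "det B = det D \<or> det B = - det D"
proof -
  have "mat c c (\<lambda>(i,j). B $$ (\<alpha> i, \<beta> j)) =
      four_block_mat D (mat m (c - m) (\<lambda>(i,j). B $$ (\<alpha> i, \<beta> (m + j)))) (0\<^sub>m (c - m) m) (1\<^sub>m (c - m))"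
    using m by (auto simp: D_def unit intro!: eq_matI)
  also have "det \<dots> = det D * det (1\<^sub>m (c - m))"
    by (rule det_four_block_mat_lower_left_zero) (auto simp: D_def)
  finally show ?thesis using det_permute_rows_cols[OF B \<alpha> \<beta>] by simp
qed

lemma pick_props:
  assumes "finite S"
  shows "inj_on (pick S) {..<card S}" "pick S ` {..<card S} = S"
proof -
  show inj: "inj_on (pick S) {..<card S}"
    by (rule inj_onI) (metis lessThan_iff linorder_neqE_nat nat_neq_iff pick_mono_le)
  show "pick S ` {..<card S} = S"
    by (rule card_subset_eq[OF assms]) (auto simp: pick_in_set_le card_image[OF inj])
qed

definition minor_indices :: "'a mat \<Rightarrow> (nat set \<times> nat set) set" where
  "minor_indices K = {(I, J). I \<subseteq> {..<dim_row K} \<and> J \<subseteq> {..<dim_col K} \<and> card I = card J \<and> I \<noteq> {}}"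

lemma submatrix_eq:
  assumes "I \<subseteq> {..<dim_row K}" "J \<subseteq> {..<dim_col K}"
  shows "submatrix K I J = mat (card I) (card J) (\<lambda>(i,j). K $$ (pick I i, pick J j))"
proof -
  have "{i. i < dim_row K \<and> i \<in> I} = I" "{i. i < dim_col K \<and> i \<in> J} = J" using assms by auto
  then show ?thesis by (simp add: submatrix_def)
qed

text \<open>Replace the rows of the identity with index in \<open>J\<close> by the rows of
  \<open>K\<close> with index in \<open>I\<close>. Expansion along the remaining unit rows deletes
  exactly the columns outside \<open>J\<close>.\<close>

lemma minor_as_graph_minor:
  fixes K :: "'a::idom mat"
  assumes "(I, J) \<in> minor_indices K"
  shows "\<exists>\<sigma>\<in>row_choices K. graph_minor K \<sigma> = det (submatrix K I J) \<or>
           graph_minor K \<sigma> = - det (submatrix K I J)"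
proof -
  define c where "c = dim_col K"
  define r where "r = dim_row K"
  define m where "m = card J"
  have I: "I \<subseteq> {..<r}" and J: "J \<subseteq> {..<c}" and IJ: "card I = card J"
    using assms by (auto simp: minor_indices_def c_def r_def)
  have fin: "finite I" "finite J" using I J finite_subset by blast+
  \<comment> \<open>\<open>\<alpha>\<close> lists the elements of \<open>J\<close> first, in
    increasing order; it serves for rows and columns alike.\<close>
  obtain \<alpha> where \<alpha>: "\<alpha> permutes {..<c}" "\<And>i. i < m \<Longrightarrow> \<alpha> i = pick J i"
    using ex_permutes_extending[of "pick J" m c] pick_props[OF fin(2)] J unfolding m_def by metis
  have m: "m \<le> c" using card_mono[OF _ J] by (simp add: m_def)
  have \<alpha>lt: "\<alpha> i < c" if "i < c" for i
    using that permutes_in_image[OF \<alpha>(1)] by auto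
  have \<alpha>_eq: "\<alpha> i = \<alpha> j \<longleftrightarrow> i = j" for i j
    using permutes_inj[OF \<alpha>(1)] by (rule inj_eq)
  have \<alpha>J: "\<alpha> i \<in> J \<longleftrightarrow> i < m" for i
  proof
    assume "\<alpha> i \<in> J"
    then obtain k where "k < m" "\<alpha> i = \<alpha> k"
      using pick_props(2)[OF fin(2)] \<alpha>(2) by (metis imageE lessThan_iff m_def)
    then show "i < m" by (simp add: \<alpha>_eq)
  qed (use \<alpha>(2) in \<open>simp add: m_def pick_in_set_le\<close>)
  define \<sigma> where "\<sigma> k = (if k \<in> J then c + pick I (inv_into UNIV \<alpha> k) else k)" for k
  have \<sigma>\<alpha>: "\<sigma> (\<alpha> i) = (if i < m then c + pick I i else \<alpha> i)" for i
    using \<alpha>J by (simp add: \<sigma>_def permutes_inverses[OF \<alpha>(1)])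
  have pI: "pick I i < r" if "i < m" for i
    using that I IJ pick_in_set_le[of i I] by (auto simp: m_def)
  have sel: "\<sigma> k < c + r" if "k < c" for k
    using that \<sigma>\<alpha>[of "inv_into UNIV \<alpha> k"] pI by (auto simp: permutes_inverses[OF \<alpha>(1)] split: if_splits)
  let ?B = "graph_mat K \<sigma>"
  have B: "?B \<in> carrier_mat c c" by (auto simp: graph_mat_def c_def)
  have Bidx: "?B $$ (\<alpha> i, \<alpha> j) = (if i < m then K $$ (pick I i, \<alpha> j) else if i = j then 1 else 0)"
    if "i < c" "j < c" for i j
    using that \<alpha>lt[of i] \<alpha>lt[of j]
    by (auto simp: graph_mat_def \<sigma>\<alpha> \<alpha>_eq simp flip: c_def)
  have "det ?B = det (mat m m (\<lambda>(i,j). ?B $$ (\<alpha> i, \<alpha> j))) \<or>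
        det ?B = - det (mat m m (\<lambda>(i,j). ?B $$ (\<alpha> i, \<alpha> j)))"
    by (rule det_permuted_block[OF B \<alpha>(1) \<alpha>(1) m]) (simp add: Bidx)
  also have "mat m m (\<lambda>(i,j). ?B $$ (\<alpha> i, \<alpha> j)) = mat m m (\<lambda>(i,j). K $$ (pick I i, pick J j))"
    using m by (intro cong_mat) (auto simp: Bidx, simp add: \<alpha>(2))
  also have "\<dots> = submatrix K I J"
    using I J IJ by (subst submatrix_eq) (auto simp: c_def r_def m_def)
  finally have "graph_minor K \<sigma> = det (submatrix K I J) \<or> graph_minor K \<sigma> = - det (submatrix K I J)"
    by (simp add: graph_minor_def)
  moreover have "restrict \<sigma> {..<dim_col K} \<in> row_choices K"
    by (rule restrict_row_choices) (use sel in \<open>auto simp: c_def r_def\<close>)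
  ultimately show ?thesis using graph_minor_restrict by metis
qed

text \<open>A repeated selector gives two equal rows. Otherwise the positions in \<open>T\<close>
  select rows of \<open>K\<close> and those in \<open>U\<close> distinct unit rows; expansion along
  the latter leaves the columns \<open>J\<close> that no unit row occupies. With no row of
  \<open>K\<close> selected, the empty minor \<open>1\<close> remains.\<close>

lemma graph_minor_cases:
  fixes K :: "'a::idom mat"
  assumes "\<sigma> \<in> row_choices K"
  shows "graph_minor K \<sigma> \<in> {0, 1, -1} \<or> (\<exists>(I,J)\<in>minor_indices K.
    graph_minor K \<sigma> = det (submatrix K I J) \<or> graph_minor K \<sigma> = - det (submatrix K I J))"
proof -
  define c where "c = dim_col K"
  define r where "r = dim_row K"
  let ?B = "graph_mat K \<sigma>"
  have B: "?B \<in> carrier_mat c c" by (auto simp: graph_mat_def c_def)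
  have sel: "\<sigma> k < c + r" if "k < c" for k
    using assms that by (auto simp: row_choices_def c_def r_def)
  show ?thesis
  proof (cases "inj_on \<sigma> {..<c}")
    case False
    then obtain i j where ij: "i < c" "j < c" "i \<noteq> j" "\<sigma> i = \<sigma> j" by (auto simp: inj_on_def)
    then have "row ?B i = row ?B j"
      by (intro eq_vecI) (auto simp: graph_mat_def c_def)
    then have "det ?B = 0" using det_identical_rows[OF B ij(3,1,2)] by simp
    then show ?thesis by (simp add: graph_minor_def)
  next
    case inj: True
    define T where "T = {i. i < c \<and> \<sigma> i \<ge> c}"
    define U where "U = {i. i < c \<and> \<sigma> i < c}"
    define I where "I = (\<lambda>i. \<sigma> i - c) ` T"
    define J where "J = {..<c} - \<sigma> ` U"
    define m where "m = card T"
    have fin: "finite T" "finite U" "finite I" "finite J" by (auto simp: T_def U_def I_def J_def)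
    have "inj_on (\<lambda>i. \<sigma> i - c) T"
      using inj by (auto simp: T_def inj_on_def)
    then have cI: "card I = m" by (simp add: I_def m_def card_image)
    have "card T + card U = card (T \<union> U)" by (subst card_Un_disjoint) (auto simp: T_def U_def)
    also have "T \<union> U = {..<c}" by (auto simp: T_def U_def)
    finally have TU: "card T + card U = c" by simp
    have "card (\<sigma> ` U) = card U" using inj by (intro card_image) (auto simp: U_def inj_on_def)
    then have cJ: "card J = m"
      using TU fin by (subst J_def, subst card_Diff_subset) (auto simp: U_def m_def)
    have I: "I \<subseteq> {..<r}" using sel by (fastforce simp: I_def T_def)
    have J: "J \<subseteq> {..<c}" by (auto simp: J_def)
    \<comment> \<open>\<open>f i\<close> is the position in \<open>T\<close> at which row
      \<open>pick I i\<close> of \<open>K\<close> was selected; it sorts these rows in the order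
      used by \<open>submatrix\<close>.\<close>
    define f where "f i = (SOME t. t \<in> T \<and> \<sigma> t - c = pick I i)" for i
    have f: "f i \<in> T \<and> \<sigma> (f i) - c = pick I i" if "i < m" for i
    proof -
      have "pick I i \<in> I" using that cI by (simp add: pick_in_set_le)
      then have "\<exists>t. t \<in> T \<and> \<sigma> t - c = pick I i" by (auto simp: I_def)
      then show ?thesis unfolding f_def by (rule someI_ex)
    qed
    have f_inj: "inj_on f {..<m}"
      using pick_props(1)[OF fin(3)] f unfolding cI inj_on_def by (metis lessThan_iff)
    have "f ` {..<m} \<subseteq> {..<c}" using f by (auto simp: T_def)
    then obtain \<alpha> where \<alpha>: "\<alpha> permutes {..<c}" "\<And>i. i < m \<Longrightarrow> \<alpha> i = f i"
      using ex_permutes_extending[OF f_inj] by blast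
    have m: "m \<le> c" using TU by (simp add: m_def)
    have \<alpha>lt: "\<alpha> i < c" if "i < c" for i
      using that permutes_in_image[OF \<alpha>(1)] by auto
    have \<alpha>_eq: "\<alpha> i = \<alpha> j \<longleftrightarrow> i = j" for i j
    using permutes_inj[OF \<alpha>(1)] by (rule inj_eq)
    have fT: "f ` {..<m} = T"
    proof (rule card_subset_eq[OF fin(1)])
      show "f ` {..<m} \<subseteq> T" using f by auto
      show "card (f ` {..<m}) = card T" using card_image[OF f_inj] by (simp add: m_def)
    qed
    have \<alpha>U: "\<alpha> i \<in> U" if "m \<le> i" "i < c" for i
    proof (rule ccontr)
      assume "\<alpha> i \<notin> U"
      then have "\<alpha> i \<in> T" using \<alpha>lt[OF that(2)] by (auto simp: T_def U_def)
      then have "\<alpha> i \<in> f ` {..<m}" by (simp add: fT)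
      then obtain k where "k < m" "\<alpha> i = f k" by blast
      then have "k < m" "\<alpha> i = \<alpha> k" using \<alpha>(2) by simp_all
      then show False using that by (simp add: \<alpha>_eq)
    qed
    \<comment> \<open>For \<open>m \<le> i\<close>, column \<open>\<beta> i\<close> is the one
      occupied by the unit row at position \<open>\<alpha> i\<close>; this puts the identity block
      on the diagonal.\<close>
    define \<beta> where "\<beta> i = (if i < m then pick J i else if i < c then \<sigma> (\<alpha> i) else i)" for i
    have "inj_on \<beta> {..<c}"
    proof (rule inj_onI)
      fix i j assume ij: "i \<in> {..<c}" "j \<in> {..<c}" "\<beta> i = \<beta> j"
      have nJ: "\<sigma> (\<alpha> k) \<notin> J" if "m \<le> k" "k < c" for k
        using \<alpha>U[OF that] by (auto simp: J_def)
      have pJ: "pick J k \<in> J" if "k < m" for k using that cJ by (simp add: pick_in_set_le)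
      consider "i < m" "j < m" | "m \<le> i" "m \<le> j" | "i < m" "m \<le> j" | "m \<le> i" "j < m" by linarith
      then show "i = j"
      proof cases
        case 1
        then show ?thesis using ij pick_props(1)[OF fin(4)] cJ by (auto simp: \<beta>_def inj_on_def)
      next
        case 2
        then have "\<sigma> (\<alpha> i) = \<sigma> (\<alpha> j)" using ij by (auto simp: \<beta>_def)
        then have "\<alpha> i = \<alpha> j" using inj ij \<alpha>lt by (auto simp: inj_on_def)
        then show ?thesis by (simp add: \<alpha>_eq)
      qed (use ij nJ pJ in \<open>force simp: \<beta>_def\<close>)+
    qed
    moreover have "\<beta> ` {..<c} \<subseteq> {..<c}"
      using J cJ pick_in_set_le[of _ J] \<alpha>U by (auto simp: \<beta>_def U_def)
    ultimately have "bij_betw \<beta> {..<c} {..<c}"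
      by (simp add: bij_betw_def endo_inj_surj)
    then have \<beta>: "\<beta> permutes {..<c}"
      using m by (intro bij_imp_permutes) (auto simp: \<beta>_def)
    have Bidx: "?B $$ (\<alpha> i, \<beta> j) = (if i < m then K $$ (pick I i, \<beta> j) else if i = j then 1 else 0)"
      if "i < c" "j < c" for i j
    proof (cases "i < m")
      case True
      then show ?thesis using that \<alpha>lt[of i] f[of i] \<alpha>(2)[of i] permutes_in_image[OF \<beta>, of j]
        by (auto simp: graph_mat_def T_def simp flip: c_def)
    next
      case False
      then have "\<sigma> (\<alpha> i) = \<beta> i" "\<beta> i < c" using that \<alpha>U[of i] by (auto simp: \<beta>_def U_def)
      then show ?thesis using False that \<alpha>lt[of i] permutes_in_image[OF \<beta>, of j]
          inj_eq[OF permutes_inj[OF \<beta>], of i j]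
        by (auto simp: graph_mat_def simp flip: c_def)
    qed
    have "det ?B = det (mat m m (\<lambda>(i,j). ?B $$ (\<alpha> i, \<beta> j))) \<or>
          det ?B = - det (mat m m (\<lambda>(i,j). ?B $$ (\<alpha> i, \<beta> j)))"
      by (rule det_permuted_block[OF B \<alpha>(1) \<beta> m]) (simp add: Bidx)
    also have "mat m m (\<lambda>(i,j). ?B $$ (\<alpha> i, \<beta> j)) = mat m m (\<lambda>(i,j). K $$ (pick I i, pick J j))"
      using m by (intro cong_mat) (auto simp: Bidx, simp add: \<beta>_def)
    also have "\<dots> = submatrix K I J"
      using I J cI cJ by (subst submatrix_eq) (auto simp: c_def r_def)
    finally have *: "graph_minor K \<sigma> = det (submatrix K I J) \<or> graph_minor K \<sigma> = - det (submatrix K I J)"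
      by (simp add: graph_minor_def)
    show ?thesis
    proof (cases "I = {}")
      case True
      then have "submatrix K I J \<in> carrier_mat 0 0"
        using I J cI cJ by (subst submatrix_eq) (auto simp: c_def r_def)
      then have "det (submatrix K I J) = 1" by (rule det_dim_zero)
      then show ?thesis using * by auto
    next
      case False
      then have "(I, J) \<in> minor_indices K" 
        using I J cI cJ by (auto simp: minor_indices_def c_def r_def)
      then show ?thesis using * by auto
    qed
  qed
qed

section \<open>Feedback matrices\<close>

definition feedback_mat :: "nat \<Rightarrow> nat \<Rightarrow> 'a::comm_ring_1 mat \<Rightarrow> 'a mat \<Rightarrow> 'a mat" where
  "feedback_mat n1 n2 P K = four_block_mat (0\<^sub>m n1 n1) P K (0\<^sub>m n2 n2)"

lemma feedback_mat_carrier: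
  "P \<in> carrier_mat n1 n2 \<Longrightarrow> K \<in> carrier_mat n2 n1 \<Longrightarrow> feedback_mat n1 n2 P K \<in> carrier_mat (n1 + n2) (n1 + n2)"
  by (auto simp: feedback_mat_def intro!: four_block_carrier_mat)

lemma feedback_mat_index:
  assumes "P \<in> carrier_mat n1 n2" "K \<in> carrier_mat n2 n1" "i < n1 + n2" "j < n1 + n2"
  shows "feedback_mat n1 n2 P K $$ (i,j) =
    (if i < n1 then if j < n1 then 0 else P $$ (i, j - n1)
     else if j < n1 then K $$ (i - n1, j) else 0)"
  using assms by (auto simp: feedback_mat_def)

text \<open>The easy half of the Frobenius-Koenig theorem: the rows in \<open>T\<close> live on
  fewer columns than there are rows, so every permutation in the Leibniz formula meets a zero
  entry.\<close>

lemma det_eq_0_if_zero_block: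
  fixes B :: "'a::idom mat"
  assumes B: "B \<in> carrier_mat n n" and T: "T \<subseteq> {..<n}" and C: "C \<subseteq> {..<n}" and card: "card C < card T"
    and zero: "\<And>i j. i \<in> T \<Longrightarrow> j < n \<Longrightarrow> j \<notin> C \<Longrightarrow> B $$ (i,j) = 0"
  shows "det B = 0"
proof -
  have "(\<Prod>i = 0..<n. B $$ (i, p i)) = 0" if p: "p permutes {0..<n}" for p
  proof -
    have "\<exists>i\<in>T. p i \<notin> C"
    proof (rule ccontr)
      assume "\<not> ?thesis"
      then have "p ` T \<subseteq> C" by auto
      moreover have "inj_on p T" using permutes_inj[OF p] by (rule inj_on_subset) simp
      ultimately have "card T \<le> card C"
        using card_inj_on_le finite_subset[OF C] by blast
      then show False using card by simp
    qed
    then obtain i where i: "i \<in> T" "p i \<notin> C" by blast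
    then have "i < n" using T by auto
    moreover from this have "p i < n" using permutes_in_image[OF p, of i] by simp
    ultimately show ?thesis using zero[OF i(1) _ i(2)] by (intro prod_zero) auto
  qed
  then show ?thesis unfolding det_def'[OF B] by (intro sum.neutral) auto
qed

text \<open>Every row of the graph of \<open>M\<close> lives either on the first \<open>n1\<close>
  columns (unit rows below \<open>n1\<close>, rows of \<open>K\<close>) or on the last
  \<open>n2\<close> columns (other unit rows, rows of \<open>P\<close>). A nonzero minor needs
  exactly \<open>n1\<close> rows of the first kind; sorting by kind makes the matrix block
  diagonal.\<close>

lemma graph_minor_feedback_cases:
  fixes P K :: "'a::idom mat"
  assumes P: "P \<in> carrier_mat n1 n2" and K: "K \<in> carrier_mat n2 n1"
    and \<tau>: "\<tau> \<in> row_choices (feedback_mat n1 n2 P K)"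
  defines "M \<equiv> feedback_mat n1 n2 P K"
  shows "graph_minor M \<tau> = 0 \<or> (\<exists>\<sigma>\<in>row_choices K. \<exists>\<sigma>'\<in>row_choices P.
     graph_minor M \<tau> = graph_minor K \<sigma> * graph_minor P \<sigma>' \<or>
     graph_minor M \<tau> = - (graph_minor K \<sigma> * graph_minor P \<sigma>'))"
proof -
  define n where "n = n1 + n2"
  have M: "M \<in> carrier_mat n n" using feedback_mat_carrier[OF P K] by (simp add: M_def n_def)
  let ?B = "graph_mat M \<tau>"
  have B: "?B \<in> carrier_mat n n" by (rule graph_mat_carrier[OF M])
  have \<tau>lt: "\<tau> i < n + n" if "i < n" for i
    using \<tau> M that by (auto simp: row_choices_def simp flip: M_def)
  have Bidx: "?B $$ (i,j) = (if \<tau> i < n then (if \<tau> i = j then 1 else 0) else M $$ (\<tau> i - n, j))"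
    if "i < n" "j < n" for i j
    using that M by (auto simp: graph_mat_def)
  have Midx: "M $$ (i,j) = (if i < n1 then if j < n1 then 0 else P $$ (i, j - n1)
     else if j < n1 then K $$ (i - n1, j) else 0)" if "i < n" "j < n" for i j
    using feedback_mat_index[OF P K] that by (simp add: M_def n_def)
  define T where "T = {i. i < n \<and> (\<tau> i < n1 \<or> n + n1 \<le> \<tau> i)}"
  have zero1: "?B $$ (i,j) = 0" if "i \<in> T" "j < n" "n1 \<le> j" for i j
    using that \<tau>lt[of i] by (auto simp: T_def Bidx Midx)
  have zero2: "?B $$ (i,j) = 0" if "i < n" "i \<notin> T" "j < n1" for i j
    using that \<tau>lt[of i] by (auto simp: T_def Bidx Midx n_def)
  have finT: "finite T" "T \<subseteq> {..<n}" by (auto simp: T_def)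
  consider "card T > n1" | "card T < n1" | "card T = n1" by linarith
  then show ?thesis
  proof cases
    case 1
    have "det ?B = 0"
      by (rule det_eq_0_if_zero_block[OF B finT(2), of "{..<n1}"])
        (use 1 zero1 in \<open>auto simp: n_def\<close>)
    then show ?thesis by (simp add: graph_minor_def)
  next
    case 2
    have "card ({..<n} - T) > n2"
      using 2 finT by (subst card_Diff_subset) (auto simp: n_def)
    then have "det ?B = 0"
      by (intro det_eq_0_if_zero_block[OF B, of "{..<n} - T" "{n1..<n}"])
        (use zero2 in \<open>auto simp: n_def\<close>)
    then show ?thesis by (simp add: graph_minor_def)
  next
    case 3
    have "\<exists>f. bij_betw f {..<n1} T"
      using 3 finT by (intro finite_same_card_bij) auto
    then obtain f where f: "bij_betw f {..<n1} T" by blast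
    then obtain \<alpha> where \<alpha>: "\<alpha> permutes {..<n}" "\<And>i. i < n1 \<Longrightarrow> \<alpha> i = f i"
      using ex_permutes_extending[of f n1 n] finT(2) by (auto simp: bij_betw_def)
    have \<alpha>_eq: "\<alpha> i = \<alpha> j \<longleftrightarrow> i = j" for i j
      using permutes_inj[OF \<alpha>(1)] by (rule inj_eq)
    have \<alpha>lt: "\<alpha> i < n" if "i < n" for i
      using that permutes_in_image[OF \<alpha>(1)] by auto
    have \<alpha>T: "\<alpha> i \<in> T \<longleftrightarrow> i < n1" for i
    proof
      assume "\<alpha> i \<in> T"
      then obtain k where "k < n1" "\<alpha> i = f k" using f by (auto simp: bij_betw_def)
      then have "\<alpha> i = \<alpha> k" "k < n1" using \<alpha>(2)[of k] by simp_all
      then show "i < n1" by (simp add: \<alpha>_eq)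
    next
      assume "i < n1"
      then show "\<alpha> i \<in> T" using \<alpha>(2) f by (auto simp: bij_betw_def)
    qed
    \<comment> \<open>Row \<open>r\<close> of \<open>K\<close> has the number
      \<open>n + n1 + r\<close> in the graph of \<open>M\<close> and \<open>n1 + r\<close> in that
      of \<open>K\<close>. For \<open>P\<close> the unit rows shift by \<open>n1\<close>, and row
      \<open>r\<close> goes from \<open>n + r\<close> to \<open>n2 + r\<close>.\<close>
    define \<sigma> where "\<sigma> i = (if \<tau> (\<alpha> i) < n1 then \<tau> (\<alpha> i) else \<tau> (\<alpha> i) - n)" for i
    define \<sigma>' where "\<sigma>' i = (if \<tau> (\<alpha> (n1 + i)) < n then \<tau> (\<alpha> (n1 + i)) - n1
        else n2 + (\<tau> (\<alpha> (n1 + i)) - n))" for i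
    have \<sigma>: "restrict \<sigma> {..<dim_col K} \<in> row_choices K"
    proof (rule restrict_row_choices)
      fix i assume "i < dim_col K"
      then have "i < n1" using K by simp
      then show "\<sigma> i < dim_col K + dim_row K"
        using K \<alpha>lt[of i] \<tau>lt[of "\<alpha> i"] by (auto simp: \<sigma>_def n_def)
    qed
    have nT: "\<not> \<tau> (\<alpha> (n1 + i)) < n1" "\<tau> (\<alpha> (n1 + i)) < n + n1" if "i < n2" for i
      using \<alpha>T[of "n1 + i"] \<alpha>lt[of "n1 + i"] that by (auto simp: T_def n_def)
    have \<sigma>': "restrict \<sigma>' {..<dim_col P} \<in> row_choices P"
    proof (rule restrict_row_choices)
      fix i assume "i < dim_col P"
      then have "i < n2" using P by simp
      then show "\<sigma>' i < dim_col P + dim_row P"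
        using P nT[of i] by (auto simp: \<sigma>'_def n_def)
    qed
    have "mat n n (\<lambda>(i,j). ?B $$ (\<alpha> i, j)) =
       four_block_mat (graph_mat K \<sigma>) (0\<^sub>m n1 n2) (0\<^sub>m n2 n1) (graph_mat P \<sigma>')" (is "?L = ?R")
    proof (rule eq_matI)
      show "dim_row ?L = dim_row ?R" "dim_col ?L = dim_col ?R"
        using P K by (auto simp: n_def graph_mat_def)
      fix i j assume "i < dim_row ?R" "j < dim_col ?R"
      then have ij: "i < n" "j < n" using P K by (auto simp: n_def graph_mat_def)
      show "?L $$ (i,j) = ?R $$ (i,j)"
      proof (cases "i < n1")
        case True
        then have \<tau>\<alpha>: "\<tau> (\<alpha> i) < n1 \<or> n + n1 \<le> \<tau> (\<alpha> i)" "\<tau> (\<alpha> i) < n + n"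
          using \<alpha>T[of i] \<alpha>lt[of i] \<tau>lt[of "\<alpha> i"] ij by (auto simp: T_def)
        show ?thesis
        proof (cases "j < n1")
          case True
          have "?L $$ (i,j) = (if \<tau> (\<alpha> i) < n1 then (if \<tau> (\<alpha> i) = j then 1 else 0)
              else K $$ (\<tau> (\<alpha> i) - n - n1, j))"
            using \<tau>\<alpha> True ij \<alpha>lt[of i] by (auto simp: Bidx Midx n_def)
          also have "\<dots> = ?R $$ (i,j)"
            using \<open>i < n1\<close> True \<tau>\<alpha> P K ij by (auto simp: graph_mat_def \<sigma>_def n_def)
          finally show ?thesis .
        next
          case False
          then show ?thesis using \<open>i < n1\<close> ij P K zero1[of "\<alpha> i" j] \<alpha>T[of i] by (auto simp: graph_mat_def n_def)
        qed
      next
        case False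
        define i' where "i' = i - n1"
        have i': "i = n1 + i'" "i' < n2" using False ij by (auto simp: i'_def n_def)
        show ?thesis
        proof (cases "j < n1")
          case True
          then show ?thesis using False ij P K zero2[of "\<alpha> i" j] \<alpha>T[of i] \<alpha>lt[of i] by (auto simp: graph_mat_def n_def)
        next
          case nj: False
          define j' where "j' = j - n1"
          have j': "j = n1 + j'" "j' < n2" using nj ij by (auto simp: j'_def n_def)
          have "?L $$ (i,j) = (if \<tau> (\<alpha> i) < n then (if \<tau> (\<alpha> i) = j then 1 else 0)
              else P $$ (\<tau> (\<alpha> i) - n, j'))"
            using nT[OF i'(2)] i' j' ij \<alpha>lt[of i] by (auto simp: Bidx Midx)
          also have "\<dots> = ?R $$ (i,j)"
            using i' j' nT[OF i'(2)] P K ij by (auto simp: graph_mat_def \<sigma>'_def n_def)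
          finally show ?thesis .
        qed
      qed
    qed
    moreover have "det ?R = det (graph_mat K \<sigma>) * det (graph_mat P \<sigma>')"
      by (rule det_four_block_mat_lower_left_zero) (use P K in \<open>auto simp: graph_mat_def\<close>)
    moreover have "det ?B = det (mat n n (\<lambda>(i,j). ?B $$ (\<alpha> i, j))) \<or>
        det ?B = - det (mat n n (\<lambda>(i,j). ?B $$ (\<alpha> i, j)))"
      using det_permute_rows_cols[OF B \<alpha>(1) permutes_id] by simp
    ultimately have "graph_minor M \<tau> = graph_minor K \<sigma> * graph_minor P \<sigma>' \<or>
       graph_minor M \<tau> = - (graph_minor K \<sigma> * graph_minor P \<sigma>')"
      by (simp add: graph_minor_def)
    then show ?thesis using \<sigma> \<sigma>' graph_minor_restrict[of K \<sigma>] graph_minor_restrict[of P \<sigma>'] by metis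
  qed
qed

text \<open>The same block structure read backwards. That all products occur as coordinates is what
  keeps the loop family free of common zeros.\<close>

lemma graph_minor_mult_feedback:
  fixes P K :: "'a::idom mat"
  assumes P: "P \<in> carrier_mat n1 n2" and K: "K \<in> carrier_mat n2 n1"
    and \<sigma>: "\<sigma> \<in> row_choices K" and \<sigma>': "\<sigma>' \<in> row_choices P"
  defines "M \<equiv> feedback_mat n1 n2 P K"
  shows "\<exists>\<tau>\<in>row_choices M. graph_minor M \<tau> = graph_minor K \<sigma> * graph_minor P \<sigma>'"
proof -
  define n where "n = n1 + n2"
  have M: "M \<in> carrier_mat n n" using feedback_mat_carrier[OF P K] by (simp add: M_def n_def)
  have Midx: "M $$ (i,j) = (if i < n1 then if j < n1 then 0 else P $$ (i, j - n1)
     else if j < n1 then K $$ (i - n1, j) else 0)" if "i < n" "j < n" for i j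
    using feedback_mat_index[OF P K] that by (simp add: M_def n_def)
  have lt: "\<sigma> i < n1 + n2" if "i < n1" for i
    using \<sigma> K that by (auto simp: row_choices_def)
  have lt': "\<sigma>' i < n2 + n1" if "i < n2" for i
    using \<sigma>' P that by (auto simp: row_choices_def)
  define \<tau> where "\<tau> i = (if i < n1 then if \<sigma> i < n1 then \<sigma> i else n + \<sigma> i
     else if \<sigma>' (i - n1) < n2 then n1 + \<sigma>' (i - n1) else n + (\<sigma>' (i - n1) - n2))" for i
  have \<tau>: "restrict \<tau> {..<dim_col M} \<in> row_choices M"
  proof (rule restrict_row_choices)
    fix i assume "i < dim_col M"
    then have "i < n1 \<or> \<not> i < n1 \<and> i - n1 < n2" using M by (auto simp: n_def)
    then show "\<tau> i < dim_col M + dim_row M"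
      using M lt[of i] lt'[of "i - n1"] by (auto simp: \<tau>_def n_def)
  qed
  have "graph_mat M \<tau> =
     four_block_mat (graph_mat K \<sigma>) (0\<^sub>m n1 n2) (0\<^sub>m n2 n1) (graph_mat P \<sigma>')" (is "?L = ?R")
  proof (rule eq_matI)
    show "dim_row ?L = dim_row ?R" "dim_col ?L = dim_col ?R"
      using P K M by (auto simp: n_def graph_mat_def)
    fix i j assume "i < dim_row ?R" "j < dim_col ?R"
    then have ij: "i < n" "j < n" using P K by (auto simp: n_def graph_mat_def)
    have Bidx: "?L $$ (i,j) = (if \<tau> i < n then (if \<tau> i = j then 1 else 0) else M $$ (\<tau> i - n, j))"
      using ij M by (auto simp: graph_mat_def)
    show "?L $$ (i,j) = ?R $$ (i,j)"
    proof (cases "i < n1")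
      case True
      show ?thesis using True ij P K lt[OF True]
        by (subst Bidx) (auto simp: \<tau>_def graph_mat_def n_def Midx)
    next
      case False
      define i' where "i' = i - n1"
      have i': "i = n1 + i'" "i' < n2" using False ij by (auto simp: i'_def n_def)
      show ?thesis using False i' ij P K lt'[OF i'(2)]
        by (subst Bidx) (auto simp: \<tau>_def graph_mat_def n_def Midx)
    qed
  qed
  moreover have "det ?R = det (graph_mat K \<sigma>) * det (graph_mat P \<sigma>')"
    by (rule det_four_block_mat_lower_left_zero) (use P K in \<open>auto simp: graph_mat_def\<close>)
  ultimately have "graph_minor M \<tau> = graph_minor K \<sigma> * graph_minor P \<sigma>'"
    by (simp add: graph_minor_def)
  then show ?thesis using \<tau> graph_minor_restrict[of M \<tau>] by metis
qed

section \<open>Multilinear expansion of \<open>1 - M\<close>\<close>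

lemma det_row_diff:
  fixes A B C :: "'a::comm_ring_1 mat"
  assumes A: "A \<in> carrier_mat n n" and B: "B \<in> carrier_mat n n" and C: "C \<in> carrier_mat n n"
    and k: "k < n"
    and other: "\<And>i j. i < n \<Longrightarrow> j < n \<Longrightarrow> i \<noteq> k \<Longrightarrow> A $$ (i,j) = C $$ (i,j) \<and> B $$ (i,j) = C $$ (i,j)"
    and row: "\<And>j. j < n \<Longrightarrow> C $$ (k,j) = A $$ (k,j) - B $$ (k,j)"
  shows "det C = det A - det B"
proof -
  have "cofactor A k j = cofactor C k j \<and> cofactor B k j = cofactor C k j" if "j < n" for j
  proof -
    have "mat_delete A k j = mat_delete C k j \<and> mat_delete B k j = mat_delete C k j"
      using A B C k that other by (auto simp: mat_delete_def intro!: eq_matI)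
    then show ?thesis by (simp add: cofactor_def)
  qed
  then show ?thesis
    by (simp add: laplace_expansion_row[OF A k] laplace_expansion_row[OF B k]
        laplace_expansion_row[OF C k] row algebra_simps flip: sum_subtractf)
qed

text \<open>A row of \<open>1 - M\<close> (third block of selectors) is the difference of the rows given by the same
  selector in the first and second block; multilinearity reduces to these.\<close>
definition mixed_mat :: "'a::comm_ring_1 mat \<Rightarrow> (nat \<Rightarrow> nat) \<Rightarrow> 'a mat" where
  "mixed_mat M \<tau> = (let n = dim_col M in mat n n (\<lambda>(i,j).
     if \<tau> i < n then (if \<tau> i = j then 1 else 0)
     else if \<tau> i < 2 * n then M $$ (\<tau> i - n, j)
     else (if \<tau> i - 2 * n = j then 1 else 0) - M $$ (\<tau> i - 2 * n, j)))"

text \<open>In its use \<open>Q\<close> says that a sequence is cleared by fixed polynomials with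
  numerators of degree at most \<open>\<delta>\<close>; differences respect this, products would
  not. The induction is on the number of rows taken from \<open>1 - M\<close>.\<close>

lemma det_mixed_mat_closed:
  fixes M :: "'i \<Rightarrow> 'a::comm_ring_1 mat"
  assumes M: "\<And>x. M x \<in> carrier_mat n n"
    and diff: "\<And>f g. Q f \<Longrightarrow> Q g \<Longrightarrow> Q (\<lambda>x. f x - g x)"
    and minors: "\<And>\<tau>. (\<And>i. i < n \<Longrightarrow> \<tau> i < 2 * n) \<Longrightarrow> Q (\<lambda>x. graph_minor (M x) \<tau>)"
    and \<tau>: "\<And>i. i < n \<Longrightarrow> \<tau> i < 3 * n"
  shows "Q (\<lambda>x. det (mixed_mat (M x) \<tau>))"
  using \<tau>
proof (induction "card {i. i < n \<and> 2 * n \<le> \<tau> i}" arbitrary: \<tau>)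
  case 0
  then have *: "\<tau> i < 2 * n" if "i < n" for i using that by force
  have "mixed_mat (M x) \<tau> = graph_mat (M x) \<tau>" for x
    using M[of x] * by (auto simp: mixed_mat_def graph_mat_def Let_def intro!: eq_matI)
  then show ?case using minors[OF *] by (simp add: graph_minor_def)
next
  case (Suc m)
  have "{i. i < n \<and> 2 * n \<le> \<tau> i} \<noteq> {}"
    using Suc.hyps(2) by (metis card.empty nat.distinct(1))
  then obtain k where k: "k < n" "2 * n \<le> \<tau> k" by blast
  \<comment> \<open>These selectors name the corresponding rows of the identity and of
    \<open>M\<close>, whose difference is row \<open>k\<close>.\<close>
  let ?\<tau>1 = "\<tau>(k := \<tau> k - 2 * n)" and ?\<tau>2 = "\<tau>(k := \<tau> k - n)"
  have lt: "\<tau> k < 3 * n" using Suc.prems k by simp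
  have "{i. i < n \<and> 2 * n \<le> ?\<tau>1 i} = {i. i < n \<and> 2 * n \<le> \<tau> i} - {k}"
    "{i. i < n \<and> 2 * n \<le> ?\<tau>2 i} = {i. i < n \<and> 2 * n \<le> \<tau> i} - {k}"
    using k lt by auto
  then have card: "m = card {i. i < n \<and> 2 * n \<le> ?\<tau>1 i}" "m = card {i. i < n \<and> 2 * n \<le> ?\<tau>2 i}"
    using Suc.hyps(2) k by simp_all
  have "Q (\<lambda>x. det (mixed_mat (M x) ?\<tau>1))" "Q (\<lambda>x. det (mixed_mat (M x) ?\<tau>2))"
  proof -
    have "?\<tau>1 i < 3 * n" "?\<tau>2 i < 3 * n" if "i < n" for i
      using Suc.prems[OF that] lt by auto
    then show "Q (\<lambda>x. det (mixed_mat (M x) ?\<tau>1))" "Q (\<lambda>x. det (mixed_mat (M x) ?\<tau>2))"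
      using Suc.hyps(1)[OF card(1)] Suc.hyps(1)[OF card(2)] by blast+
  qed
  then have "Q (\<lambda>x. det (mixed_mat (M x) ?\<tau>1) - det (mixed_mat (M x) ?\<tau>2))" by (rule diff)
  moreover have "det (mixed_mat (M x) \<tau>) = det (mixed_mat (M x) ?\<tau>1) - det (mixed_mat (M x) ?\<tau>2)" for x
    by (rule det_row_diff[where n = n and k = k])
      (use M[of x] k lt in \<open>auto simp: mixed_mat_def Let_def mult_2[symmetric]\<close>)
  ultimately show ?case by simp
qed

lemma mixed_mat_one_minus:
  assumes "M \<in> carrier_mat n n"
  shows "mixed_mat M (\<lambda>k. 2 * n + k) = 1\<^sub>m n - M"
  using assms by (auto simp: mixed_mat_def Let_def intro!: eq_matI)

text \<open>Cramer's rule. The right inverse \<open>G\<close> is also a left inverse, so row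
  \<open>i\<close> of \<open>G\<close> solves the transposed system with right-hand side
  \<open>unit_vec n i\<close>; replacing a column of the transpose amounts to replacing row
  \<open>j\<close> of \<open>1 - M\<close> by a unit row.\<close>

lemma inverse_entry_mixed:
  fixes M G :: "'a::field mat"
  assumes M: "M \<in> carrier_mat n n" and G: "G \<in> carrier_mat n n"
    and inv: "(1\<^sub>m n - M) * G = 1\<^sub>m n" and ij: "i < n" "j < n"
  shows "det (1\<^sub>m n - M) * G $$ (i,j) = det (mixed_mat M (\<lambda>k. if k = j then i else 2 * n + k))"
proof -
  define A where "A = 1\<^sub>m n - M"
  have A: "A \<in> carrier_mat n n" unfolding A_def by (rule minus_carrier_mat[OF M])
  have GA: "G * A = 1\<^sub>m n"
    using mat_mult_left_right_inverse[OF A G] inv by (simp add: A_def)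
  have "transpose_mat A *\<^sub>v row G i = unit_vec n i"
  proof (rule eq_vecI)
    fix k assume "k < dim_vec (unit_vec n i :: 'a vec)"
    then have k: "k < n" by simp
    have "(transpose_mat A *\<^sub>v row G i) $ k = col A k \<bullet> row G i" using A k by simp
    also have "\<dots> = row G i \<bullet> col A k" using A G k ij by (intro comm_scalar_prod[of _ n]) auto
    also have "\<dots> = (G * A) $$ (i,k)" using A G ij k by simp
    finally show "(transpose_mat A *\<^sub>v row G i) $ k = unit_vec n i $ k" using GA ij k by (auto simp: unit_vec_def)
  qed (use A in auto)
  then have "det (replace_col (transpose_mat A) (unit_vec n i) j) = row G i $ j * det (transpose_mat A)"
    using cramer_lemma_mat[of "transpose_mat A" n "row G i" j] A G ij by auto
  moreover have "replace_col (transpose_mat A) (unit_vec n i) j =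
      transpose_mat (mixed_mat M (\<lambda>k. if k = j then i else 2 * n + k))"
    using M ij by (auto simp: replace_col_def mixed_mat_def Let_def A_def unit_vec_def intro!: eq_matI)
  moreover have "mixed_mat M \<tau> \<in> carrier_mat n n" for \<tau>
    using M by (auto simp: mixed_mat_def Let_def)
  ultimately show ?thesis
    using det_transpose[OF A] det_transpose[of "mixed_mat M (\<lambda>k. if k = j then i else 2 * n + k)" n] G ij
    by (simp add: A_def mult.commute)
qed

text \<open>Multiplication by \<open>G\<close> turns unit rows into rows of \<open>G\<close>, and
  rows of \<open>M\<close> into rows of \<open>M * G = G - 1\<close>; the determinant of the product
  is thus a polynomial in the entries of \<open>G\<close>.\<close>

lemma det_mult_graph_minor_closed:
  fixes M G :: "'a::field mat"
  assumes Q: "ring_closed (\<lambda>f::unit \<Rightarrow> 'a. R (f ()))"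
    and M: "M \<in> carrier_mat n n" and G: "G \<in> carrier_mat n n"
    and eq: "G = 1\<^sub>m n + M * G"
    and ent: "\<And>i j. i < n \<Longrightarrow> j < n \<Longrightarrow> R (G $$ (i,j))"
    and \<tau>: "\<And>i. i < n \<Longrightarrow> \<tau> i < n + n"
  shows "R (graph_minor M \<tau> * det G)"
proof -
  have cl: "R (a + 0)" "R (a + - 1)" if "R a" for a
    using ring_closedD(4)[OF Q, of "\<lambda>_. a" "\<lambda>_. - 1"] ring_closedD(3)[OF Q, of "\<lambda>_. 1"]
      ring_closedD(2)[OF Q] that by simp_all
  let ?B = "graph_mat M \<tau>"
  have B: "?B \<in> carrier_mat n n" by (rule graph_mat_carrier[OF M])
  have MG: "(M * G) $$ (i,j) = G $$ (i,j) + - (if i = j then 1 else 0)" if "i < n" "j < n" for i j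
  proof -
    have "G $$ (i,j) = (1\<^sub>m n + M * G) $$ (i,j)" using eq by simp
    then show ?thesis using that M G by simp
  qed
  have "R ((?B * G) $$ (i,j))" if ij: "i < n" "j < n" for i j
  proof (cases "\<tau> i < n")
    case True
    then have "row ?B i = unit_vec n (\<tau> i)"
      using M ij by (auto simp: graph_mat_def unit_vec_def intro!: eq_vecI)
    then have "(?B * G) $$ (i,j) = G $$ (\<tau> i, j)"
      using B G ij True by (simp add: scalar_prod_left_unit[of _ n])
    then show ?thesis using ent[OF True ij(2)] by simp
  next
    case False
    have t: "\<tau> i - n < n" using False \<tau>[OF ij(1)] by linarith
    have "row ?B i = row M (\<tau> i - n)"
      using M ij False t by (auto simp: graph_mat_def intro!: eq_vecI)
    then have "(?B * G) $$ (i,j) = (M * G) $$ (\<tau> i - n, j)"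
      using B G M ij t by simp
    then show ?thesis using MG[OF t ij(2)] ent[OF t ij(2)] cl by (auto split: if_splits)
  qed
  then have "R (det (?B * G))"
    using ring_closed_det[OF Q, of "\<lambda>_. ?B * G" n] B G by auto
  then show ?thesis using det_mult[OF B G] by (simp add: graph_minor_def)
qed

lemma feedback_inverse:
  assumes P: "P \<in> carrier_mat n1 n2" and K: "K \<in> carrier_mat n2 n1"
    and "feedback_interconnection n1 n2 P K G"
  defines "M \<equiv> feedback_mat n1 n2 P K"
  shows "G \<in> carrier_mat (n1 + n2) (n1 + n2)" "G = 1\<^sub>m (n1 + n2) + M * G"
    "(1\<^sub>m (n1 + n2) - M) * G = 1\<^sub>m (n1 + n2)"
proof -
  define n where "n = n1 + n2"
  show G: "G \<in> carrier_mat (n1 + n2) (n1 + n2)" and eq: "G = 1\<^sub>m (n1 + n2) + M * G"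
    using assms(3) by (simp_all add: feedback_interconnection_def M_def feedback_mat_def)
  have M: "M \<in> carrier_mat n n" using feedback_mat_carrier[OF P K] by (simp add: M_def n_def)
  have "(1\<^sub>m n - M) * G = G - M * G"
    using M G by (subst minus_mult_distrib_mat[of _ n n]) (auto simp: n_def)
  also have "\<dots> = 1\<^sub>m n"
  proof (rule eq_matI)
    fix i j assume "i < dim_row (1\<^sub>m n :: tf mat)" "j < dim_col (1\<^sub>m n :: tf mat)"
    then have ij: "i < n" "j < n" by auto
    have "G $$ (i,j) = (1\<^sub>m n + M * G) $$ (i,j)" using eq by (simp add: n_def)
    then show "(G - M * G) $$ (i,j) = 1\<^sub>m n $$ (i,j)" using M G ij by (auto simp: n_def)
  qed (use M G in \<open>auto simp: n_def\<close>)
  finally show "(1\<^sub>m (n1 + n2) - M) * G = 1\<^sub>m (n1 + n2)" by (simp add: n_def)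
qed

section \<open>McMillan degree\<close>

lemma tf_const_hom:
  "tf_const 0 = 0" "tf_const 1 = 1" "tf_const (a + b) = tf_const a + tf_const b"
  "tf_const (a * b) = tf_const a * tf_const b" "tf_const a = 0 \<longleftrightarrow> a = 0"
  unfolding tf_const_def by (simp_all add: pCons_one flip: to_fract_mult to_fract_add)

lemma tf_const_sum: "tf_const (\<Sum>i\<in>S. f i) = (\<Sum>i\<in>S. tf_const (f i))"
  by (induction S rule: infinite_finite_induct) (simp_all add: tf_const_hom)

definition poly_at_inv :: "real poly \<Rightarrow> tf" where
  "poly_at_inv p = poly (map_poly tf_const p) (inverse tf_s)"

lemma poly_at_inv_0: "poly_at_inv 0 = 0" and poly_at_inv_1: "poly_at_inv 1 = 1"
  by (simp_all add: poly_at_inv_def tf_const_hom)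

lemma poly_at_inv_add: "poly_at_inv (p + q) = poly_at_inv p + poly_at_inv q"
proof -
  have "map_poly tf_const (p + q) = map_poly tf_const p + map_poly tf_const q"
    by (simp add: poly_eq_iff coeff_map_poly tf_const_hom)
  then show ?thesis by (simp add: poly_at_inv_def)
qed

lemma poly_at_inv_mult: "poly_at_inv (p * q) = poly_at_inv p * poly_at_inv q"
proof -
  have "map_poly tf_const (p * q) = map_poly tf_const p * map_poly tf_const q"
    by (simp add: poly_eq_iff coeff_map_poly coeff_mult tf_const_hom tf_const_sum)
  then show ?thesis by (simp add: poly_at_inv_def)
qed

lemma tf_s_nonzero: "tf_s \<noteq> 0"
  by (simp add: tf_s_def)

lemma poly_tf_const_tf_s: "poly (map_poly tf_const p) tf_s = to_fract p"
proof (induction p)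
  case (pCons a p)
  have "poly (map_poly tf_const (pCons a p)) tf_s = to_fract ([:a:] + [:0, 1:] * p)"
    using pCons by (simp add: map_poly_pCons tf_const_hom to_fract_add to_fract_mult del: mult_pCons_left)
      (simp add: tf_const_def tf_s_def)
  then show ?case by simp
qed simp

lemma poly_at_inv_reflect: "tf_s ^ degree p * poly_at_inv p = to_fract (reflect_poly p)"
proof -
  have deg: "degree (map_poly tf_const p) = degree p"
    by (rule degree_map_poly) (simp add: tf_const_hom)
  have "reflect_poly (map_poly tf_const p) = map_poly tf_const (reflect_poly p)"
    by (simp add: poly_eq_iff coeff_map_poly tf_const_hom coeff_reflect_poly deg)
  then show ?thesis
    using poly_reflect_poly_nz[OF tf_s_nonzero, of "map_poly tf_const p"]
    by (simp add: poly_at_inv_def deg poly_tf_const_tf_s)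
qed

lemma poly_at_inv_eq_0_iff: "poly_at_inv p = 0 \<longleftrightarrow> p = 0"
proof
  assume "poly_at_inv p = 0"
  then have "to_fract (reflect_poly p) = 0" using poly_at_inv_reflect[of p] by simp
  then show "p = 0" by simp
qed (simp add: poly_at_inv_0)

lemma tf_subst_inv_altdef: "tf_subst_inv f = poly_at_inv (tf_num f) / poly_at_inv (tf_den f)"
  by (simp add: tf_subst_inv_def poly_at_inv_def)

text \<open>Sums and products of reduced fractions need not come out reduced, so the homomorphism
  laws require the substitution for arbitrary representations.\<close>

lemma tf_subst_inv_eq:
  assumes "to_fract b * f = to_fract a" "b \<noteq> 0"
  shows "tf_subst_inv f = poly_at_inv a / poly_at_inv b"
proof -
  have "b * tf_num f = a * tf_den f" using assms(1) by (simp add: to_fract_mult_eq_iff)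
  then have "poly_at_inv b * poly_at_inv (tf_num f) = poly_at_inv a * poly_at_inv (tf_den f)"
    by (simp flip: poly_at_inv_mult)
  then show ?thesis using assms(2) by (simp add: tf_subst_inv_altdef poly_at_inv_eq_0_iff field_simps)
qed

text \<open>As a ring homomorphism the substitution commutes with determinants, so the poles at
  infinity of a minor can be read off from the minor itself.\<close>

interpretation tf_subst_inv: comm_ring_hom tf_subst_inv
proof
  fix f g :: tf
  note e = fract_op_eqs[OF to_fract_den_mult[of f] to_fract_den_mult[of g]]
  show "tf_subst_inv (f + g) = tf_subst_inv f + tf_subst_inv g"
    by (subst tf_subst_inv_eq[OF e(2)])
      (simp_all add: tf_subst_inv_altdef poly_at_inv_add poly_at_inv_mult poly_at_inv_eq_0_iff field_simps)
  show "tf_subst_inv (f * g) = tf_subst_inv f * tf_subst_inv g"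
    by (subst tf_subst_inv_eq[OF e(3)])
      (simp_all add: tf_subst_inv_altdef poly_at_inv_mult poly_at_inv_eq_0_iff)
qed (simp_all add: tf_subst_inv_altdef poly_at_inv_0 poly_at_inv_1)

text \<open>The truncated subtraction is the pole order at infinity, zero for proper functions.
  Multiplying by powers of \<open>tf_s\<close> turns numerator and denominator into reflected
  polynomials, which do not vanish at \<open>0\<close>; comparing orders at \<open>0\<close> and
  using coprimality settles the rest.\<close>

lemma order_den_subst_inv:
  "order 0 (tf_den (tf_subst_inv f)) = degree (tf_num f) - degree (tf_den f)"
proof (cases "f = 0")
  case True
  then show ?thesis by simp
next
  case False
  define h where "h = tf_subst_inv f"
  define dn dd where "dn = degree (tf_num f)" and "dd = degree (tf_den f)"
  let ?X = "[:0, 1:] :: real poly"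
  have X: "tf_s ^ k = to_fract (?X ^ k)" for k
    by (induction k) (simp_all add: tf_s_def flip: to_fract_mult)
  have "poly_at_inv (tf_den f) * h = poly_at_inv (tf_num f)"
    by (simp add: h_def tf_subst_inv_altdef poly_at_inv_eq_0_iff)
  then have "(tf_s ^ dn * (tf_s ^ dd * poly_at_inv (tf_den f))) * h
      = tf_s ^ dd * (tf_s ^ dn * poly_at_inv (tf_num f))"
    by (simp add: ac_simps)
  then have "to_fract (?X ^ dn * reflect_poly (tf_den f)) * h = to_fract (?X ^ dd * reflect_poly (tf_num f))"
    by (simp only: dn_def dd_def poly_at_inv_reflect X [symmetric] to_fract_mult)
  then have eq: "?X ^ dn * reflect_poly (tf_den f) * tf_num h = ?X ^ dd * reflect_poly (tf_num f) * tf_den h"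
    by (simp only: to_fract_mult_eq_iff)
  have h0: "h \<noteq> 0"
    using False by (simp add: h_def tf_subst_inv_altdef poly_at_inv_eq_0_iff)
  have oX: "order 0 (?X ^ k) = k" for k
    using order_power_n_n[of "0::real" k] by simp
  have o0: "order 0 (reflect_poly p) = 0" if "p \<noteq> 0" for p :: "real poly"
    using that by (intro order_0I) (simp del: poly_0_coeff_0)
  have "order 0 (?X ^ dn * reflect_poly (tf_den f) * tf_num h) = dn + order 0 (tf_num h)"
    using h0 by (simp add: order_mult oX o0)
  moreover have "order 0 (?X ^ dd * reflect_poly (tf_num f) * tf_den h) = dd + order 0 (tf_den h)"
    using False by (simp add: order_mult oX o0)
  ultimately have ord: "dn + order 0 (tf_num h) = dd + order 0 (tf_den h)"
    using eq by simp
  have "order 0 (tf_num h) = 0 \<or> order 0 (tf_den h) = 0"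
  proof (rule ccontr)
    assume "\<not> ?thesis"
    then have "?X dvd tf_num h" "?X dvd tf_den h"
      using order_divides[of "0::real" 1] by auto
    then have "is_unit ?X" using coprime_num_den[of h] coprime_common_divisor by blast
    then show False by (simp add: is_unit_iff_degree)
  qed
  then show ?thesis using ord by (auto simp: h_def dn_def dd_def)
qed

text \<open>The upper bound comes from a common multiple: the largest power of the linear factor
  times a cofactor \<open>R\<close> that does not vanish at \<open>a\<close>.\<close>

lemma order_Lcm:
  fixes B :: "real poly set"
  assumes "finite B" "B \<noteq> {}" "0 \<notin> B"
  shows "order a (Lcm B) = Max (order a ` B)"
proof (rule antisym)
  have L0: "Lcm B \<noteq> 0" using assms by (simp add: Lcm_0_iff)
  show "Max (order a ` B) \<le> order a (Lcm B)"
    using assms L0 by (auto intro: dvd_imp_order_le dvd_Lcm)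
  define m where "m = Max (order a ` B)"
  have "\<exists>q. b = [:-a, 1:] ^ order a b * q \<and> \<not> [:-a, 1:] dvd q" if "b \<in> B" for b
    using order_decomp[of b a] that assms by auto
  then obtain q where q: "\<And>b. b \<in> B \<Longrightarrow> b = [:-a, 1:] ^ order a b * q b \<and> \<not> [:-a, 1:] dvd q b"
    by metis
  define R where "R = (\<Prod>b\<in>B. q b)"
  have q0: "poly (q b) a \<noteq> 0" if "b \<in> B" for b
    using q[OF that] by (simp add: poly_eq_0_iff_dvd)
  then have R0: "poly R a \<noteq> 0" using assms by (auto simp: R_def poly_prod)
  have "Lcm B dvd [:-a, 1:] ^ m * R"
  proof (rule Lcm_least)
    fix b assume b: "b \<in> B"
    have "[:-a, 1:] ^ order a b dvd [:-a, 1:] ^ m"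
      using b assms by (intro le_imp_power_dvd) (simp add: m_def)
    moreover have "q b dvd R" unfolding R_def using b assms by (simp add: dvd_prodI)
    ultimately show "b dvd [:-a, 1:] ^ m * R" using q[OF b] mult_dvd_mono by metis
  qed
  moreover have "[:-a, 1:] ^ m * R \<noteq> 0" using R0 by auto
  ultimately have "order a (Lcm B) \<le> order a ([:-a, 1:] ^ m * R)"
    by (intro dvd_imp_order_le)
  also have "\<dots> = m"
    using R0 \<open>[:-a, 1:] ^ m * R \<noteq> 0\<close> by (simp add: order_mult order_power_n_n order_0I del: mult_eq_0_iff)
  finally show "order a (Lcm B) \<le> Max (order a ` B)" by (simp add: m_def)
qed

text \<open>The two families of minors agree up to sign, apart from the values \<open>0\<close>,
  \<open>1\<close> and \<open>-1\<close>, whose denominator is \<open>1\<close>.\<close>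

lemma pole_poly_altdef: "pole_poly K = Lcm ((\<lambda>\<sigma>. tf_den (graph_minor K \<sigma>)) ` row_choices K)"
proof (rule associated_eqI)
  have eq: "pole_poly K = Lcm ((\<lambda>(I,J). tf_den (det (submatrix K I J))) ` minor_indices K)"
    unfolding pole_poly_def minor_indices_def by (rule arg_cong[where f = Lcm]) auto
  show "pole_poly K dvd Lcm ((\<lambda>\<sigma>. tf_den (graph_minor K \<sigma>)) ` row_choices K)"
    unfolding eq
  proof (rule Lcm_least, clarify)
    fix I J assume "(I, J) \<in> minor_indices K"
    from minor_as_graph_minor[OF this] show "tf_den (det (submatrix K I J)) dvd
        Lcm ((\<lambda>\<sigma>. tf_den (graph_minor K \<sigma>)) ` row_choices K)"
      by (metis dvd_Lcm image_eqI tf_den_uminus)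
  qed
  show "Lcm ((\<lambda>\<sigma>. tf_den (graph_minor K \<sigma>)) ` row_choices K) dvd pole_poly K"
    unfolding eq
  proof (rule Lcm_least, clarify)
    fix \<sigma> assume "\<sigma> \<in> row_choices K"
    from graph_minor_cases[OF this]
    consider "graph_minor K \<sigma> \<in> {0, 1, -1}"
      | I J where "(I, J) \<in> minor_indices K" "tf_den (graph_minor K \<sigma>) = tf_den (det (submatrix K I J))"
      by fastforce
    then show "tf_den (graph_minor K \<sigma>) dvd
        Lcm ((\<lambda>(I,J). tf_den (det (submatrix K I J))) ` minor_indices K)"
    proof cases
      case 1
      then have "tf_den (graph_minor K \<sigma>) = 1" using tf_den_uminus[of 1] by auto
      then show ?thesis by simp
    next
      case 2
      then show ?thesis by (intro dvd_Lcm) force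
    qed
  qed
qed (simp_all add: pole_poly_def)

lemma graph_minor_map_subst_inv:
  assumes "\<sigma> \<in> row_choices K"
  shows "graph_minor (map_mat tf_subst_inv K) \<sigma> = tf_subst_inv (graph_minor K \<sigma>)"
proof -
  have "graph_mat (map_mat tf_subst_inv K) \<sigma> = map_mat tf_subst_inv (graph_mat K \<sigma>)"
    using assms by (intro eq_matI) (auto simp: graph_mat_def row_choices_def PiE_def Pi_def)
  then show ?thesis by (simp add: graph_minor_def)
qed

lemma row_choices_nonempty: "row_choices K \<noteq> {}"
  using restrict_row_choices[of K "\<lambda>i. i"] by auto

text \<open>Clearing a nonzero minor by \<open>pole_poly K\<close> shifts the degree of
  \<open>pole_poly K\<close> by the numerator degree minus the denominator degree of that minor. The
  formula thus makes the McMillan degree the largest degree among the cleared minors.\<close>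

lemma mcmillan_degree_altdef:
  "mcmillan_degree K = degree (pole_poly K) + Max ((\<lambda>\<sigma>.
     degree (tf_num (graph_minor K \<sigma>)) - degree (tf_den (graph_minor K \<sigma>))) ` row_choices K)"
proof -
  have rc: "row_choices (map_mat tf_subst_inv K) = row_choices K"
    by (simp add: row_choices_def)
  have eq: "pole_poly (map_mat tf_subst_inv K) =
      Lcm ((\<lambda>\<sigma>. tf_den (tf_subst_inv (graph_minor K \<sigma>))) ` row_choices K)"
    unfolding pole_poly_altdef rc
    by (intro arg_cong[where f = Lcm] image_cong) (simp_all add: graph_minor_map_subst_inv)
  have "order 0 (pole_poly (map_mat tf_subst_inv K)) =
      Max ((\<lambda>\<sigma>. order 0 (tf_den (tf_subst_inv (graph_minor K \<sigma>)))) ` row_choices K)"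
    unfolding eq using row_choices_nonempty by (subst order_Lcm) (auto simp: image_image)
  then show ?thesis by (simp add: mcmillan_degree_def order_den_subst_inv)
qed

section \<open>Reduced homogeneous coordinates and their degree\<close>

text \<open>The polynomials \<open>w \<sigma>\<close> are homogeneous coordinates of degree \<open>\<delta>\<close>, without common zero
  in the closed plane (infinity included), of the point with affine coordinates \<open>\<phi> \<sigma>\<close>.\<close>
definition reduced_family ::
  "'s set \<Rightarrow> ('s \<Rightarrow> tf) \<Rightarrow> real poly \<Rightarrow> nat \<Rightarrow> ('s \<Rightarrow> real poly) \<Rightarrow> bool" where
  "reduced_family S \<phi> q \<delta> w \<longleftrightarrow> q \<noteq> 0 \<and>
     (\<forall>\<sigma>\<in>S. to_fract q * \<phi> \<sigma> = to_fract (w \<sigma>) \<and> degree (w \<sigma>) \<le> \<delta>) \<and>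
     (\<exists>\<sigma>\<in>S. coeff (w \<sigma>) \<delta> \<noteq> 0) \<and> (\<forall>s. \<exists>\<sigma>\<in>S. cpoly (w \<sigma>) s \<noteq> 0)"

text \<open>The minimal polynomial of \<open>s\<close> over the reals. It turns common complex zeros
  into common divisors in \<open>real poly\<close>.\<close>

lemma ex_real_minimal_poly:
  assumes "p \<noteq> 0" "cpoly p s = 0"
  obtains q where "degree q > 0" "\<And>p. cpoly p s = 0 \<Longrightarrow> q dvd p"
proof -
  define D where "D = {q. q \<noteq> 0 \<and> cpoly q s = 0}"
  have "p \<in> D" using assms by (simp add: D_def)
  then obtain q where q: "q \<in> D" "\<And>q'. q' \<in> D \<Longrightarrow> degree q \<le> degree q'"
    using ex_has_least_nat[of "\<lambda>q. q \<in> D" p degree] by auto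
  show ?thesis
  proof (rule that)
    show "degree q > 0"
    proof (rule ccontr)
      assume "\<not> degree q > 0"
      then obtain c where "q = [:c:]" using degree_eq_zeroE by blast
      then show False using q(1) by (auto simp: D_def map_poly_pCons)
    qed
    fix p' assume p': "cpoly p' s = 0"
    have "p' = p' div q * q + p' mod q" by simp
    then have "cpoly p' s = cpoly (p' div q) s * cpoly q s + cpoly (p' mod q) s"
      by (metis cpoly_add cpoly_mult)
    then have "cpoly (p' mod q) s = 0" using p' q(1) by (simp add: D_def)
    moreover have "p' mod q = 0 \<or> degree (p' mod q) < degree q"
      using q(1) by (intro degree_mod_less) (simp add: D_def)
    ultimately have "p' mod q = 0" using q(2)[of "p' mod q"] by (force simp: D_def)
    then show "q dvd p'" by (simp add: mod_eq_0_iff_dvd)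
  qed
qed

text \<open>The real minimal polynomial of a common zero would divide \<open>q\<close> and all
  \<open>w \<sigma>\<close>; the quotient of \<open>q\<close> would still clear the family, against
  minimality of the lcm. At infinity the bound is attained by \<open>q\<close> itself if all
  functions are proper, otherwise by one with the largest excess.\<close>

lemma reduced_family_Lcm:
  fixes \<phi> :: "'s \<Rightarrow> tf"
  assumes fin: "finite S" and \<sigma>0: "\<sigma>0 \<in> S" "\<phi> \<sigma>0 = 1"
  defines "q \<equiv> Lcm ((\<lambda>\<sigma>. tf_den (\<phi> \<sigma>)) ` S)"
  defines "\<delta> \<equiv> degree q + Max ((\<lambda>\<sigma>. degree (tf_num (\<phi> \<sigma>)) - degree (tf_den (\<phi> \<sigma>))) ` S)"
  shows "\<exists>w. reduced_family S \<phi> q \<delta> w"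
proof -
  let ?e = "\<lambda>\<sigma>. degree (tf_num (\<phi> \<sigma>)) - degree (tf_den (\<phi> \<sigma>))"
  have q0: "q \<noteq> 0" using fin by (auto simp: q_def Lcm_0_iff)
  have "tf_den (\<phi> \<sigma>) dvd q" if "\<sigma> \<in> S" for \<sigma> using that unfolding q_def by (intro dvd_Lcm imageI)
  then have "\<exists>v. to_fract q * \<phi> \<sigma> = to_fract v" if "\<sigma> \<in> S" for \<sigma>
    using that den_dvd_iff by blast
  then obtain w where w: "\<And>\<sigma>. \<sigma> \<in> S \<Longrightarrow> to_fract q * \<phi> \<sigma> = to_fract (w \<sigma>)" by metis
  then have eq: "q * tf_num (\<phi> \<sigma>) = w \<sigma> * tf_den (\<phi> \<sigma>)" if "\<sigma> \<in> S" for \<sigma>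
    using that by (simp add: to_fract_mult_eq_iff)
  have deg: "degree q + degree (tf_num (\<phi> \<sigma>)) = degree (w \<sigma>) + degree (tf_den (\<phi> \<sigma>))"
    "w \<sigma> \<noteq> 0" if "\<sigma> \<in> S" "\<phi> \<sigma> \<noteq> 0" for \<sigma>
  proof -
    show w0: "w \<sigma> \<noteq> 0" using w[OF that(1)] q0 that(2) by auto
    show "degree q + degree (tf_num (\<phi> \<sigma>)) = degree (w \<sigma>) + degree (tf_den (\<phi> \<sigma>))"
      using arg_cong[OF eq[OF that(1)], of degree] q0 w0 that(2) by (simp add: degree_mult_eq)
  qed
  have le: "degree (w \<sigma>) \<le> \<delta>" if \<sigma>: "\<sigma> \<in> S" for \<sigma>
  proof (cases "\<phi> \<sigma> = 0")
    case True
    then show ?thesis using w[OF \<sigma>] by auto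
  next
    case False
    have "?e \<sigma> \<le> Max (?e ` S)" using fin \<sigma> by simp
    then show ?thesis using deg(1)[OF \<sigma> False] by (simp add: \<delta>_def)
  qed
  have w_\<sigma>0: "w \<sigma>0 = q" using w[OF \<sigma>0(1)] \<sigma>0(2) by simp
  have "\<exists>\<sigma>\<in>S. coeff (w \<sigma>) \<delta> \<noteq> 0"
  proof (cases "Max (?e ` S) = 0")
    case True
    then show ?thesis using \<sigma>0(1) w_\<sigma>0 q0 by (intro bexI[of _ \<sigma>0]) (simp_all add: \<delta>_def)
  next
    case False
    have "Max (?e ` S) \<in> ?e ` S" using fin \<sigma>0 by (intro Max_in) auto
    then obtain \<sigma> where \<sigma>: "\<sigma> \<in> S" "?e \<sigma> = Max (?e ` S)" by auto
    then have nz: "\<phi> \<sigma> \<noteq> 0" using False by auto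
    have "degree (w \<sigma>) = \<delta>" using deg(1)[OF \<sigma>(1) nz] \<sigma>(2) False by (simp add: \<delta>_def)
    then show ?thesis using \<sigma>(1) deg(2)[OF \<sigma>(1) nz] by (metis leading_coeff_0_iff)
  qed
  moreover have "\<exists>\<sigma>\<in>S. cpoly (w \<sigma>) s \<noteq> 0" for s
  proof (rule ccontr)
    assume "\<not> ?thesis"
    then have zero: "\<And>\<sigma>. \<sigma> \<in> S \<Longrightarrow> cpoly (w \<sigma>) s = 0" by blast
    then have "cpoly q s = 0" using \<sigma>0(1) w_\<sigma>0 by metis
    then obtain m where m: "degree m > 0" "\<And>p. cpoly p s = 0 \<Longrightarrow> m dvd p"
      using ex_real_minimal_poly[OF q0] by metis
    have m0: "m \<noteq> 0" using m(1) by auto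
    obtain q' where q': "q = m * q'" using m(2) \<open>cpoly q s = 0\<close> by blast
    have "q dvd q'"
      unfolding q_def
    proof (rule Lcm_least, clarify)
      fix \<sigma> assume \<sigma>: "\<sigma> \<in> S"
      obtain v where v: "w \<sigma> = m * v" using m(2) zero[OF \<sigma>] by blast
      have "to_fract m * (to_fract q' * \<phi> \<sigma>) = to_fract m * to_fract v"
        using w[OF \<sigma>] by (simp add: q' v ac_simps)
      then have "to_fract q' * \<phi> \<sigma> = to_fract v" using m0 by simp
      then show "tf_den (\<phi> \<sigma>) dvd q'" using den_dvd_iff by blast
    qed
    moreover have "q' \<noteq> 0" using q0 q' by auto
    ultimately have "degree q \<le> degree q'" by (rule dvd_imp_degree_le)
    then show False using q' m(1) m0 \<open>q' \<noteq> 0\<close> by (simp add: degree_mult_eq)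
  qed
  ultimately show ?thesis using q0 w le unfolding reduced_family_def by blast
qed

lemma mcmillan_reduced_family:
  "\<exists>w. reduced_family (row_choices K) (graph_minor K) (pole_poly K) (mcmillan_degree K) w"
  unfolding mcmillan_degree_altdef unfolding pole_poly_altdef
proof (rule reduced_family_Lcm)
  show "restrict (\<lambda>i. i) {..<dim_col K} \<in> row_choices K" by (rule restrict_row_choices) simp
  show "graph_minor K (restrict (\<lambda>i. i) {..<dim_col K}) = 1"
    by (simp only: graph_minor_restrict graph_minor_id)
qed simp

text \<open>Each coordinate of the loop is zero or, up to sign, a product of one coordinate of
  \<open>K\<close> and one of \<open>P\<close>, and all such products occur (a Segre embedding).
  Hence degrees add, and coordinates of \<open>K\<close> and \<open>P\<close> not vanishing at
  \<open>s\<close> can be chosen independently.\<close>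

lemma reduced_family_feedback:
  assumes P: "P \<in> carrier_mat n1 n2" and K: "K \<in> carrier_mat n2 n1"
    and rP: "reduced_family (row_choices P) (graph_minor P) qP dP wP"
    and rK: "reduced_family (row_choices K) (graph_minor K) qK dK wK"
  defines "M \<equiv> feedback_mat n1 n2 P K"
  shows "\<exists>w. reduced_family (row_choices M) (graph_minor M) (qK * qP) (dK + dP) w"
proof -
  have "\<exists>v. to_fract (qK * qP) * graph_minor M \<tau> = to_fract v \<and> degree v \<le> dK + dP"
    if \<tau>: "\<tau> \<in> row_choices M" for \<tau>
  proof -
    consider "graph_minor M \<tau> = 0" | \<sigma> \<sigma>' where "\<sigma> \<in> row_choices K" "\<sigma>' \<in> row_choices P"
      "graph_minor M \<tau> = graph_minor K \<sigma> * graph_minor P \<sigma>' \<or>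
       graph_minor M \<tau> = - (graph_minor K \<sigma> * graph_minor P \<sigma>')"
      using graph_minor_feedback_cases[OF P K] \<tau> unfolding M_def by blast
    then show ?thesis
    proof cases
      case 1
      then show ?thesis by (intro exI[of _ 0]) simp
    next
      case (2 \<sigma> \<sigma>')
      have w: "to_fract qK * graph_minor K \<sigma> = to_fract (wK \<sigma>)" "to_fract qP * graph_minor P \<sigma>' = to_fract (wP \<sigma>')"
        "degree (wK \<sigma>) \<le> dK" "degree (wP \<sigma>') \<le> dP"
        using rP rK 2 by (auto simp: reduced_family_def)
      have *: "to_fract (qK * qP) * (graph_minor K \<sigma> * graph_minor P \<sigma>') = to_fract (wK \<sigma> * wP \<sigma>')"
        by (simp add: ac_simps flip: w(1,2))
      have **: "degree (wK \<sigma> * wP \<sigma>') \<le> dK + dP"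
        using degree_mult_le[of "wK \<sigma>" "wP \<sigma>'"] w(3,4) by linarith
      from 2(3) show ?thesis
      proof
        assume "graph_minor M \<tau> = graph_minor K \<sigma> * graph_minor P \<sigma>'"
        then show ?thesis using * ** by (intro exI[of _ "wK \<sigma> * wP \<sigma>'"]) auto
      next
        assume "graph_minor M \<tau> = - (graph_minor K \<sigma> * graph_minor P \<sigma>')"
        then show ?thesis using * ** by (intro exI[of _ "- (wK \<sigma> * wP \<sigma>')"]) auto
      qed
    qed
  qed
  then obtain w where w: "\<And>\<tau>. \<tau> \<in> row_choices M \<Longrightarrow>
      to_fract (qK * qP) * graph_minor M \<tau> = to_fract (w \<tau>) \<and> degree (w \<tau>) \<le> dK + dP" by metis
  have prod: "\<exists>\<tau>\<in>row_choices M. w \<tau> = wK \<sigma> * wP \<sigma>'"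
    if s: "\<sigma> \<in> row_choices K" "\<sigma>' \<in> row_choices P" for \<sigma> \<sigma>'
  proof -
    obtain \<tau> where \<tau>: "\<tau> \<in> row_choices M" "graph_minor M \<tau> = graph_minor K \<sigma> * graph_minor P \<sigma>'"
      using graph_minor_mult_feedback[OF P K s] by (auto simp: M_def)
    have "to_fract (qK * qP) * graph_minor M \<tau> = (to_fract qK * graph_minor K \<sigma>) * (to_fract qP * graph_minor P \<sigma>')"
      by (simp add: \<tau>(2) ac_simps)
    also have "\<dots> = to_fract (wK \<sigma> * wP \<sigma>')"
      using rP rK s by (simp add: reduced_family_def)
    finally show ?thesis using w[OF \<tau>(1)] \<tau>(1) by (metis to_fract_eq_iff)
  qed
  have "\<exists>\<tau>\<in>row_choices M. coeff (w \<tau>) (dK + dP) \<noteq> 0"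
  proof -
    obtain \<sigma> \<sigma>' where s: "\<sigma> \<in> row_choices K" "coeff (wK \<sigma>) dK \<noteq> 0" "degree (wK \<sigma>) \<le> dK"
      "\<sigma>' \<in> row_choices P" "coeff (wP \<sigma>') dP \<noteq> 0" "degree (wP \<sigma>') \<le> dP"
      using rP rK unfolding reduced_family_def by blast
    have "degree (wK \<sigma>) = dK" "degree (wP \<sigma>') = dP" using s le_degree by (meson le_antisym)+
    then have "coeff (wK \<sigma> * wP \<sigma>') (dK + dP) \<noteq> 0"
      using s coeff_mult_degree_sum[of "wK \<sigma>" "wP \<sigma>'"] by simp
    then show ?thesis using prod[OF s(1,4)] by metis
  qed
  moreover have "\<exists>\<tau>\<in>row_choices M. cpoly (w \<tau>) s \<noteq> 0" for s
  proof -
    obtain \<sigma> \<sigma>' where s: "\<sigma> \<in> row_choices K" "cpoly (wK \<sigma>) s \<noteq> 0"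
      "\<sigma>' \<in> row_choices P" "cpoly (wP \<sigma>') s \<noteq> 0"
      using rP rK unfolding reduced_family_def by blast
    then have "cpoly (wK \<sigma> * wP \<sigma>') s \<noteq> 0" by simp
    then show ?thesis using prod[OF s(1,3)] by metis
  qed
  moreover have "qK * qP \<noteq> 0" using rP rK by (simp add: reduced_family_def)
  ultimately show ?thesis using w unfolding reduced_family_def by blast
qed

section \<open>Limits of homogeneous coordinates\<close>

text \<open>Families indexed by \<open>nat\<close> encode a sequence (indices \<open>Suc n\<close>) together with its
  prospective limit (index \<open>0\<close>).\<close>
definition poly_conv :: "(nat \<Rightarrow> real poly) \<Rightarrow> bool" where
  "poly_conv A \<longleftrightarrow> (\<forall>k. (\<lambda>n. coeff (A (Suc n)) k) \<longlonglongrightarrow> coeff (A 0) k)"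

definition subfamily :: "(nat \<Rightarrow> nat) \<Rightarrow> nat \<Rightarrow> nat" where
  "subfamily r n = (case n of 0 \<Rightarrow> 0 | Suc m \<Rightarrow> Suc (r m))"

lemma subfamily_simps [simp]: "subfamily r 0 = 0" "subfamily r (Suc n) = Suc (r n)"
  by (simp_all add: subfamily_def)

lemma poly_conv_const: "poly_conv (\<lambda>_. p)"
  by (simp add: poly_conv_def)

lemma poly_conv_add: "poly_conv A \<Longrightarrow> poly_conv B \<Longrightarrow> poly_conv (\<lambda>n. A n + B n)"
  by (auto simp: poly_conv_def intro: tendsto_add)

lemma poly_conv_diff: "poly_conv A \<Longrightarrow> poly_conv B \<Longrightarrow> poly_conv (\<lambda>n. A n - B n)"
  by (auto simp: poly_conv_def intro: tendsto_diff)

lemma poly_conv_uminus: "poly_conv A \<Longrightarrow> poly_conv (\<lambda>n. - A n)"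
  by (auto simp: poly_conv_def intro: tendsto_minus)

lemma poly_conv_mult: "poly_conv A \<Longrightarrow> poly_conv B \<Longrightarrow> poly_conv (\<lambda>n. A n * B n)"
  unfolding poly_conv_def coeff_mult by (intro allI tendsto_sum tendsto_mult) auto

lemma poly_conv_unique:
  assumes "poly_conv A" "poly_conv B" "\<And>n. A (Suc n) = B (Suc n)"
  shows "A 0 = B 0"
proof (rule poly_eqI)
  fix k
  have "(\<lambda>n. coeff (B (Suc n)) k) \<longlonglongrightarrow> coeff (A 0) k" "(\<lambda>n. coeff (B (Suc n)) k) \<longlonglongrightarrow> coeff (B 0) k"
    using assms by (simp_all add: poly_conv_def)
  then show "coeff (A 0) k = coeff (B 0) k" by (rule LIMSEQ_unique)
qed

lemma poly_conv_subfamily: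
  assumes "poly_conv A" "strict_mono r"
  shows "poly_conv (\<lambda>n. A (subfamily r n))"
  unfolding poly_conv_def
proof
  fix k
  have "(\<lambda>n. coeff (A (Suc n)) k) \<longlonglongrightarrow> coeff (A 0) k" using assms(1) by (simp add: poly_conv_def)
  from LIMSEQ_subseq_LIMSEQ[OF this assms(2)]
  show "(\<lambda>n. coeff (A (subfamily r (Suc n))) k) \<longlonglongrightarrow> coeff (A (subfamily r 0)) k"
    by (simp add: o_def)
qed

text \<open>The representations are not in lowest terms: a common factor may appear at index
  \<open>0\<close>, so the reduced forms need not converge. What must not happen is a denominator
  vanishing identically in the limit.\<close>

definition fract_conv :: "(nat \<Rightarrow> tf) \<Rightarrow> bool" where
  "fract_conv f \<longleftrightarrow> (\<exists>A B. poly_conv A \<and> poly_conv B \<and>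
     (\<forall>n. B n \<noteq> 0 \<and> to_fract (B n) * f n = to_fract (A n)))"

lemma fract_convI:
  "poly_conv A \<Longrightarrow> poly_conv B \<Longrightarrow> (\<And>n. B n \<noteq> 0) \<Longrightarrow> (\<And>n. to_fract (B n) * f n = to_fract (A n)) \<Longrightarrow> fract_conv f"
  by (auto simp: fract_conv_def)

lemma fract_conv_const: "fract_conv (\<lambda>_. f)"
  by (rule fract_convI[where A = "\<lambda>_. tf_num f" and B = "\<lambda>_. tf_den f"])
    (simp_all add: poly_conv_const to_fract_den_mult)

lemma fract_conv_ring: "ring_closed fract_conv"
  unfolding ring_closed_def
proof (intro conjI allI impI)
  fix f g assume "fract_conv f"
  then obtain A B where f: "poly_conv A" "poly_conv B" "\<And>n. B n \<noteq> 0" "\<And>n. to_fract (B n) * f n = to_fract (A n)"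
    by (auto simp: fract_conv_def)
  show "fract_conv (\<lambda>n. - f n)"
    by (rule fract_convI[where A = "\<lambda>n. - A n" and B = B]) (simp_all add: f poly_conv_uminus)
  assume "fract_conv g"
  then obtain C D where g: "poly_conv C" "poly_conv D" "\<And>n. D n \<noteq> 0" "\<And>n. to_fract (D n) * g n = to_fract (C n)"
    by (auto simp: fract_conv_def)
  show "fract_conv (\<lambda>n. f n + g n)"
  proof (rule fract_convI[where A = "\<lambda>n. A n * D n + C n * B n" and B = "\<lambda>n. B n * D n"])
    show "to_fract (B n * D n) * (f n + g n) = to_fract (A n * D n + C n * B n)" for n
      by (rule fract_op_eqs(2)[OF f(4) g(4)])
  qed (simp_all add: f g poly_conv_add poly_conv_mult)
  show "fract_conv (\<lambda>n. f n * g n)"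
  proof (rule fract_convI[where A = "\<lambda>n. A n * C n" and B = "\<lambda>n. B n * D n"])
    show "to_fract (B n * D n) * (f n * g n) = to_fract (A n * C n)" for n
      by (rule fract_op_eqs(3)[OF f(4) g(4)])
  qed (simp_all add: f g poly_conv_mult)
qed (simp_all add: fract_conv_const)

lemma fract_conv_graph_minor:
  assumes M: "\<And>n. M n \<in> carrier_mat r c"
    and ent: "\<And>i j. i < r \<Longrightarrow> j < c \<Longrightarrow> fract_conv (\<lambda>n. M n $$ (i,j))"
    and \<sigma>: "\<And>i. i < c \<Longrightarrow> \<sigma> i < c + r"
  shows "fract_conv (\<lambda>n. graph_minor (M n) \<sigma>)"
  unfolding graph_minor_def
proof (rule ring_closed_det[OF fract_conv_ring])
  show "graph_mat (M n) \<sigma> \<in> carrier_mat c c" for n by (rule graph_mat_carrier[OF M])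
  fix i j assume ij: "i < c" "j < c"
  have "graph_mat (M n) \<sigma> $$ (i,j) = (if \<sigma> i < c then if \<sigma> i = j then 1 else 0 else M n $$ (\<sigma> i - c, j))" for n
    using M[of n] ij by (auto simp: graph_mat_def)
  moreover have "\<sigma> i - c < r" if "\<not> \<sigma> i < c" using that \<sigma>[OF ij(1)] by linarith
  ultimately show "fract_conv (\<lambda>n. graph_mat (M n) \<sigma> $$ (i,j))"
    using ent[OF _ ij(2)] by (cases "\<sigma> i < c") (simp_all add: fract_conv_const)
qed

section \<open>Compactness of normalised coordinates\<close>

lemma common_convergent_subseq:
  fixes u :: "nat \<Rightarrow> 'i \<Rightarrow> real"
  assumes "finite I" and "\<And>n i. i \<in> I \<Longrightarrow> \<bar>u n i\<bar> \<le> B"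
  shows "\<exists>r l. strict_mono r \<and> (\<forall>i\<in>I. (\<lambda>n. u (r n) i) \<longlonglongrightarrow> l i)"
  using assms
proof (induction I rule: finite_induct)
  case empty
  show ?case by (intro exI[of _ id]) (auto simp: strict_mono_def)
next
  case (insert i I)
  then obtain r l where r: "strict_mono r" "\<forall>i\<in>I. (\<lambda>n. u (r n) i) \<longlonglongrightarrow> l i" by auto
  have "bounded (range (\<lambda>n. u (r n) i))"
    using insert.prems by (auto simp: bounded_iff)
  then obtain l' r' where r': "strict_mono r'" "(\<lambda>n. u (r (r' n)) i) \<longlonglongrightarrow> l'"
    using bounded_imp_convergent_subsequence[of "\<lambda>n. u (r n) i"] by (auto simp: o_def)
  have "(\<lambda>n. u ((r \<circ> r') n) j) \<longlonglongrightarrow> (l(i := l')) j" if j: "j \<in> insert i I" for j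
  proof (cases "j = i")
    case True
    then show ?thesis using r'(2) by simp
  next
    case False
    then have "(\<lambda>n. u (r n) j) \<longlonglongrightarrow> l j" using r(2) j by simp
    from LIMSEQ_subseq_LIMSEQ[OF this r'(1)] show ?thesis using False by (simp add: o_def)
  qed
  then show ?case using strict_mono_o[OF r(1) r'(1)] by blast
qed

lemma ex_cpoly_root:
  assumes "degree p > 0"
  shows "\<exists>s. cpoly p s = 0"
proof -
  have "degree (map_poly complex_of_real p) \<noteq> 0"
    using assms by (simp add: degree_map_poly)
  then have "\<not> constant (poly (map_poly complex_of_real p))"
    by (simp add: constant_degree)
  then show ?thesis by (rule fundamental_theorem_of_algebra)
qed

lemma cpoly_smult [simp]: "cpoly (Polynomial.smult c p) s = of_real c * cpoly p s"
proof -
  have "map_poly complex_of_real (Polynomial.smult c p) = Polynomial.smult (of_real c) (map_poly of_real p)"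
    by (simp add: poly_eq_iff coeff_map_poly)
  then show ?thesis by simp
qed

lemma to_fract_smult: "to_fract (Polynomial.smult c p) = tf_const c * to_fract p"
  by (simp add: tf_const_def flip: to_fract_mult)

lemma reduced_family_scale:
  assumes "reduced_family S \<phi> q \<delta> w" "c \<noteq> 0"
  shows "reduced_family S \<phi> (Polynomial.smult c q) \<delta> (\<lambda>\<sigma>. Polynomial.smult c (w \<sigma>))"
  using assms unfolding reduced_family_def by (simp add: to_fract_smult mult.assoc)

text \<open>Put \<open>p / q = a / b\<close> in lowest terms. A root of \<open>b\<close> would be a
  zero of every \<open>w \<sigma>\<close>, and a nonconstant \<open>a\<close> would push a
  coordinate of full degree beyond \<open>\<delta>\<close>.\<close>

lemma reduced_family_unique:
  assumes red: "reduced_family S \<phi> q \<delta> w" and p: "p \<noteq> 0"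
    and v: "\<And>\<sigma>. \<sigma> \<in> S \<Longrightarrow> to_fract p * \<phi> \<sigma> = to_fract (v \<sigma>)" "\<And>\<sigma>. \<sigma> \<in> S \<Longrightarrow> degree (v \<sigma>) \<le> \<delta>"
  shows "\<exists>c. c \<noteq> 0 \<and> (\<forall>\<sigma>\<in>S. v \<sigma> = Polynomial.smult c (w \<sigma>))"
proof -
  define f where "f = Fract p q"
  have q: "q \<noteq> 0" using red by (simp add: reduced_family_def)
  define a b where "a = tf_num f" and "b = tf_den f"
  have ab: "a * q = p * b" using tf_eq_iff[OF q] by (auto simp: f_def a_def b_def)
  have b0: "b \<noteq> 0" by (simp add: b_def)
  have a0: "a \<noteq> 0" using ab b0 p by auto
  have eq: "b * v \<sigma> = a * w \<sigma>" if "\<sigma> \<in> S" for \<sigma>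
  proof -
    have w: "to_fract q * \<phi> \<sigma> = to_fract (w \<sigma>)" using red that by (simp add: reduced_family_def)
    have "to_fract (q * (b * v \<sigma>)) = to_fract (p * b) * (to_fract q * \<phi> \<sigma>)"
      by (simp add: v(1)[OF that, symmetric] ac_simps)
    also have "\<dots> = to_fract (a * q) * to_fract (w \<sigma>)"
      by (simp only: w ab)
    also have "\<dots> = to_fract (q * (a * w \<sigma>))"
      by (simp add: ac_simps)
    finally show ?thesis using q by (simp del: to_fract_mult)
  qed
  have "degree b = 0"
  proof (rule ccontr)
    assume "degree b \<noteq> 0"
    then obtain s where s: "cpoly b s = 0" using ex_cpoly_root by blast
    obtain \<sigma> where \<sigma>: "\<sigma> \<in> S" "cpoly (w \<sigma>) s \<noteq> 0" using red unfolding reduced_family_def by blast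
    have "b dvd a * w \<sigma>" by (rule dvdI) (rule eq[OF \<sigma>(1), symmetric])
    then have "b dvd w \<sigma>"
      using coprime_num_den[of f] coprime_commute coprime_dvd_mult_right_iff unfolding a_def b_def by blast
    then show False using s \<sigma>(2) by auto
  qed
  moreover have "degree a = 0"
  proof -
    obtain \<sigma> where \<sigma>: "\<sigma> \<in> S" "coeff (w \<sigma>) \<delta> \<noteq> 0" using red unfolding reduced_family_def by blast
    then have "\<delta> \<le> degree (w \<sigma>)" "w \<sigma> \<noteq> 0" using le_degree by auto
    moreover have "degree (b * v \<sigma>) \<le> \<delta>"
      using degree_mult_le[of b "v \<sigma>"] v(2)[OF \<sigma>(1)] \<open>degree b = 0\<close> by simp
    ultimately show ?thesis using eq[OF \<sigma>(1)] a0 by (simp add: degree_mult_eq)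
  qed
  ultimately obtain ca cb where cs: "a = [:ca:]" "b = [:cb:]" by (metis degree_eq_zeroE)
  have nz: "ca \<noteq> 0" "cb \<noteq> 0" using a0 b0 cs by auto
  have "v \<sigma> = Polynomial.smult (ca / cb) (w \<sigma>)" if "\<sigma> \<in> S" for \<sigma>
  proof -
    have "Polynomial.smult (inverse cb) (Polynomial.smult cb (v \<sigma>)) = Polynomial.smult (inverse cb) (Polynomial.smult ca (w \<sigma>))"
      using eq[OF that] by (simp add: cs)
    then show ?thesis using nz by (simp add: field_simps)
  qed
  then show ?thesis using nz by (intro exI[of _ "ca / cb"]) auto
qed

text \<open>Constancy of \<open>\<delta>\<close> enters here: normalised homogeneous coordinates have a convergent
  subsequence, and a limit of degree at most \<open>\<delta>\<close> has no room for a cancelled common factor.\<close>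
lemma reduced_family_compactness:
  fixes \<phi> :: "'s \<Rightarrow> nat \<Rightarrow> tf"
  assumes fin: "finite S" and \<sigma>0: "\<sigma>0 \<in> S" "\<And>n. \<phi> \<sigma>0 n = 1"
    and conv: "\<And>\<sigma>. \<sigma> \<in> S \<Longrightarrow> fract_conv (\<phi> \<sigma>)"
    and red: "\<And>n. reduced_family S (\<lambda>\<sigma>. \<phi> \<sigma> n) (q n) \<delta> (w n)"
  obtains r q' w' where "strict_mono r"
    "\<And>n. reduced_family S (\<lambda>\<sigma>. \<phi> \<sigma> (subfamily r n)) (q' n) \<delta> (w' n)"
    "\<And>\<sigma>. \<sigma> \<in> S \<Longrightarrow> poly_conv (\<lambda>n. w' n \<sigma>)"
proof -
  define N where "N n = (\<Sum>\<sigma>\<in>S. \<Sum>k\<le>\<delta>. \<bar>coeff (w (Suc n) \<sigma>) k\<bar>)" for n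
  have rw: "to_fract (q n) * \<phi> \<sigma> n = to_fract (w n \<sigma>)" "degree (w n \<sigma>) \<le> \<delta>" if "\<sigma> \<in> S" for n \<sigma>
    using red[of n] that by (auto simp: reduced_family_def)
  have le_N: "\<bar>coeff (w (Suc n) \<sigma>) k\<bar> \<le> N n" if "\<sigma> \<in> S" "k \<le> \<delta>" for n \<sigma> k
  proof -
    have "\<bar>coeff (w (Suc n) \<sigma>) k\<bar> \<le> (\<Sum>k\<le>\<delta>. \<bar>coeff (w (Suc n) \<sigma>) k\<bar>)"
      using that by (intro member_le_sum) auto
    also have "\<dots> \<le> N n"
      unfolding N_def using that fin by (intro member_le_sum[of \<sigma> S "\<lambda>\<sigma>. \<Sum>k\<le>\<delta>. \<bar>coeff (w (Suc n) \<sigma>) k\<bar>"])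
        (auto intro: sum_nonneg)
    finally show ?thesis .
  qed
  have N_pos: "N n > 0" for n
  proof -
    obtain \<sigma> where "\<sigma> \<in> S" "coeff (w (Suc n) \<sigma>) \<delta> \<noteq> 0"
      using red[of "Suc n"] unfolding reduced_family_def by blast
    then show ?thesis using le_N[of \<sigma> \<delta> n] by auto
  qed
  define u where "u n = (\<lambda>(\<sigma>,k). coeff (w (Suc n) \<sigma>) k / N n)" for n
  have u_le: "\<bar>u n i\<bar> \<le> 1" if "i \<in> S \<times> {..\<delta>}" for n i
    using that le_N N_pos[of n] by (auto simp: u_def divide_le_eq)
  obtain r l where r: "strict_mono r" and l: "\<forall>i\<in>S\<times>{..\<delta>}. (\<lambda>n. u (r n) i) \<longlonglongrightarrow> l i"
    using common_convergent_subseq[of "S \<times> {..\<delta>}" u 1] fin u_le by auto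
  define v where "v \<sigma> = (\<Sum>k\<le>\<delta>. monom (l (\<sigma>, k)) k)" for \<sigma>
  have cv: "coeff (v \<sigma>) k = (if k \<le> \<delta> then l (\<sigma>, k) else 0)" for \<sigma> k
    by (simp add: v_def coeff_sum)
  have dv: "degree (v \<sigma>) \<le> \<delta>" for \<sigma>
    by (rule degree_le) (simp add: cv)
  have lim: "(\<lambda>n. coeff (Polynomial.smult (1 / N (r n)) (w (Suc (r n)) \<sigma>)) k) \<longlonglongrightarrow> coeff (v \<sigma>) k"
    if "\<sigma> \<in> S" for \<sigma> k
  proof (cases "k \<le> \<delta>")
    case True
    then show ?thesis using bspec[OF l, of "(\<sigma>, k)"] that by (simp add: cv u_def)
  next
    case False
    then have "coeff (w n \<sigma>) k = 0" for n
      using rw(2)[OF that, of n] by (intro coeff_eq_0) linarith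
    then show ?thesis using False by (simp add: cv)
  qed
  define W where "W \<sigma> n = (case n of 0 \<Rightarrow> v \<sigma> | Suc n \<Rightarrow> Polynomial.smult (1 / N (r n)) (w (Suc (r n)) \<sigma>))" for \<sigma> n
  have W: "poly_conv (W \<sigma>)" if "\<sigma> \<in> S" for \<sigma>
    using lim[OF that] by (simp add: poly_conv_def W_def)
  have wq: "w n \<sigma>0 = q n" for n
    using rw(1)[OF \<sigma>0(1), of n] \<sigma>0(2) by simp
  \<comment> \<open>The relation \<open>w n \<sigma>0 * A n = w n \<sigma> * B n\<close> is
    homogeneous in \<open>w n\<close>, so it also holds for the normalised coordinates and passes to
    the limit.\<close>
  have vv: "to_fract (v \<sigma>0) * \<phi> \<sigma> 0 = to_fract (v \<sigma>)" if \<sigma>: "\<sigma> \<in> S" for \<sigma>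
  proof -
    obtain A B where AB: "poly_conv A" "poly_conv B" "\<And>n. B n \<noteq> 0" "\<And>n. to_fract (B n) * \<phi> \<sigma> n = to_fract (A n)"
      using conv[OF \<sigma>] by (auto simp: fract_conv_def)
    have "w n \<sigma>0 * A n = w n \<sigma> * B n" for n
    proof -
      have "to_fract (w n \<sigma>0 * A n) = to_fract (q n) * (to_fract (B n) * \<phi> \<sigma> n)"
        by (simp add: wq AB(4))
      also have "\<dots> = to_fract (w n \<sigma> * B n)"
        by (simp add: rw(1)[OF \<sigma>, symmetric] ac_simps)
      finally show ?thesis by (simp del: to_fract_mult)
    qed
    then have "W \<sigma>0 (Suc n) * A (subfamily r (Suc n)) = W \<sigma> (Suc n) * B (subfamily r (Suc n))" for n
      by (simp add: W_def)
    then have "W \<sigma>0 0 * A (subfamily r 0) = W \<sigma> 0 * B (subfamily r 0)"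
      using poly_conv_unique[OF poly_conv_mult[OF W[OF \<sigma>0(1)] poly_conv_subfamily[OF AB(1) r]]
          poly_conv_mult[OF W[OF \<sigma>] poly_conv_subfamily[OF AB(2) r]]] by blast
    then have eq: "v \<sigma>0 * A 0 = v \<sigma> * B 0" by (simp add: W_def)
    have "to_fract (B 0) * (to_fract (v \<sigma>0) * \<phi> \<sigma> 0) = to_fract (v \<sigma>0) * (to_fract (B 0) * \<phi> \<sigma> 0)"
      by (simp only: ac_simps)
    also have "\<dots> = to_fract (v \<sigma>0 * A 0)" by (simp add: AB(4))
    also have "\<dots> = to_fract (B 0) * to_fract (v \<sigma>)" unfolding eq by simp
    finally have "to_fract (B 0) * (to_fract (v \<sigma>0) * \<phi> \<sigma> 0) = to_fract (B 0) * to_fract (v \<sigma>)" .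
    then show ?thesis using AB(3)[of 0] by simp
  qed
  \<comment> \<open>Otherwise all limit coordinates vanish by \<open>vv\<close>, whereas the
    absolute values of the normalised coefficients sum to \<open>1\<close>.\<close>
  have "v \<sigma>0 \<noteq> 0"
  proof
    assume "v \<sigma>0 = 0"
    then have v0: "v \<sigma> = 0" if "\<sigma> \<in> S" for \<sigma> using vv[OF that] by simp
    have "(\<lambda>n. \<Sum>\<sigma>\<in>S. \<Sum>k\<le>\<delta>. \<bar>coeff (Polynomial.smult (1 / N (r n)) (w (Suc (r n)) \<sigma>)) k\<bar>) \<longlonglongrightarrow>
        (\<Sum>\<sigma>\<in>S. \<Sum>k\<le>\<delta>. \<bar>coeff (v \<sigma>) k\<bar>)"
      by (intro tendsto_sum tendsto_rabs lim)
    moreover have "(\<Sum>\<sigma>\<in>S. \<Sum>k\<le>\<delta>. \<bar>coeff (Polynomial.smult (1 / N (r n)) (w (Suc (r n)) \<sigma>)) k\<bar>) = 1" for n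
    proof -
      have "(\<Sum>\<sigma>\<in>S. \<Sum>k\<le>\<delta>. \<bar>coeff (Polynomial.smult (1 / N (r n)) (w (Suc (r n)) \<sigma>)) k\<bar>) =
          (\<Sum>\<sigma>\<in>S. \<Sum>k\<le>\<delta>. \<bar>coeff (w (Suc (r n)) \<sigma>) k\<bar> / N (r n))"
        using N_pos[of "r n"] by (intro sum.cong refl) simp
      also have "\<dots> = N (r n) / N (r n)"
        unfolding sum_divide_distrib[symmetric] by (simp only: N_def)
      then show ?thesis using N_pos[of "r n"] by simp
    qed
    ultimately have "(\<lambda>n. 1) \<longlonglongrightarrow> (0::real)" using v0 by simp
    then show False by (simp add: LIMSEQ_const_iff)
  qed
  then obtain c where c: "c \<noteq> 0" "\<forall>\<sigma>\<in>S. v \<sigma> = Polynomial.smult c (w 0 \<sigma>)"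
    using reduced_family_unique[OF red[of 0], of "v \<sigma>0" v] vv dv by blast
  \<comment> \<open>At index \<open>0\<close> the scalar \<open>c\<close> matches the coordinates of
    the limit system with the limit \<open>v\<close> found by compactness.\<close>
  define a where "a n = (case n of 0 \<Rightarrow> c | Suc n \<Rightarrow> 1 / N (r n))" for n
  have a: "a n \<noteq> 0" for n
  proof (cases n)
    case (Suc m)
    then show ?thesis using N_pos[of "r m"] by (simp add: a_def)
  qed (use c(1) in \<open>simp add: a_def\<close>)
  show ?thesis
  proof (rule that[OF r])
    show "reduced_family S (\<lambda>\<sigma>. \<phi> \<sigma> (subfamily r n)) (Polynomial.smult (a n) (q (subfamily r n))) \<delta>
        (\<lambda>\<sigma>. Polynomial.smult (a n) (w (subfamily r n) \<sigma>))" for n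
      by (rule reduced_family_scale[OF red a])
    show "poly_conv (\<lambda>n. Polynomial.smult (a n) (w (subfamily r n) \<sigma>))" if "\<sigma> \<in> S" for \<sigma>
      using W[OF that] c(2) that by (simp add: poly_conv_def W_def a_def)
  qed
qed

section \<open>The closed loop\<close>

definition cleared_conv :: "(nat \<Rightarrow> real poly) \<Rightarrow> nat \<Rightarrow> (nat \<Rightarrow> tf) \<Rightarrow> (nat \<Rightarrow> real poly) \<Rightarrow> bool" where
  "cleared_conv q \<delta> f h \<longleftrightarrow> poly_conv h \<and> (\<forall>n. degree (h n) \<le> \<delta> \<and> to_fract (q n) * f n = to_fract (h n))"

text \<open>The last two conclusions say that \<open>\<kappa>\<close> has no modes hidden from
  \<open>G\<close>. They use a coordinate \<open>w n \<sigma>\<close> of full degree, or nonzero at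
  \<open>s\<close>: over the denominator \<open>\<kappa> n\<close> it is a polynomial expression in
  the entries of \<open>G n\<close>, hence proper, or analytic at \<open>s\<close>.\<close>

lemma closed_loop_polynomials:
  fixes M G :: "nat \<Rightarrow> tf mat" and N :: nat
  defines "S \<equiv> {..<N} \<rightarrow>\<^sub>E {..<N + N}"
  assumes M: "\<And>n. M n \<in> carrier_mat N N" and G: "\<And>n. G n \<in> carrier_mat N N"
    and eq: "\<And>n. G n = 1\<^sub>m N + M n * G n" and inv: "\<And>n. (1\<^sub>m N - M n) * G n = 1\<^sub>m N"
    and red: "\<And>n. reduced_family S (graph_minor (M n)) (q n) \<delta> (w n)"
    and conv: "\<And>\<sigma>. \<sigma> \<in> S \<Longrightarrow> poly_conv (\<lambda>n. w n \<sigma>)"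
  obtains \<kappa> H where "poly_conv \<kappa>" "\<And>n. degree (\<kappa> n) \<le> \<delta>" "\<And>n. \<kappa> n \<noteq> 0"
    "\<And>i j. i < N \<Longrightarrow> j < N \<Longrightarrow> poly_conv (H i j)"
    "\<And>n i j. i < N \<Longrightarrow> j < N \<Longrightarrow> to_fract (\<kappa> n) * G n $$ (i,j) = to_fract (H i j n)"
    "\<And>n. (\<And>i j. i < N \<Longrightarrow> j < N \<Longrightarrow> tf_proper (G n $$ (i,j))) \<Longrightarrow> degree (\<kappa> n) = \<delta>"
    "\<And>n s. (\<And>i j. i < N \<Longrightarrow> j < N \<Longrightarrow> analytic_at_point s (G n $$ (i,j))) \<Longrightarrow> cpoly (\<kappa> n) s \<noteq> 0"
proof -
  have w: "to_fract (q n) * graph_minor (M n) \<sigma> = to_fract (w n \<sigma>)" "degree (w n \<sigma>) \<le> \<delta>"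
    if "\<sigma> \<in> S" for n \<sigma>
    using red[of n] that by (auto simp: reduced_family_def)
  have q: "q n \<noteq> 0" for n using red[of n] by (simp add: reduced_family_def)
  define Q where "Q f \<longleftrightarrow> (\<exists>h. cleared_conv q \<delta> f h)" for f
  have mixed: "Q (\<lambda>n. det (mixed_mat (M n) \<tau>))" if \<tau>: "\<And>i. i < N \<Longrightarrow> \<tau> i < 3 * N" for \<tau>
  proof (rule det_mixed_mat_closed[OF M _ _ \<tau>])
    fix f g assume "Q f" "Q g"
    then obtain hf hg where "cleared_conv q \<delta> f hf" "cleared_conv q \<delta> g hg" by (auto simp: Q_def)
    then have "cleared_conv q \<delta> (\<lambda>n. f n - g n) (\<lambda>n. hf n - hg n)"
      by (simp add: cleared_conv_def poly_conv_diff degree_diff_le algebra_simps)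
    then show "Q (\<lambda>n. f n - g n)" unfolding Q_def by blast
  next
    fix \<tau> :: "nat \<Rightarrow> nat" assume \<tau>: "\<And>i. i < N \<Longrightarrow> \<tau> i < 2 * N"
    define \<sigma> where "\<sigma> = restrict \<tau> {..<N}"
    have \<sigma>: "\<sigma> \<in> S" using \<tau> by (auto simp: \<sigma>_def S_def mult_2)
    have "graph_minor (M n) \<sigma> = graph_minor (M n) \<tau>" for n
      using graph_minor_restrict[of "M n" \<tau>] M[of n] by (simp add: \<sigma>_def)
    then have "cleared_conv q \<delta> (\<lambda>n. graph_minor (M n) \<tau>) (\<lambda>n. w n \<sigma>)"
      using w[OF \<sigma>] conv[OF \<sigma>] by (simp add: cleared_conv_def)
    then show "Q (\<lambda>n. graph_minor (M n) \<tau>)" unfolding Q_def by blast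
  qed
  have "Q (\<lambda>n. det (1\<^sub>m N - M n))"
    using mixed[of "\<lambda>k. 2 * N + k"] mixed_mat_one_minus[OF M] by simp
  then obtain \<kappa> where \<kappa>: "cleared_conv q \<delta> (\<lambda>n. det (1\<^sub>m N - M n)) \<kappa>"
    by (auto simp: Q_def)
  have "\<exists>h. cleared_conv q \<delta> (\<lambda>n. det (1\<^sub>m N - M n) * G n $$ (i,j)) h" if "i < N" "j < N" for i j
    using mixed[of "\<lambda>k. if k = j then i else 2 * N + k"] inverse_entry_mixed[OF M G inv that] that
    by (simp add: Q_def)
  then obtain H where H: "\<And>i j. i < N \<Longrightarrow> j < N \<Longrightarrow>
      cleared_conv q \<delta> (\<lambda>n. det (1\<^sub>m N - M n) * G n $$ (i,j)) (H i j)" by metis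
  have A: "1\<^sub>m N - M n \<in> carrier_mat N N" for n by (rule minus_carrier_mat[OF M])
  have dAG: "det (1\<^sub>m N - M n) * det (G n) = 1" for n
    using det_mult[OF A G, of n n] by (simp add: inv)
  have \<kappa>_eq: "to_fract (q n) * det (1\<^sub>m N - M n) = to_fract (\<kappa> n)" for n
    using \<kappa> by (simp add: cleared_conv_def)
  have \<kappa>0: "\<kappa> n \<noteq> 0" for n
    using \<kappa>_eq[of n] q[of n] dAG[of n] by auto
  \<comment> \<open>\<open>det (G n)\<close> is inverse to \<open>det (1\<^sub>m N - M n)\<close>,
    so the minor times \<open>det (G n)\<close> equals
    \<open>w n \<sigma> / \<kappa> n\<close>.\<close>
  have \<kappa>_minor: "to_fract (\<kappa> n) * (graph_minor (M n) \<sigma> * det (G n)) = to_fract (w n \<sigma>)"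
    if "\<sigma> \<in> S" for n \<sigma>
  proof -
    have "to_fract (\<kappa> n) * (graph_minor (M n) \<sigma> * det (G n)) =
        (to_fract (q n) * graph_minor (M n) \<sigma>) * (det (1\<^sub>m N - M n) * det (G n))"
      unfolding \<kappa>_eq[symmetric] by (simp only: ac_simps)
    then show ?thesis by (simp add: dAG w(1)[OF that])
  qed
  have \<kappa>_minor': "\<kappa> n * tf_num (graph_minor (M n) \<sigma> * det (G n)) =
      w n \<sigma> * tf_den (graph_minor (M n) \<sigma> * det (G n))" if "\<sigma> \<in> S" for n \<sigma>
    using \<kappa>_minor[OF that] by (simp only: to_fract_mult_eq_iff)
  have S_lt: "\<sigma> i < N + N" if "\<sigma> \<in> S" "i < N" for \<sigma> i using that by (auto simp: S_def)
  show ?thesis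
  proof (rule that[of \<kappa> H])
    show "poly_conv \<kappa>" "\<And>n. degree (\<kappa> n) \<le> \<delta>" using \<kappa> by (simp_all add: cleared_conv_def)
    show "\<And>n. \<kappa> n \<noteq> 0" by (rule \<kappa>0)
    show "poly_conv (H i j)" if "i < N" "j < N" for i j
      using H[OF that] by (simp add: cleared_conv_def)
    show "to_fract (\<kappa> n) * G n $$ (i,j) = to_fract (H i j n)" if "i < N" "j < N" for n i j
      using H[OF that] by (simp add: cleared_conv_def \<kappa>_eq[symmetric] mult.assoc)
    show "degree (\<kappa> n) = \<delta>" if proper: "\<And>i j. i < N \<Longrightarrow> j < N \<Longrightarrow> tf_proper (G n $$ (i,j))" for n
    proof (rule antisym)
      show "degree (\<kappa> n) \<le> \<delta>" using \<kappa> by (simp add: cleared_conv_def)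
      obtain \<sigma> where \<sigma>: "\<sigma> \<in> S" "coeff (w n \<sigma>) \<delta> \<noteq> 0"
        using red[of n] unfolding reduced_family_def by blast
      let ?f = "graph_minor (M n) \<sigma> * det (G n)"
      have pr: "tf_proper ?f"
        by (rule det_mult_graph_minor_closed[OF tf_proper_ring M G eq])
          (use proper S_lt[OF \<sigma>(1)] in auto)
      have w0: "w n \<sigma> \<noteq> 0" "\<delta> \<le> degree (w n \<sigma>)" using \<sigma>(2) le_degree by auto
      have f0: "?f \<noteq> 0"
      proof
        assume "?f = 0"
        then have "to_fract (w n \<sigma>) = 0" using \<kappa>_minor[OF \<sigma>(1), of n] by (metis mult_zero_right)
        then show False using w0 by simp
      qed
      then have "tf_num ?f \<noteq> 0" using tf_num_eq_0_iff by blast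
      then have "degree (\<kappa> n) + degree (tf_num ?f) = degree (\<kappa> n * tf_num ?f)"
        by (rule degree_mult_eq[OF \<kappa>0, symmetric])
      also have "\<dots> = degree (w n \<sigma> * tf_den ?f)" using \<kappa>_minor'[OF \<sigma>(1), of n] by simp
      also have "\<dots> = degree (w n \<sigma>) + degree (tf_den ?f)"
        by (rule degree_mult_eq[OF w0(1) tf_den_nonzero])
      finally have "degree (\<kappa> n) + degree (tf_num ?f) = degree (w n \<sigma>) + degree (tf_den ?f)" .
      then show "\<delta> \<le> degree (\<kappa> n)" using pr w0(2) by (simp add: tf_proper_def)
    qed
    show "cpoly (\<kappa> n) s \<noteq> 0"
      if an: "\<And>i j. i < N \<Longrightarrow> j < N \<Longrightarrow> analytic_at_point s (G n $$ (i,j))" for n s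
    proof
      assume 0: "cpoly (\<kappa> n) s = 0"
      obtain \<sigma> where \<sigma>: "\<sigma> \<in> S" "cpoly (w n \<sigma>) s \<noteq> 0"
        using red[of n] unfolding reduced_family_def by blast
      let ?f = "graph_minor (M n) \<sigma> * det (G n)"
      have "analytic_at_point s ?f"
        by (rule det_mult_graph_minor_closed[OF analytic_at_point_ring M G eq])
          (use an S_lt[OF \<sigma>(1)] in auto)
      moreover have "cpoly (\<kappa> n) s * cpoly (tf_num ?f) s = cpoly (w n \<sigma>) s * cpoly (tf_den ?f) s"
        using arg_cong[OF \<kappa>_minor'[OF \<sigma>(1), of n], of "\<lambda>p. cpoly p s"] by (simp only: cpoly_mult)
      ultimately show False using 0 \<sigma>(2) by (simp add: analytic_at_point_def)
    qed
  qed
qed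

section \<open>Hurwitz polynomials\<close>

lemma cpoly_cnj: "cpoly p (cnj s) = cnj (cpoly p s)"
  by (simp add: cpoly_sum[OF order.refl])

lemma continuous_cpoly [continuous_intros]:
  "continuous_on A f \<Longrightarrow> continuous_on A (\<lambda>x. cpoly p (f x))"
  unfolding cpoly_sum[OF order.refl] by (intro continuous_intros)

lemma poly_conv_cpoly:
  assumes "poly_conv A" "\<And>n. degree (A n) \<le> d"
  shows "(\<lambda>n. cpoly (A (Suc n)) s) \<longlonglongrightarrow> cpoly (A 0) s"
  unfolding cpoly_sum[OF assms(2)]
  using assms(1) by (intro tendsto_sum tendsto_mult tendsto_of_real tendsto_const) (simp add: poly_conv_def)

text \<open>Here the degree is below \<open>d\<close>, and the gained factor
  \<open>1 + norm s\<close> becomes the decay that square integrability requires. The assumption on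
  coefficients includes \<open>d = 0\<close>, where it forces \<open>p = 0\<close>.\<close>

lemma norm_cpoly_le:
  assumes "\<And>k. d \<le> k \<Longrightarrow> coeff p k = 0"
  shows "norm (cpoly p s) * (1 + norm s) \<le> (\<Sum>k\<le>d. \<bar>coeff p k\<bar>) * (1 + norm s) ^ d"
proof -
  have deg: "degree p \<le> d" using assms by (intro degree_le) auto
  have "norm (cpoly p s) * (1 + norm s) \<le> (\<Sum>k\<le>d. \<bar>coeff p k\<bar> * norm s ^ k) * (1 + norm s)"
    unfolding cpoly_sum[OF deg]
    by (intro mult_right_mono order_trans[OF norm_sum] sum_mono) (auto simp: norm_mult norm_power)
  also have "\<dots> \<le> (\<Sum>k\<le>d. \<bar>coeff p k\<bar>) * (1 + norm s) ^ d"
    unfolding sum_distrib_right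
  proof (rule sum_mono)
    fix k assume k: "k \<in> {..d}"
    show "\<bar>coeff p k\<bar> * norm s ^ k * (1 + norm s) \<le> \<bar>coeff p k\<bar> * (1 + norm s) ^ d"
    proof (cases "k = d")
      case False
      have "norm s ^ k * (1 + norm s) \<le> (1 + norm s) ^ k * (1 + norm s)"
        by (intro mult_right_mono power_mono) auto
      also have "\<dots> = (1 + norm s) ^ Suc k" by simp
      also have "\<dots> \<le> (1 + norm s) ^ d" using k False by (intro power_increasing) auto
      finally show ?thesis by (simp add: mult.assoc mult_left_mono)
    qed (simp add: assms)
  qed
  finally show ?thesis .
qed

lemma norm_cpoly_le':
  assumes "degree p \<le> d"
  shows "norm (cpoly p s) \<le> (\<Sum>k\<le>d. \<bar>coeff p k\<bar>) * (1 + norm s) ^ d"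
  unfolding cpoly_sum[OF assms] sum_distrib_right
proof (rule order_trans[OF norm_sum], rule sum_mono)
  fix k assume "k \<in> {..d}"
  then have "norm s ^ k \<le> (1 + norm s) ^ d"
    by (intro order_trans[OF power_mono[of "norm s" "1 + norm s"] power_increasing]) auto
  then show "norm (complex_of_real (coeff p k) * s ^ k) \<le> \<bar>coeff p k\<bar> * (1 + norm s) ^ d"
    by (simp add: norm_mult norm_power mult_left_mono)
qed

definition hurwitz :: "real poly \<Rightarrow> bool" where
  "hurwitz p \<longleftrightarrow> (\<forall>s. Re s \<ge> 0 \<longrightarrow> cpoly p s \<noteq> 0)"

text \<open>In the closed right half plane every factor satisfies
  \<open>\<bar>s - z\<bar> \<ge> max (- Re z) (\<bar>s\<bar> - \<bar>z\<bar>)\<close>.\<close>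
lemma complex_hurwitz_lower_bound:
  fixes p :: "complex poly"
  assumes "\<And>s. Re s \<ge> 0 \<Longrightarrow> poly p s \<noteq> 0"
  shows "\<exists>c>0. \<forall>s. Re s \<ge> 0 \<longrightarrow> c * (1 + norm s) ^ degree p \<le> norm (poly p s)"
  using assms
proof (induction "degree p" arbitrary: p)
  case 0
  then obtain a where a: "p = [:a:]" using degree_eq_zeroE by metis
  with "0.prems"[of 0] have "a \<noteq> 0" by simp
  then show ?case using a by (intro exI[of _ "norm a"]) simp
next
  case (Suc d)
  then have "\<not> constant (poly p)" by (simp add: constant_degree)
  then obtain z where z: "poly p z = 0" using fundamental_theorem_of_algebra by blast
  then obtain q where q: "p = [:-z, 1:] * q" by (metis poly_eq_0_iff_dvd dvdE)
  have q0: "q \<noteq> 0" using q Suc.hyps(2) by auto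
  have "degree p = Suc (degree q)" unfolding q using q0 by (subst degree_mult_eq) auto
  then have dq: "d = degree q" using Suc.hyps(2) by simp
  have "poly q s \<noteq> 0" if "Re s \<ge> 0" for s using Suc.prems[OF that] q by auto
  with Suc.hyps(1)[OF dq] obtain c where c: "c > 0"
    "\<And>s. Re s \<ge> 0 \<Longrightarrow> c * (1 + norm s) ^ degree q \<le> norm (poly q s)" by blast
  define a where "a = - Re z"
  have a: "a > 0" using z Suc.prems[of z] by (force simp: a_def)
  \<comment> \<open>From \<open>1 + norm s \<le> (1 + norm z) + norm (s - z)\<close>, with the
    constant absorbed by \<open>1 \<le> norm (s - z) / a\<close>.\<close>
  define e where "e = (1 + norm z) / a + 1"
  have "(1 + norm z) / a > 0" using a by (simp add: add_pos_nonneg)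
  then have e: "e > 0" by (simp add: e_def)
  have fac: "inverse e * (1 + norm s) \<le> norm (s - z)" if s: "Re s \<ge> 0" for s
  proof -
    have "a \<le> Re (s - z)" using s by (simp add: a_def)
    also have "\<dots> \<le> norm (s - z)" by (rule complex_Re_le_cmod)
    finally have 1: "a \<le> norm (s - z)" .
    have "norm s \<le> norm (s - z) + norm z" using norm_triangle_ineq[of "s - z" z] by simp
    then have "1 + norm s \<le> (1 + norm z) / a * a + norm (s - z)" using a by simp
    also have "\<dots> \<le> (1 + norm z) / a * norm (s - z) + norm (s - z)"
      using 1 a by (intro add_right_mono mult_left_mono) auto
    also have "\<dots> = e * norm (s - z)" by (simp add: e_def algebra_simps)
    finally show ?thesis using e by (simp add: field_simps)
  qed
  have "inverse e * c * (1 + norm s) ^ degree p \<le> norm (poly p s)" if s: "Re s \<ge> 0" for s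
  proof -
    have "inverse e * c * (1 + norm s) ^ degree p = (inverse e * (1 + norm s)) * (c * (1 + norm s) ^ degree q)"
      using \<open>degree p = Suc (degree q)\<close> by simp
    also have "\<dots> \<le> norm (s - z) * norm (poly q s)"
      using fac[OF s] c(2)[OF s] c(1) e by (intro mult_mono) auto
    also have "\<dots> = norm (poly p s)" by (simp add: q flip: norm_mult) (simp add: algebra_simps)
    finally show ?thesis .
  qed
  then show ?case using c(1) e by (intro exI[of _ "inverse e * c"]) auto
qed

lemma hurwitz_lower_bound:
  assumes "hurwitz p"
  shows "\<exists>c>0. \<forall>s. Re s \<ge> 0 \<longrightarrow> c * (1 + norm s) ^ degree p \<le> norm (cpoly p s)"
  using complex_hurwitz_lower_bound[of "map_poly of_real p"] assms
  by (simp add: hurwitz_def degree_map_poly)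

text \<open>The difference from the limit also has degree at most \<open>d\<close>, so small
  coefficients make it small relative to \<open>(1 + norm s) ^ d\<close> uniformly in
  \<open>s\<close>; half of the constant survives. Equal degrees exclude roots running off to
  infinity.\<close>

lemma hurwitz_conv_lower_bound:
  assumes conv: "poly_conv \<kappa>" and deg: "\<And>n. degree (\<kappa> n) = d" and hw: "hurwitz (\<kappa> 0)"
  obtains c n0 where "c > 0"
    "\<And>n s. n \<ge> n0 \<Longrightarrow> Re s \<ge> 0 \<Longrightarrow> c * (1 + norm s) ^ d \<le> norm (cpoly (\<kappa> (Suc n)) s)"
proof -
  obtain c where c: "c > 0" "\<And>s. Re s \<ge> 0 \<Longrightarrow> c * (1 + norm s) ^ d \<le> norm (cpoly (\<kappa> 0) s)"
    using hurwitz_lower_bound[OF hw] deg by metis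
  have "(\<lambda>n. \<Sum>k\<le>d. \<bar>coeff (\<kappa> (Suc n) - \<kappa> 0) k\<bar>) \<longlonglongrightarrow> (\<Sum>k\<le>d. \<bar>coeff (\<kappa> 0 - \<kappa> 0) k\<bar>)"
    unfolding coeff_diff using conv by (intro tendsto_intros) (simp add: poly_conv_def)
  then have "(\<lambda>n. \<Sum>k\<le>d. \<bar>coeff (\<kappa> (Suc n) - \<kappa> 0) k\<bar>) \<longlonglongrightarrow> 0" by simp
  then have "\<forall>\<^sub>F n in sequentially. (\<Sum>k\<le>d. \<bar>coeff (\<kappa> (Suc n) - \<kappa> 0) k\<bar>) < c / 2"
    using c(1) by (intro order_tendstoD(2)) auto
  then obtain n0 where n0: "\<And>n. n \<ge> n0 \<Longrightarrow> (\<Sum>k\<le>d. \<bar>coeff (\<kappa> (Suc n) - \<kappa> 0) k\<bar>) < c / 2"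
    by (auto simp: eventually_sequentially)
  show ?thesis
  proof (rule that[of "c / 2" n0])
    fix n and s :: complex assume n: "n \<ge> n0" and s: "Re s \<ge> 0"
    have "cpoly (\<kappa> (Suc n)) s = cpoly (\<kappa> 0) s + cpoly (\<kappa> (Suc n) - \<kappa> 0) s"
      by (simp flip: cpoly_add)
    then have "norm (cpoly (\<kappa> 0) s) \<le> norm (cpoly (\<kappa> (Suc n)) s) + norm (cpoly (\<kappa> (Suc n) - \<kappa> 0) s)"
      by (metis add_diff_cancel_right' norm_triangle_ineq4)
    moreover have "norm (cpoly (\<kappa> (Suc n) - \<kappa> 0) s) \<le>
        (\<Sum>k\<le>d. \<bar>coeff (\<kappa> (Suc n) - \<kappa> 0) k\<bar>) * (1 + norm s) ^ d"
      by (rule norm_cpoly_le') (simp add: deg degree_diff_le)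
    moreover have "\<dots> \<le> c / 2 * (1 + norm s) ^ d"
      using n0[OF n] by (intro mult_right_mono) auto
    ultimately show "c / 2 * (1 + norm s) ^ d \<le> norm (cpoly (\<kappa> (Suc n)) s)"
      using c(2)[OF s] by simp
  qed (use c(1) in auto)
qed

text \<open>All roots of a Hurwitz polynomial satisfy \<open>\<bar>s - z\<bar> \<ge> Re s\<close> for \<open>Re s \<ge> 0\<close>; unlike the
  Hurwitz property itself, the resulting estimate passes to limits.\<close>
lemma complex_hurwitz_Re_bound:
  fixes p :: "complex poly"
  assumes "\<And>s. Re s \<ge> 0 \<Longrightarrow> poly p s \<noteq> 0" and s: "Re s \<ge> 0"
  shows "norm (lead_coeff p) * Re s ^ degree p \<le> norm (poly p s)"
  using assms(1)
proof (induction "degree p" arbitrary: p)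
  case 0
  then obtain a where "p = [:a:]" using degree_eq_zeroE by metis
  then show ?case by simp
next
  case (Suc d)
  then have "\<not> constant (poly p)" by (simp add: constant_degree)
  then obtain z where z: "poly p z = 0" using fundamental_theorem_of_algebra by blast
  then obtain q where q: "p = [:-z, 1:] * q" by (metis poly_eq_0_iff_dvd dvdE)
  have q0: "q \<noteq> 0" using q Suc.hyps(2) by auto
  have dp: "degree p = Suc (degree q)" unfolding q using q0 by (subst degree_mult_eq) auto
  then have dq: "d = degree q" using Suc.hyps(2) by simp
  have lc: "lead_coeff p = lead_coeff q" unfolding q by (subst lead_coeff_mult) simp
  have "poly q t \<noteq> 0" if "Re t \<ge> 0" for t using Suc.prems[OF that] q by auto
  then have IH: "norm (lead_coeff q) * Re s ^ degree q \<le> norm (poly q s)"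
    by (rule Suc.hyps(1)[OF dq])
  have "Re z < 0" using z Suc.prems[of z] by force
  then have "Re s \<le> Re (s - z)" by simp
  also have "\<dots> \<le> norm (s - z)" by (rule complex_Re_le_cmod)
  finally have "Re s * (norm (lead_coeff q) * Re s ^ degree q) \<le> norm (s - z) * norm (poly q s)"
    using IH s by (intro mult_mono) auto
  also have "\<dots> = norm (poly p s)" by (simp add: q flip: norm_mult) (simp add: algebra_simps)
  also have "Re s * (norm (lead_coeff q) * Re s ^ degree q) = norm (lead_coeff p) * Re s ^ degree p"
    unfolding lc by (simp only: dp power_Suc ac_simps)
  finally show ?case .
qed

text \<open>At a zero of the limit with \<open>Re s > 0\<close> the bound of
  \<open>complex_hurwitz_Re_bound\<close> fails strictly, hence it fails for all late members, which
  then cannot be Hurwitz. Equal degrees keep the leading coefficient nonzero in the limit.\<close>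

lemma hurwitz_limit_root:
  assumes conv: "poly_conv \<kappa>" and deg: "\<And>n. degree (\<kappa> n) = d" and nz: "\<kappa> 0 \<noteq> 0"
    and freq: "\<exists>\<^sub>F n in sequentially. hurwitz (\<kappa> (Suc n))" and s: "Re s > 0"
  shows "cpoly (\<kappa> 0) s \<noteq> 0"
proof
  assume z: "cpoly (\<kappa> 0) s = 0"
  have le: "\<bar>coeff (\<kappa> (Suc n)) d\<bar> * Re s ^ d \<le> norm (cpoly (\<kappa> (Suc n)) s)" if "hurwitz (\<kappa> (Suc n))" for n
    using complex_hurwitz_Re_bound[of "map_poly of_real (\<kappa> (Suc n))" s] that s
    by (simp add: hurwitz_def degree_map_poly deg coeff_map_poly)
  have "coeff (\<kappa> 0) d \<noteq> 0" using nz deg[of 0] by (metis leading_coeff_0_iff)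
  have "(\<lambda>n. norm (cpoly (\<kappa> (Suc n)) s) - \<bar>coeff (\<kappa> (Suc n)) d\<bar> * Re s ^ d) \<longlonglongrightarrow>
      norm (cpoly (\<kappa> 0) s) - \<bar>coeff (\<kappa> 0) d\<bar> * Re s ^ d"
    using conv deg by (intro tendsto_intros poly_conv_cpoly[of _ d]) (auto simp: poly_conv_def)
  moreover have "norm (cpoly (\<kappa> 0) s) - \<bar>coeff (\<kappa> 0) d\<bar> * Re s ^ d < 0"
    using z s \<open>coeff (\<kappa> 0) d \<noteq> 0\<close> by simp
  ultimately have "\<forall>\<^sub>F n in sequentially. norm (cpoly (\<kappa> (Suc n)) s) - \<bar>coeff (\<kappa> (Suc n)) d\<bar> * Re s ^ d < 0"
    by (rule order_tendstoD(2))
  with freq have "\<exists>\<^sub>F n in sequentially. hurwitz (\<kappa> (Suc n)) \<and>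
      norm (cpoly (\<kappa> (Suc n)) s) - \<bar>coeff (\<kappa> (Suc n)) d\<bar> * Re s ^ d < 0"
    by (rule frequently_eventually_frequently)
  then show False using le by (auto dest!: frequently_ex) (smt (verit))
qed

section \<open>The \<open>H\<^sub>2\<close> integral\<close>

definition h2_density :: "tf mat \<Rightarrow> real \<Rightarrow> real" where
  "h2_density G \<omega> = (\<Sum>i<dim_row G. \<Sum>j<dim_col G. (norm (tf_eval (G $$ (i,j)) (\<i> * of_real \<omega>)))\<^sup>2)"

definition h2_integral :: "tf mat \<Rightarrow> ennreal" where
  "h2_integral G = (\<integral>\<^sup>+ \<omega>. ennreal (h2_density G \<omega>) \<partial>lborel)"

lemma tf_eval_cnj: "tf_eval f (cnj s) = cnj (tf_eval f s)"
  by (simp add: tf_eval_def cpoly_cnj)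

text \<open>Real coefficients make \<open>G(-i \<omega>)\<close> the complex conjugate of
  \<open>G(i \<omega>)\<close>, so the trace is the squared Frobenius norm.\<close>

lemma trace_eq_h2_density:
  "Re (mat_trace (tfm_eval G (\<i> * complex_of_real \<omega>)
     * transpose_mat (tfm_eval G (- (\<i> * complex_of_real \<omega>))))) = h2_density G \<omega>"
proof -
  have "tf_eval f (- (\<i> * complex_of_real \<omega>)) = cnj (tf_eval f (\<i> * of_real \<omega>))" for f
    using tf_eval_cnj[of f "\<i> * of_real \<omega>"] by simp
  moreover have "Re z * Re z + Im z * Im z = (norm z)\<^sup>2" for z
    unfolding cmod_power2 by (simp add: power2_eq_square)
  ultimately show ?thesis
    by (simp add: mat_trace_def tfm_eval_def h2_density_def scalar_prod_def atLeast0LessThan)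
qed

lemma H2_norm_sq_altdef:
  "H2_norm_sq G = (if tfm_stable G then enn2ereal (ennreal (1 / (2 * pi)) * h2_integral G) else \<infinity>)"
  unfolding H2_norm_sq_def trace_eq_h2_density h2_integral_def ..

lemma measurable_cpoly [measurable]: "(\<lambda>\<omega>. cpoly p (\<i> * complex_of_real \<omega>)) \<in> borel_measurable borel"
  by (intro borel_measurable_continuous_onI continuous_intros)

lemma measurable_tf_eval [measurable]: "(\<lambda>\<omega>. tf_eval f (\<i> * complex_of_real \<omega>)) \<in> borel_measurable borel"
  unfolding tf_eval_def by measurable

lemma measurable_h2_density [measurable]: "h2_density G \<in> borel_measurable borel"
  unfolding h2_density_def by measurable

text \<open>Roots on the imaginary axis form a finite set. At poles there \<open>tf_eval\<close>
  takes the default value of division by zero, which the integrals do not see.\<close>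

lemma AE_cpoly_nonzero:
  assumes "p \<noteq> 0"
  shows "AE \<omega> in lborel. cpoly p (\<i> * complex_of_real \<omega>) \<noteq> 0"
proof -
  have "map_poly complex_of_real p \<noteq> 0"
    using assms by (simp add: map_poly_eq_0_iff)
  then have "finite {s. cpoly p s = 0}" by (rule poly_roots_finite)
  moreover have "inj (\<lambda>\<omega>. \<i> * complex_of_real \<omega>)" by (auto simp: inj_on_def)
  ultimately have "finite ((\<lambda>\<omega>. \<i> * complex_of_real \<omega>) -` {s. cpoly p s = 0})"
    by (rule finite_vimageI)
  then have "{\<omega>. cpoly p (\<i> * complex_of_real \<omega>) = 0} \<in> null_sets lborel"
    by (intro countable_imp_null_set_lborel countable_finite) (simp add: vimage_def)
  then show ?thesis by (rule AE_I') auto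
qed

lemma nn_integral_inverse_1_plus_square: "(\<integral>\<^sup>+ \<omega>. ennreal (inverse (1 + \<omega>\<^sup>2)) \<partial>lborel) < \<infinity>"
proof -
  have "integrable lborel (\<lambda>x::real. inverse (1 + x\<^sup>2))"
    using integrable_inverse_1_plus_square by (simp add: set_integrable_def)
  then show ?thesis by (simp add: integrable_iff_bounded)
qed

text \<open>The real minimal polynomial of a common complex root would be a nonconstant common
  divisor.\<close>

lemma num_den_no_common_root:
  "cpoly (tf_den f) s = 0 \<Longrightarrow> cpoly (tf_num f) s \<noteq> 0"
proof
  assume "cpoly (tf_den f) s = 0" "cpoly (tf_num f) s = 0"
  then obtain m where m: "degree m > 0" "\<And>p. cpoly p s = 0 \<Longrightarrow> m dvd p"
    using ex_real_minimal_poly[OF tf_den_nonzero] by metis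
  then have "is_unit m"
    using coprime_num_den[of f] \<open>cpoly (tf_den f) s = 0\<close> \<open>cpoly (tf_num f) s = 0\<close>
      coprime_common_divisor by blast
  then show False using m(1) by (auto simp: is_unit_poly_iff)
qed

text \<open>Near a pole \<open>\<i> \<omega>0\<close> the density exceeds \<open>C / (\<omega> - \<omega>0)\<^sup>2\<close>; its integral over
  \<open>[\<omega>0 + h, \<omega>0 + 2 h]\<close> is of order \<open>1 / h\<close>.\<close>
lemma nn_integral_imaginary_pole:
  assumes pole: "cpoly (tf_den f) (\<i> * complex_of_real \<omega>0) = 0"
  shows "(\<integral>\<^sup>+ \<omega>. ennreal ((norm (tf_eval f (\<i> * complex_of_real \<omega>)))\<^sup>2) \<partial>lborel) = \<infinity>" (is "?I = \<infinity>")
proof -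
  define g where "g \<omega> = \<i> * complex_of_real \<omega>" for \<omega>
  have g_diff: "norm (g x - g y) = \<bar>x - y\<bar>" for x y
    by (simp add: g_def norm_mult flip: right_diff_distrib of_real_diff)
  have cont_g: "continuous_on A g" for A unfolding g_def by (intro continuous_intros)
  have "[:- g \<omega>0, 1:] dvd map_poly complex_of_real (tf_den f)"
    using pole by (simp add: poly_eq_0_iff_dvd g_def)
  then obtain q where q: "map_poly complex_of_real (tf_den f) = [:- g \<omega>0, 1:] * q"
    by (rule dvdE)
  have "compact ((\<lambda>\<omega>. poly q (g \<omega>)) ` {\<omega>0..\<omega>0 + 1})"
    by (intro compact_continuous_image continuous_intros cont_g) auto
  then have "bounded ((\<lambda>\<omega>. poly q (g \<omega>)) ` {\<omega>0..\<omega>0 + 1})" by (rule compact_imp_bounded)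
  then obtain C0 where C0: "\<forall>z\<in>(\<lambda>\<omega>. poly q (g \<omega>)) ` {\<omega>0..\<omega>0 + 1}. norm z \<le> C0"
    unfolding bounded_iff by blast
  define C where "C = max C0 1"
  have C: "C > 0" "\<And>\<omega>. \<omega> \<in> {\<omega>0..\<omega>0 + 1} \<Longrightarrow> norm (poly q (g \<omega>)) \<le> C"
    using C0 by (auto simp: C_def intro: max.coboundedI1)
  define a where "a = norm (cpoly (tf_num f) (g \<omega>0)) / 2"
  have a: "a > 0" using num_den_no_common_root[OF pole] by (simp add: a_def g_def)
  have "isCont (\<lambda>\<omega>. norm (cpoly (tf_num f) (g \<omega>))) \<omega>0"
    using continuous_on_norm[OF continuous_cpoly[OF cont_g[of UNIV]]] by (simp add: continuous_on_eq_continuous_at)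
  moreover have "a < norm (cpoly (tf_num f) (g \<omega>0))" using a by (simp add: a_def)
  ultimately have "\<forall>\<^sub>F \<omega> in at \<omega>0. a < norm (cpoly (tf_num f) (g \<omega>))"
    unfolding isCont_def by (rule order_tendstoD(1))
  then obtain \<eta>0 where \<eta>0: "\<eta>0 > 0" "\<And>\<omega>. \<omega> \<noteq> \<omega>0 \<Longrightarrow> dist \<omega> \<omega>0 < \<eta>0 \<Longrightarrow> a < norm (cpoly (tf_num f) (g \<omega>))"
    by (auto simp: eventually_at)
  define \<eta> where "\<eta> = min \<eta>0 1"
  have \<eta>: "\<eta> > 0" "\<eta> \<le> 1" "\<eta> \<le> \<eta>0" using \<eta>0(1) by (auto simp: \<eta>_def)
  have lower: "ennreal (a\<^sup>2 / (4 * C\<^sup>2 * h)) \<le> ?I" if h: "h > 0" "2 * h < \<eta>" for h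
  proof -
    \<comment> \<open>On the interval the numerator is at least \<open>a\<close> and the denominator
      at most \<open>C * (2 * h)\<close>; with length \<open>h\<close> this gives
      \<open>k * h\<close>.\<close>
    define k where "k = (a / (C * (2 * h)))\<^sup>2"
    have k0: "k \<ge> 0" by (simp add: k_def)
    have "ennreal (a\<^sup>2 / (4 * C\<^sup>2 * h)) = ennreal k * ennreal h"
      using h C(1) by (simp add: k_def power2_eq_square field_simps flip: ennreal_mult)
    also have "\<dots> = (\<integral>\<^sup>+ \<omega>. ennreal k * indicator {\<omega>0 + h..\<omega>0 + 2 * h} \<omega> \<partial>lborel)"
      using h by (simp add: nn_integral_cmult_indicator)
    also have "\<dots> \<le> ?I"
    proof (rule nn_integral_mono_AE)
      show "AE \<omega> in lborel. ennreal k * indicator {\<omega>0 + h..\<omega>0 + 2 * h} \<omega>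
          \<le> ennreal ((norm (tf_eval f (\<i> * complex_of_real \<omega>)))\<^sup>2)"
        using AE_cpoly_nonzero[OF tf_den_nonzero[of f]]
      proof eventually_elim
        fix \<omega> assume nz: "cpoly (tf_den f) (\<i> * complex_of_real \<omega>) \<noteq> 0"
        show "ennreal k * indicator {\<omega>0 + h..\<omega>0 + 2 * h} \<omega>
          \<le> ennreal ((norm (tf_eval f (\<i> * complex_of_real \<omega>)))\<^sup>2)"
        proof (cases "\<omega> \<in> {\<omega>0 + h..\<omega>0 + 2 * h}")
          case True
          have num: "a \<le> norm (cpoly (tf_num f) (g \<omega>))"
            using True h \<eta> by (intro less_imp_le \<eta>0(2)) (auto simp: dist_real_def)
          have "cpoly (tf_den f) (g \<omega>) = (g \<omega> - g \<omega>0) * poly q (g \<omega>)"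
            by (simp add: q algebra_simps)
          then have "norm (cpoly (tf_den f) (g \<omega>)) = \<bar>\<omega> - \<omega>0\<bar> * norm (poly q (g \<omega>))"
            by (simp add: norm_mult g_diff)
          also have "\<dots> \<le> (2 * h) * C"
            using True h \<eta> C by (intro mult_mono) auto
          finally have den: "norm (cpoly (tf_den f) (g \<omega>)) \<le> C * (2 * h)" by (simp add: mult.commute)
          have "a / (C * (2 * h)) \<le> norm (cpoly (tf_num f) (g \<omega>)) / norm (cpoly (tf_den f) (g \<omega>))"
            using num den nz a by (intro frac_le) (auto simp: g_def)
          also have "\<dots> = norm (tf_eval f (g \<omega>))" by (simp add: tf_eval_def norm_divide)
          finally have "k \<le> (norm (tf_eval f (g \<omega>)))\<^sup>2"
            unfolding k_def using a C(1) h by (intro power_mono) auto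
          then show ?thesis using True by (simp add: g_def ennreal_leI)
        qed simp
      qed
    qed
    finally show ?thesis .
  qed
  show ?thesis
  proof (rule ccontr)
    assume "?I \<noteq> \<infinity>"
    then obtain r where r: "r \<ge> 0" "?I = ennreal r" by (cases ?I) auto
    \<comment> \<open>The second argument pushes the lower bound to at least \<open>r + 1\<close>,
      above the supposed finite value \<open>r\<close>; the first keeps the interval inside the
      neighbourhood.\<close>
    define h where "h = min (\<eta> / 3) (a\<^sup>2 / (4 * C\<^sup>2 * (r + 1)))"
    have "h \<le> \<eta> / 3" by (simp add: h_def)
    then have h: "h > 0" "2 * h < \<eta>" using \<eta>(1) a C(1) r(1) by (simp_all add: h_def)
    have "0 < 4 * C\<^sup>2 * (r + 1)" "0 < 4 * C\<^sup>2 * h" using C(1) r(1) h(1) by auto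
    moreover have "h \<le> a\<^sup>2 / (4 * C\<^sup>2 * (r + 1))" by (simp add: h_def)
    ultimately have "r + 1 \<le> a\<^sup>2 / (4 * C\<^sup>2 * h)"
      by (simp only: pos_le_divide_eq ac_simps)
    moreover have "a\<^sup>2 / (4 * C\<^sup>2 * h) \<le> r"
      using lower[OF h] r h(1) by (simp add: ennreal_le_iff)
    ultimately show False by simp
  qed
qed

lemma h2_integral_imaginary_pole:
  assumes "i < dim_row G" "j < dim_col G" "cpoly (tf_den (G $$ (i,j))) (\<i> * complex_of_real \<omega>0) = 0"
  shows "h2_integral G = \<infinity>"
proof -
  have "(norm (tf_eval (G $$ (i,j)) (\<i> * of_real \<omega>)))\<^sup>2 \<le> h2_density G \<omega>" for \<omega>
  proof -
    have "(norm (tf_eval (G $$ (i,j)) (\<i> * of_real \<omega>)))\<^sup>2 \<le>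
        (\<Sum>j<dim_col G. (norm (tf_eval (G $$ (i,j)) (\<i> * of_real \<omega>)))\<^sup>2)"
      using assms by (intro member_le_sum) auto
    also have "\<dots> \<le> h2_density G \<omega>"
      unfolding h2_density_def using assms
      by (intro member_le_sum[of i _ "\<lambda>i. \<Sum>j<dim_col G. (norm (tf_eval (G $$ (i,j)) (\<i> * of_real \<omega>)))\<^sup>2"])
        (auto intro: sum_nonneg)
    finally show ?thesis .
  qed
  then have "(\<integral>\<^sup>+ \<omega>. ennreal ((norm (tf_eval (G $$ (i,j)) (\<i> * complex_of_real \<omega>)))\<^sup>2) \<partial>lborel) \<le> h2_integral G"
    unfolding h2_integral_def by (intro nn_integral_mono ennreal_leI)
  then show ?thesis using nn_integral_imaginary_pole[OF assms(3)] by (simp add: top_unique)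
qed

text \<open>Index \<open>0\<close> is the limit system. \<open>H_deg\<close> expresses strict
  properness through coefficients, so that \<open>d = 0\<close> correctly forces
  \<open>H i j n = 0\<close>.\<close>

locale convergent_system =
  fixes N d :: nat and G :: "nat \<Rightarrow> tf mat" and \<kappa> :: "nat \<Rightarrow> real poly"
    and H :: "nat \<Rightarrow> nat \<Rightarrow> nat \<Rightarrow> real poly"
  assumes G: "\<And>n. G n \<in> carrier_mat N N"
    and \<kappa>_conv: "poly_conv \<kappa>" and \<kappa>_deg: "\<And>n. degree (\<kappa> n) = d" and \<kappa>_nz: "\<And>n. \<kappa> n \<noteq> 0"
    and H_conv: "\<And>i j. i < N \<Longrightarrow> j < N \<Longrightarrow> poly_conv (H i j)"
    and H_eq: "\<And>n i j. i < N \<Longrightarrow> j < N \<Longrightarrow> to_fract (\<kappa> n) * G n $$ (i,j) = to_fract (H i j n)"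
    and H_deg: "\<And>n i j k. i < N \<Longrightarrow> j < N \<Longrightarrow> d \<le> k \<Longrightarrow> coeff (H i j n) k = 0"
begin

lemma h2_density_altdef:
  "h2_density (G n) \<omega> = (\<Sum>i<N. \<Sum>j<N. (norm (tf_eval (G n $$ (i,j)) (\<i> * of_real \<omega>)))\<^sup>2)"
  using G[of n] by (simp add: h2_density_def)

lemma eval_eq:
  "i < N \<Longrightarrow> j < N \<Longrightarrow> cpoly (\<kappa> n) s \<noteq> 0 \<Longrightarrow>
     tf_eval (G n $$ (i,j)) s = cpoly (H i j n) s / cpoly (\<kappa> n) s"
  by (rule tf_eval_eq[OF H_eq])

lemma h2_density_tendsto:
  assumes nz: "cpoly (\<kappa> 0) (\<i> * complex_of_real \<omega>) \<noteq> 0"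
  shows "(\<lambda>n. h2_density (G (Suc n)) \<omega>) \<longlonglongrightarrow> h2_density (G 0) \<omega>"
  unfolding h2_density_altdef
proof (intro tendsto_sum tendsto_power tendsto_norm)
  fix i j assume "i \<in> {..<N}" "j \<in> {..<N}"
  then have ij: "i < N" "j < N" by auto
  let ?s = "\<i> * complex_of_real \<omega>"
  have \<kappa>l: "(\<lambda>n. cpoly (\<kappa> (Suc n)) ?s) \<longlonglongrightarrow> cpoly (\<kappa> 0) ?s"
    by (rule poly_conv_cpoly[OF \<kappa>_conv, where d = d]) (simp add: \<kappa>_deg)
  have "degree (H i j n) \<le> d" for n
    by (rule degree_le) (use H_deg[OF ij] in auto)
  then have Hl: "(\<lambda>n. cpoly (H i j (Suc n)) ?s) \<longlonglongrightarrow> cpoly (H i j 0) ?s"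
    by (rule poly_conv_cpoly[OF H_conv[OF ij]])
  have "(\<lambda>n. cpoly (H i j (Suc n)) ?s / cpoly (\<kappa> (Suc n)) ?s) \<longlonglongrightarrow> tf_eval (G 0 $$ (i,j)) ?s"
    unfolding eval_eq[OF ij nz] by (rule tendsto_divide[OF Hl \<kappa>l nz])
  moreover have "\<forall>\<^sub>F n in sequentially. cpoly (\<kappa> (Suc n)) ?s \<noteq> 0"
    using tendsto_imp_eventually_ne[OF \<kappa>l nz] .
  then have "\<forall>\<^sub>F n in sequentially. cpoly (H i j (Suc n)) ?s / cpoly (\<kappa> (Suc n)) ?s = tf_eval (G (Suc n) $$ (i,j)) ?s"
    by eventually_elim (simp add: eval_eq[OF ij])
  ultimately show "(\<lambda>n. tf_eval (G (Suc n) $$ (i,j)) ?s) \<longlonglongrightarrow> tf_eval (G 0 $$ (i,j)) ?s"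
    by (rule Lim_transform_eventually)
qed

lemma AE_h2_density_tendsto:
  "AE \<omega> in lborel. (\<lambda>n. ennreal (h2_density (G (Suc n)) \<omega>)) \<longlonglongrightarrow> ennreal (h2_density (G 0) \<omega>)"
  using AE_cpoly_nonzero[OF \<kappa>_nz[of 0]]
  by eventually_elim (intro tendsto_ennrealI h2_density_tendsto)

lemma h2_integral_tendsto_hurwitz:
  assumes hw: "hurwitz (\<kappa> 0)"
  shows "(\<lambda>n. h2_integral (G (Suc n))) \<longlonglongrightarrow> h2_integral (G 0)"
proof -
  obtain c n0 where c: "c > 0" and low: "\<And>n s. n \<ge> n0 \<Longrightarrow> Re s \<ge> 0 \<Longrightarrow>
      c * (1 + norm s) ^ d \<le> norm (cpoly (\<kappa> (Suc n)) s)"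
    using hurwitz_conv_lower_bound[OF \<kappa>_conv \<kappa>_deg hw] by metis
  have "\<exists>B. \<forall>n. (\<Sum>k\<le>d. \<bar>coeff (H i j (Suc n)) k\<bar>) \<le> B" if "i < N" "j < N" for i j
  proof -
    have "(\<lambda>n. \<Sum>k\<le>d. \<bar>coeff (H i j (Suc n)) k\<bar>) \<longlonglongrightarrow> (\<Sum>k\<le>d. \<bar>coeff (H i j 0) k\<bar>)"
      using H_conv[OF that] by (intro tendsto_intros) (simp add: poly_conv_def)
    then have "Bseq (\<lambda>n. \<Sum>k\<le>d. \<bar>coeff (H i j (Suc n)) k\<bar>)"
      by (intro convergent_imp_Bseq convergentI)
    then obtain B where B: "\<forall>n. norm (\<Sum>k\<le>d. \<bar>coeff (H i j (Suc n)) k\<bar>) \<le> B"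
      unfolding Bseq_def by blast
    have "(\<Sum>k\<le>d. \<bar>coeff (H i j (Suc n)) k\<bar>) \<le> B" for n
      using spec[OF B, of n] by simp
    then show ?thesis by blast
  qed
  then obtain B where B: "\<And>i j n. i < N \<Longrightarrow> j < N \<Longrightarrow> (\<Sum>k\<le>d. \<bar>coeff (H i j (Suc n)) k\<bar>) \<le> B i j"
    by metis
  \<comment> \<open>The powers of \<open>1 + \<bar>\<omega>\<bar>\<close> in numerator and
    denominator cancel except for one, leaving \<open>B i j / c\<close> over
    \<open>1 + \<bar>\<omega>\<bar>\<close> as a bound for each entry.\<close>
  define K where "K = (\<Sum>i<N. \<Sum>j<N. (B i j / c)\<^sup>2)"
  have bound: "h2_density (G (Suc n)) \<omega> \<le> K * inverse (1 + \<omega>\<^sup>2)" if n: "n \<ge> n0" for n \<omega>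
  proof -
    let ?s = "\<i> * complex_of_real \<omega>"
    have "(norm (tf_eval (G (Suc n) $$ (i,j)) ?s))\<^sup>2 \<le> (B i j / c)\<^sup>2 * inverse (1 + \<omega>\<^sup>2)"
      if ij: "i < N" "j < N" for i j
    proof -
      have ns: "norm ?s = \<bar>\<omega>\<bar>" by (simp add: norm_mult)
      have pos: "0 < c * (1 + \<bar>\<omega>\<bar>) ^ d" using c by (simp add: add_pos_nonneg)
      have lo: "c * (1 + \<bar>\<omega>\<bar>) ^ d \<le> norm (cpoly (\<kappa> (Suc n)) ?s)"
        using low[OF n, of ?s] by (simp add: ns)
      then have nz: "cpoly (\<kappa> (Suc n)) ?s \<noteq> 0" using pos by auto
      have "norm (cpoly (H i j (Suc n)) ?s) * (1 + norm ?s) \<le> (\<Sum>k\<le>d. \<bar>coeff (H i j (Suc n)) k\<bar>) * (1 + norm ?s) ^ d"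
        by (rule norm_cpoly_le) (rule H_deg[OF ij])
      also have "\<dots> \<le> B i j * (1 + norm ?s) ^ d"
        by (rule mult_right_mono[OF B[OF ij]]) simp
      finally have up: "norm (cpoly (H i j (Suc n)) ?s) * (1 + \<bar>\<omega>\<bar>) \<le> B i j * (1 + \<bar>\<omega>\<bar>) ^ d"
        by (simp add: ns)
      have "norm (tf_eval (G (Suc n) $$ (i,j)) ?s) * (1 + \<bar>\<omega>\<bar>) =
          norm (cpoly (H i j (Suc n)) ?s) * (1 + \<bar>\<omega>\<bar>) / norm (cpoly (\<kappa> (Suc n)) ?s)"
        by (simp add: eval_eq[OF ij nz] norm_divide)
      also have "\<dots> \<le> B i j * (1 + \<bar>\<omega>\<bar>) ^ d / (c * (1 + \<bar>\<omega>\<bar>) ^ d)"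
        using up lo pos by (intro frac_le order_trans[OF _ up]) auto
      also have "\<dots> = B i j / c" using pos by (simp add: field_simps)
      finally have "(norm (tf_eval (G (Suc n) $$ (i,j)) ?s) * (1 + \<bar>\<omega>\<bar>))\<^sup>2 \<le> (B i j / c)\<^sup>2"
        by (intro power_mono) auto
      moreover have "1 + \<omega>\<^sup>2 \<le> (1 + \<bar>\<omega>\<bar>)\<^sup>2" by (simp add: power2_eq_square algebra_simps)
      then have "(norm (tf_eval (G (Suc n) $$ (i,j)) ?s))\<^sup>2 * (1 + \<omega>\<^sup>2) \<le>
          (norm (tf_eval (G (Suc n) $$ (i,j)) ?s))\<^sup>2 * (1 + \<bar>\<omega>\<bar>)\<^sup>2"
        by (intro mult_left_mono) auto
      ultimately have *: "(norm (tf_eval (G (Suc n) $$ (i,j)) ?s))\<^sup>2 * (1 + \<omega>\<^sup>2) \<le> (B i j / c)\<^sup>2"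
        by (simp add: power_mult_distrib)
      have "0 < 1 + \<omega>\<^sup>2" by (simp add: add_pos_nonneg)
      then show ?thesis using * by (simp add: pos_le_divide_eq flip: divide_inverse)
    qed
    then show ?thesis
      unfolding h2_density_altdef K_def sum_distrib_right by (intro sum_mono) auto
  qed
  have K: "K \<ge> 0" unfolding K_def by (intro sum_nonneg) auto
  \<comment> \<open>Domination holds only from \<open>n0\<close> on, hence the shifted
    sequence.\<close>
  have "(\<lambda>n. \<integral>\<^sup>+ \<omega>. ennreal (h2_density (G (Suc (n + n0))) \<omega>) \<partial>lborel) \<longlonglongrightarrow>
      (\<integral>\<^sup>+ \<omega>. ennreal (h2_density (G 0) \<omega>) \<partial>lborel)"
  proof (rule nn_integral_dominated_convergence)
    show "AE \<omega> in lborel. ennreal (h2_density (G (Suc (n + n0))) \<omega>) \<le> ennreal K * ennreal (inverse (1 + \<omega>\<^sup>2))" for n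
      using bound[of "n + n0"] K by (intro AE_I2) (simp add: ennreal_leI flip: ennreal_mult)
    show "(\<integral>\<^sup>+ \<omega>. ennreal K * ennreal (inverse (1 + \<omega>\<^sup>2)) \<partial>lborel) < \<infinity>"
      using nn_integral_inverse_1_plus_square
      by (subst nn_integral_cmult) (auto simp: ennreal_mult_less_top)
    show "AE \<omega> in lborel. (\<lambda>n. ennreal (h2_density (G (Suc (n + n0))) \<omega>)) \<longlonglongrightarrow> ennreal (h2_density (G 0) \<omega>)"
      using AE_h2_density_tendsto
    proof eventually_elim
      fix \<omega> assume "(\<lambda>n. ennreal (h2_density (G (Suc n)) \<omega>)) \<longlonglongrightarrow> ennreal (h2_density (G 0) \<omega>)"
      from LIMSEQ_ignore_initial_segment[OF this, of n0]
      show "(\<lambda>n. ennreal (h2_density (G (Suc (n + n0))) \<omega>)) \<longlonglongrightarrow> ennreal (h2_density (G 0) \<omega>)" .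
    qed
  qed measurable
  then have "(\<lambda>n. h2_integral (G (Suc (n + n0)))) \<longlonglongrightarrow> h2_integral (G 0)"
    by (simp add: h2_integral_def)
  then show ?thesis by (rule LIMSEQ_offset)
qed

text \<open>The densities converge almost everywhere whether or not the limit is stable, so Fatou's
  lemma applies on the stability boundary, where no dominating function exists.\<close>

lemma h2_integral_tendsto_infinity:
  assumes inf: "h2_integral (G 0) = \<infinity>"
  shows "(\<lambda>n. h2_integral (G (Suc n))) \<longlonglongrightarrow> \<infinity>"
proof -
  have "\<infinity> = (\<integral>\<^sup>+ \<omega>. ennreal (h2_density (G 0) \<omega>) \<partial>lborel)" using inf by (simp add: h2_integral_def)
  also have "\<dots> = (\<integral>\<^sup>+ \<omega>. liminf (\<lambda>n. ennreal (h2_density (G (Suc n)) \<omega>)) \<partial>lborel)"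
  proof (rule nn_integral_cong_AE)
    show "AE \<omega> in lborel. ennreal (h2_density (G 0) \<omega>) = liminf (\<lambda>n. ennreal (h2_density (G (Suc n)) \<omega>))"
      using AE_h2_density_tendsto
      by eventually_elim (simp add: lim_imp_Liminf)
  qed
  also have "\<dots> \<le> liminf (\<lambda>n. h2_integral (G (Suc n)))"
    unfolding h2_integral_def by (rule nn_integral_liminf) measurable
  finally have "liminf (\<lambda>n. h2_integral (G (Suc n))) = \<infinity>" by (simp add: top_unique)
  moreover from this have "limsup (\<lambda>n. h2_integral (G (Suc n))) = \<infinity>"
    using Liminf_le_Limsup[of sequentially "\<lambda>n. h2_integral (G (Suc n))"] by (simp add: top_unique)
  ultimately show ?thesis
    using tendsto_iff_Liminf_eq_Limsup[of sequentially "\<lambda>n. h2_integral (G (Suc n))" "\<infinity>"] by simp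
qed

lemma H2_norm_sq_tendsto:
  assumes sp: "\<And>n. tfm_strictly_proper (G n)"
    and pole: "\<And>n s. (\<And>i j. i < N \<Longrightarrow> j < N \<Longrightarrow> analytic_at_point s (G n $$ (i,j))) \<Longrightarrow> cpoly (\<kappa> n) s \<noteq> 0"
  shows "(\<lambda>n. H2_norm_sq (G (Suc n))) \<longlonglongrightarrow> H2_norm_sq (G 0)"
proof -
  have analytic: "analytic_at_point s (G n $$ (i,j))" if "i < N" "j < N" "cpoly (\<kappa> n) s \<noteq> 0" for n i j s
    by (rule analytic_at_pointI[OF H_eq[OF that(1,2)] that(3)])
  have proper: "tf_proper (G n $$ (i,j))" if "i < N" "j < N" for n i j
  proof -
    have "tf_strictly_proper (G n $$ (i,j))"
      using sp[of n] G[of n] that by (simp add: tfm_strictly_proper_def)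
    then show ?thesis by (auto simp: tf_strictly_proper_def tf_proper_def)
  qed
  have stable: "tfm_stable (G n) \<longleftrightarrow> hurwitz (\<kappa> n)" for n
  proof
    assume st: "tfm_stable (G n)"
    show "hurwitz (\<kappa> n)" unfolding hurwitz_def
    proof (intro allI impI pole)
      fix s i j assume s: "Re s \<ge> 0" and "i < N" "j < N"
      then have "\<forall>s\<in>tf_poles (G n $$ (i,j)). Re s < 0" using st G[of n] by (simp add: tfm_stable_def)
      then show "analytic_at_point s (G n $$ (i,j))"
        using s by (auto simp: tf_poles_def analytic_at_point_def)
    qed
  next
    assume hw: "hurwitz (\<kappa> n)"
    show "tfm_stable (G n)" unfolding tfm_stable_def
    proof (intro allI impI conjI ballI)
      fix i j assume ij: "i < dim_row (G n)" "j < dim_col (G n)"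
      then show "tf_proper (G n $$ (i,j))" using proper G[of n] by simp
      fix s assume s: "s \<in> tf_poles (G n $$ (i,j))"
      show "Re s < 0"
      proof (rule ccontr)
        assume "\<not> Re s < 0"
        then have "analytic_at_point s (G n $$ (i,j))"
          using analytic hw ij G[of n] by (simp add: hurwitz_def)
        then show False using s by (simp add: tf_poles_def analytic_at_point_def)
      qed
    qed
  qed
  note fin = ennreal_less_top[of "1 / (2 * pi)"]
  show ?thesis
  proof (cases "hurwitz (\<kappa> 0)")
    case True
    obtain c n0 where c: "c > 0" and low: "\<And>n s. n \<ge> n0 \<Longrightarrow> Re s \<ge> 0 \<Longrightarrow>
        c * (1 + norm s) ^ d \<le> norm (cpoly (\<kappa> (Suc n)) s)"
      using hurwitz_conv_lower_bound[OF \<kappa>_conv \<kappa>_deg True] by metis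
    have hw: "hurwitz (\<kappa> (Suc n))" if "n \<ge> n0" for n
      unfolding hurwitz_def
    proof (intro allI impI)
      fix s :: complex assume "Re s \<ge> 0"
      then have "c * (1 + norm s) ^ d \<le> norm (cpoly (\<kappa> (Suc n)) s)" by (rule low[OF that])
      moreover have "0 < c * (1 + norm s) ^ d" using c by (simp add: add_pos_nonneg)
      ultimately show "cpoly (\<kappa> (Suc n)) s \<noteq> 0" by auto
    qed
    have "(\<lambda>n. enn2ereal (ennreal (1 / (2 * pi)) * h2_integral (G (Suc n)))) \<longlonglongrightarrow>
        enn2ereal (ennreal (1 / (2 * pi)) * h2_integral (G 0))"
      by (intro tendsto_enn2erealI ennreal_tendsto_cmult[OF fin] h2_integral_tendsto_hurwitz True)
    moreover have "\<forall>\<^sub>F n in sequentially.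
        enn2ereal (ennreal (1 / (2 * pi)) * h2_integral (G (Suc n))) = H2_norm_sq (G (Suc n))"
      using eventually_ge_at_top[of n0]
      by eventually_elim (simp add: H2_norm_sq_altdef stable hw)
    moreover have "H2_norm_sq (G 0) = enn2ereal (ennreal (1 / (2 * pi)) * h2_integral (G 0))"
      by (simp add: H2_norm_sq_altdef stable True)
    ultimately show ?thesis by (simp only: Lim_transform_eventually)
  next
    case False
    then have inf: "H2_norm_sq (G 0) = \<infinity>" by (simp add: H2_norm_sq_altdef stable)
    show ?thesis
    proof (cases "\<exists>s. Re s > 0 \<and> cpoly (\<kappa> 0) s = 0")
      case True
      then have "\<not> (\<exists>\<^sub>F n in sequentially. hurwitz (\<kappa> (Suc n)))"
        using hurwitz_limit_root[OF \<kappa>_conv \<kappa>_deg \<kappa>_nz] by blast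
      then have "\<forall>\<^sub>F n in sequentially. \<not> hurwitz (\<kappa> (Suc n))" by (simp add: not_frequently)
      then have "\<forall>\<^sub>F n in sequentially. H2_norm_sq (G (Suc n)) = \<infinity>"
        by eventually_elim (simp add: H2_norm_sq_altdef stable)
      then show ?thesis unfolding inf by (rule tendsto_eventually)
    next
      case no_rhp: False
      \<comment> \<open>The pole is taken from the failure of stability, not from a zero of
        \<open>\<kappa> 0\<close>, so it is an uncancelled pole of an entry; as a zero of
        \<open>\<kappa> 0\<close> it must then lie on the imaginary axis.\<close>
      from False obtain i j s where ij: "i < N" "j < N" and s: "s \<in> tf_poles (G 0 $$ (i,j))" "\<not> Re s < 0"
        using proper[of _ _ 0] G[of 0] unfolding stable[symmetric] tfm_stable_def by auto
      have pole0: "cpoly (tf_den (G 0 $$ (i,j))) s = 0" using s(1) by (simp add: tf_poles_def)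
      then have "cpoly (\<kappa> 0) s = 0"
        using analytic[OF ij] by (auto simp: analytic_at_point_def)
      then have "Re s = 0" using no_rhp s(2) by (metis linorder_neqE_linordered_idom)
      then have s_eq: "s = \<i> * complex_of_real (Im s)" by (simp add: complex_eq_iff)
      have "h2_integral (G 0) = \<infinity>"
        using pole0 ij G[of 0] s_eq by (intro h2_integral_imaginary_pole[of i _ j "Im s"]) auto
      then have "(\<lambda>n. h2_integral (G (Suc n))) \<longlonglongrightarrow> \<infinity>" by (rule h2_integral_tendsto_infinity)
      then have "(\<lambda>n. enn2ereal (ennreal (1 / (2 * pi)) * h2_integral (G (Suc n)))) \<longlonglongrightarrow>
          enn2ereal (ennreal (1 / (2 * pi)) * \<infinity>)"
        by (intro tendsto_enn2erealI ennreal_tendsto_cmult[OF fin])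
      also have "enn2ereal (ennreal (1 / (2 * pi)) * \<infinity>) = \<infinity>"
        by (simp add: ennreal_mult_top)
      finally have lim: "(\<lambda>n. enn2ereal (ennreal (1 / (2 * pi)) * h2_integral (G (Suc n)))) \<longlonglongrightarrow> \<infinity>" .
      \<comment> \<open>Nearby systems may be stable or unstable; in either case the scaled integral
        is a lower bound, unstable ones having the value infinity.\<close>
      show ?thesis unfolding inf
        by (rule tendsto_sandwich[OF _ _ lim tendsto_const]) (simp_all add: H2_norm_sq_altdef)
    qed
  qed
qed

end

section \<open>Reduction to sequences of parameters\<close>

lemma strictly_proper_coeff_0:
  assumes "to_fract b * f = to_fract a" "b \<noteq> 0" "tf_strictly_proper f" "degree b \<le> k"
  shows "coeff a k = 0"
proof (cases "f = 0")
  case True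
  then have "to_fract a = 0" using assms(1) by simp
  then show ?thesis by simp
next
  case False
  have eq: "b * tf_num f = a * tf_den f" using assms(1) by (simp add: to_fract_mult_eq_iff)
  with False assms(2) have "a \<noteq> 0" by auto
  then have "degree b + degree (tf_num f) = degree a + degree (tf_den f)"
    using arg_cong[OF eq, of degree] False assms(2) by (simp add: degree_mult_eq)
  then show ?thesis using assms(3,4) False by (intro coeff_eq_0) (simp add: tf_strictly_proper_def)
qed

text \<open>Otherwise some subsequence stays outside a neighbourhood of \<open>l\<close>, and no
  further subsequence of it could converge to \<open>l\<close>.\<close>

lemma LIMSEQ_from_subseqs:
  fixes f :: "nat \<Rightarrow> 'a::topological_space"
  assumes "\<And>r :: nat \<Rightarrow> nat. strict_mono r \<Longrightarrow> \<exists>r' :: nat \<Rightarrow> nat. strict_mono r' \<and> (\<lambda>n. f (r (r' n))) \<longlonglongrightarrow> l"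
  shows "f \<longlonglongrightarrow> l"
proof (rule topological_tendstoI)
  fix U assume U: "open U" "l \<in> U"
  show "\<forall>\<^sub>F n in sequentially. f n \<in> U"
  proof (rule ccontr)
    assume "\<not> ?thesis"
    then have "infinite {n. f n \<notin> U}"
      by (simp add: not_eventually frequently_cofinite flip: cofinite_eq_sequentially)
    then obtain r :: "nat \<Rightarrow> nat" where r: "strict_mono r" "\<forall>n. f (r n) \<notin> U"
      using infinite_enumerate[of "{n. f n \<notin> U}"] by auto
    from assms[OF r(1)] obtain r' where "(\<lambda>n. f (r (r' n))) \<longlonglongrightarrow> l" by blast
    from topological_tendstoD[OF this U] r(2) show False by simp
  qed
qed

text \<open>Compactness selects the subsequence, but the limit \<open>H2_norm_sq (G a)\<close> does
  not depend on the selection.\<close>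

lemma H2_norm_sq_subseq:
  fixes P :: "tf mat" and K G :: "'a::metric_space \<Rightarrow> tf mat"
  assumes P: "P \<in> carrier_mat n1 n2"
    and K: "\<And>\<mu>. \<mu> \<in> D \<Longrightarrow> K \<mu> \<in> carrier_mat n2 n1"
    and fb: "\<And>\<mu>. \<mu> \<in> D \<Longrightarrow> feedback_interconnection n1 n2 P (K \<mu>) (G \<mu>)"
    and mcm: "\<And>\<mu>. \<mu> \<in> D \<Longrightarrow> mcmillan_degree (K \<mu>) = d"
    and den: "\<And>\<mu> i j. \<mu> \<in> D \<Longrightarrow> i < n2 \<Longrightarrow> j < n1 \<Longrightarrow> den \<mu> i j \<noteq> 0"
    and K_eq: "\<And>\<mu> i j. \<mu> \<in> D \<Longrightarrow> i < n2 \<Longrightarrow> j < n1 \<Longrightarrow> K \<mu> $$ (i,j) = Fract (num \<mu> i j) (den \<mu> i j)"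
    and num_cont: "\<And>i j k. i < n2 \<Longrightarrow> j < n1 \<Longrightarrow> continuous_on D (\<lambda>\<mu>. coeff (num \<mu> i j) k)"
    and den_cont: "\<And>i j k. i < n2 \<Longrightarrow> j < n1 \<Longrightarrow> continuous_on D (\<lambda>\<mu>. coeff (den \<mu> i j) k)"
    and sp: "\<And>\<mu>. \<mu> \<in> D \<Longrightarrow> tfm_strictly_proper (G \<mu>)"
    and x: "\<And>n. x n \<in> D" and a: "a \<in> D" and lim: "x \<longlonglongrightarrow> a"
  shows "\<exists>r. strict_mono r \<and> (\<lambda>n. H2_norm_sq (G (x (r n)))) \<longlonglongrightarrow> H2_norm_sq (G a)"
proof -
  define N where "N = n1 + n2"
  define y where "y n = (case n of 0 \<Rightarrow> a | Suc n \<Rightarrow> x n)" for n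
  have y: "y n \<in> D" for n using x a by (simp add: y_def split: nat.split)
  define M where "M n = feedback_mat n1 n2 P (K (y n))" for n
  have M: "M n \<in> carrier_mat N N" for n
    unfolding M_def N_def by (rule feedback_mat_carrier[OF P K[OF y]])
  have conv: "poly_conv (\<lambda>n. p (y n))" if "\<And>k. continuous_on D (\<lambda>\<mu>. coeff (p \<mu>) k)" for p
    unfolding poly_conv_def
  proof
    fix k
    have "(\<lambda>n. coeff (p (x n)) k) \<longlonglongrightarrow> coeff (p a) k"
      by (rule continuous_on_tendsto_compose[OF that lim a]) (simp add: x)
    then show "(\<lambda>n. coeff (p (y (Suc n))) k) \<longlonglongrightarrow> coeff (p (y 0)) k" by (simp add: y_def)
  qed
  have K_conv: "fract_conv (\<lambda>n. K (y n) $$ (i,j))" if ij: "i < n2" "j < n1" for i j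
  proof (rule fract_convI)
    show "poly_conv (\<lambda>n. num (y n) i j)" by (rule conv) (rule num_cont[OF ij])
    show "poly_conv (\<lambda>n. den (y n) i j)" by (rule conv) (rule den_cont[OF ij])
    show "den (y n) i j \<noteq> 0" for n by (rule den[OF y ij])
    then show "to_fract (den (y n) i j) * K (y n) $$ (i,j) = to_fract (num (y n) i j)" for n
      by (simp add: K_eq[OF y ij] Fract_conv_to_fract)
  qed
  have ent: "fract_conv (\<lambda>n. M n $$ (i,j))" if "i < N" "j < N" for i j
    using that K_conv[of "i - n1" j]
    by (cases "i < n1"; cases "j < n1")
      (simp_all add: M_def N_def feedback_mat_index[OF P K[OF y]] fract_conv_const)
  define S where "S = {..<N} \<rightarrow>\<^sub>E {..<N + N}"
  have S: "row_choices (M n) = S" for n using M[of n] by (auto simp: row_choices_def S_def)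
  obtain dP qP wP where rP: "reduced_family (row_choices P) (graph_minor P) qP dP wP"
    using mcmillan_reduced_family by blast
  \<comment> \<open>Constancy of the McMillan degree makes the degree bound \<open>d + dP\<close>
    the same for all \<open>n\<close>, the limit index \<open>0\<close> included.\<close>
  have "\<exists>w. reduced_family S (graph_minor (M n)) (pole_poly (K (y n)) * qP) (d + dP) w" for n
  proof -
    obtain wK where "reduced_family (row_choices (K (y n))) (graph_minor (K (y n))) (pole_poly (K (y n))) d wK"
      using mcmillan_reduced_family[of "K (y n)"] mcm[OF y] by auto
    from reduced_family_feedback[OF P K[OF y] rP this] show ?thesis
      by (simp add: S flip: M_def)
  qed
  then obtain w where red: "\<And>n. reduced_family S (graph_minor (M n)) (pole_poly (K (y n)) * qP) (d + dP) (w n)"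
    by metis
  define \<sigma>0 where "\<sigma>0 = restrict (\<lambda>i. i) {..<N}"
  have \<sigma>0: "\<sigma>0 \<in> S" "graph_minor (M n) \<sigma>0 = 1" for n
    using graph_minor_restrict[of "M n" "\<lambda>i. i"] M[of n] by (auto simp: \<sigma>0_def S_def graph_minor_id)
  have "finite S" unfolding S_def by (intro finite_PiE) auto
  have minor_conv: "fract_conv (\<lambda>n. graph_minor (M n) \<sigma>)" if "\<sigma> \<in> S" for \<sigma>
    by (rule fract_conv_graph_minor[OF M ent]) (use that in \<open>auto simp: S_def\<close>)
  obtain r q' w' where r: "strict_mono r"
    and red': "\<And>n. reduced_family S (graph_minor (M (subfamily r n))) (q' n) (d + dP) (w' n)"
    and conv': "\<And>\<sigma>. \<sigma> \<in> S \<Longrightarrow> poly_conv (\<lambda>n. w' n \<sigma>)"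
    using reduced_family_compactness[of S \<sigma>0 "\<lambda>\<sigma> n. graph_minor (M n) \<sigma>",
        OF \<open>finite S\<close> \<sigma>0 minor_conv red] by blast
  define G' where "G' n = G (y (subfamily r n))" for n
  define M' where "M' n = M (subfamily r n)" for n
  note inv = feedback_inverse[OF P K[OF y] fb[OF y], folded M_def N_def]
  have G': "G' n \<in> carrier_mat N N" for n unfolding G'_def by (rule inv(1))
  have sp': "tfm_strictly_proper (G' n)" for n unfolding G'_def by (rule sp[OF y])
  have spe: "tf_strictly_proper (G' n $$ (i,j))" if "i < N" "j < N" for n i j
    using sp'[of n] G'[of n] that by (simp add: tfm_strictly_proper_def)
  have M': "M' n \<in> carrier_mat N N" "G' n = 1\<^sub>m N + M' n * G' n" "(1\<^sub>m N - M' n) * G' n = 1\<^sub>m N" for n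
    unfolding M'_def G'_def by (rule M, rule inv(2), rule inv(3))
  obtain \<kappa> H where \<kappa>: "poly_conv \<kappa>" "\<And>n. degree (\<kappa> n) \<le> d + dP" "\<And>n. \<kappa> n \<noteq> 0"
    and H: "\<And>i j. i < N \<Longrightarrow> j < N \<Longrightarrow> poly_conv (H i j)"
      "\<And>n i j. i < N \<Longrightarrow> j < N \<Longrightarrow> to_fract (\<kappa> n) * G' n $$ (i,j) = to_fract (H i j n)"
    and \<kappa>_deg: "\<And>n. (\<And>i j. i < N \<Longrightarrow> j < N \<Longrightarrow> tf_proper (G' n $$ (i,j))) \<Longrightarrow> degree (\<kappa> n) = d + dP"
    and pole: "\<And>n s. (\<And>i j. i < N \<Longrightarrow> j < N \<Longrightarrow> analytic_at_point s (G' n $$ (i,j))) \<Longrightarrow> cpoly (\<kappa> n) s \<noteq> 0"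
    by (rule closed_loop_polynomials[OF M'(1) G' M'(2,3) red'[folded M'_def, unfolded S_def] conv'[unfolded S_def]])
      (assumption, (rule that; blast))
  have "tf_proper (G' n $$ (i,j))" if "i < N" "j < N" for n i j
    using spe[OF that, of n] by (auto simp: tf_strictly_proper_def tf_proper_def)
  then have deg: "degree (\<kappa> n) = d + dP" for n
    by (rule \<kappa>_deg)
  interpret convergent_system N "d + dP" G' \<kappa> H
  proof
    show "coeff (H i j n) k = 0" if "i < N" "j < N" "d + dP \<le> k" for n i j k
      using strictly_proper_coeff_0[OF H(2)[OF that(1,2)] \<kappa>(3) spe[OF that(1,2)]] that(3) by (simp add: deg)
  qed (use G' \<kappa> deg H in blast)+
  have "(\<lambda>n. H2_norm_sq (G' (Suc n))) \<longlonglongrightarrow> H2_norm_sq (G' 0)"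
    by (rule H2_norm_sq_tendsto[OF sp' pole])
  then show ?thesis using r by (auto simp: G'_def y_def)
qed

theorem theorem5:
  fixes n1 n2 :: nat
    and P :: "tf mat"
    and K :: "real^'p \<Rightarrow> tf mat"
    and G :: "real^'p \<Rightarrow> tf mat"
    and D :: "(real^'p) set"
  assumes P_dim: "P \<in> carrier_mat n1 n2"
    and K_dim: "\<forall>\<mu>\<in>D. K \<mu> \<in> carrier_mat n2 n1"
    and G_fb: "\<forall>\<mu>\<in>D. feedback_interconnection n1 n2 P (K \<mu>) (G \<mu>)"
    and mcmillan_const: "\<exists>d. \<forall>\<mu>\<in>D. mcmillan_degree (K \<mu>) = d"
    and K_rational_cont: "\<exists>num den :: real^'p \<Rightarrow> nat \<Rightarrow> nat \<Rightarrow> real poly. \<exists>N::nat.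
          \<forall>i<n2. \<forall>j<n1.
            (\<forall>\<mu>\<in>D. den \<mu> i j \<noteq> 0 \<and> degree (num \<mu> i j) \<le> N \<and> degree (den \<mu> i j) \<le> N
                    \<and> K \<mu> $$ (i,j) = Fract (num \<mu> i j) (den \<mu> i j))
          \<and> (\<forall>k. continuous_on D (\<lambda>\<mu>. coeff (num \<mu> i j) k)
                 \<and> continuous_on D (\<lambda>\<mu>. coeff (den \<mu> i j) k))"
    and G_sp: "\<forall>\<mu>\<in>D. tfm_strictly_proper (G \<mu>)"
  shows "continuous_on D (\<lambda>\<mu>. ereal (1/2) * H2_norm_sq (G \<mu>))"
proof -
  obtain d where d: "\<And>\<mu>. \<mu> \<in> D \<Longrightarrow> mcmillan_degree (K \<mu>) = d" using mcmillan_const by blast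
  obtain num den :: "real^'p \<Rightarrow> nat \<Rightarrow> nat \<Rightarrow> real poly" and N :: nat where nd: "\<forall>i<n2. \<forall>j<n1.
            (\<forall>\<mu>\<in>D. den \<mu> i j \<noteq> 0 \<and> degree (num \<mu> i j) \<le> N \<and> degree (den \<mu> i j) \<le> N
                    \<and> K \<mu> $$ (i,j) = Fract (num \<mu> i j) (den \<mu> i j))
          \<and> (\<forall>k. continuous_on D (\<lambda>\<mu>. coeff (num \<mu> i j) k)
                 \<and> continuous_on D (\<lambda>\<mu>. coeff (den \<mu> i j) k))"
    using K_rational_cont by blast
  show ?thesis
    unfolding continuous_on_sequentially
  proof (intro allI ballI impI, elim conjE)
    fix x :: "nat \<Rightarrow> real^'p" and a assume a: "a \<in> D" and x: "\<forall>n. x n \<in> D" "x \<longlonglongrightarrow> a"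
    have "(\<lambda>n. H2_norm_sq (G (x n))) \<longlonglongrightarrow> H2_norm_sq (G a)"
    proof (rule LIMSEQ_from_subseqs)
      fix r :: "nat \<Rightarrow> nat" assume r: "strict_mono r"
      show "\<exists>r'. strict_mono r' \<and> (\<lambda>n. H2_norm_sq (G (x (r (r' n))))) \<longlonglongrightarrow> H2_norm_sq (G a)"
      proof (rule H2_norm_sq_subseq[where x = "\<lambda>n. x (r n)" and D = D and K = K and den = den and num = num])
        show "(\<lambda>n. x (r n)) \<longlonglongrightarrow> a" using LIMSEQ_subseq_LIMSEQ[OF x(2) r] by (simp add: o_def)
      qed (use P_dim K_dim G_fb G_sp d nd a x(1) in blast)+
    qed
    then show "((\<lambda>\<mu>. ereal (1/2) * H2_norm_sq (G \<mu>)) \<circ> x) \<longlonglongrightarrow> ereal (1/2) * H2_norm_sq (G a)"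
      unfolding o_def by (intro tendsto_cmult_ereal) auto
  qed
qed

end
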